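(* Let $\alpha\ge-\frac12$. (i) (Plancherel formula) The $q$-Dunkl transform $F_D^{\alpha,q}$ is a linear isomorphism from $\mathcal{S}_q(\mathbb{R}_q)$ onto itself. Moreover, for all $f\in\mathcal{S}_q(\mathbb{R}_q)$, $$\|F_D^{\alpha,q}(f)\|_{2,\alpha,q}=\|f\|_{2,\alpha,q}.$$ (ii) (Plancherel theorem) The $q$-Dunkl transform can be uniquely extended to an isometric isomorphism of $L^2_{\alpha,q}(\mathbb{R}_q)$ onto itself. Its inverse transform $(F_D^{\alpha,q})^{-1}$ is given by $$(F_D^{\alpha,q})^{-1}(f)(x)=\frac{c_{\alpha,q}}{2}\int_{-\infty}^{+\infty}f(\lambda)\,\psi_\lambda^{\alpha,q}(x)\,|\lambda|^{2\alpha+1}\,d_q\lambda=F_D^{\alpha,q}(f)(-x),\qquad x\in\mathbb{R}_q.$$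
   Context: Standing assumptions: $q\in(0,1)$ and $\frac{\log(1-q)}{\log q}\in 2\mathbb{Z}$. Functions are complex-valued. $\mathbb{R}_q=\{\pm q^n: n\in\mathbb{Z}\}$. Notation: $(a;q)_\infty=\prod_{k\ge0}(1-aq^k)$, $[x]_q=\frac{1-q^x}{1-q}$, $\Gamma_{q^2}(x)=\frac{(q^2;q^2)_\infty}{(q^{2x};q^2)_\infty}(1-q^2)^{1-x}$, $c_{\alpha,q}=\frac{(1+q)^{-\alpha}}{\Gamma_{q^2}(\alpha+1)}$. $q$-Jackson integral: $\int_{-\infty}^{\infty}f(x)\,d_qx=(1-q)\sum_{n=-\infty}^{\infty}q^n[f(q^n)+f(-q^n)]$ (absolute convergence required). $q^2$-analogue differential operator: for $z\neq0$, $\partial_q f(z)=\frac{f(q^{-1}z)+f(-q^{-1}z)-f(qz)+f(-qz)-2f(-z)}{2(1-q)z}$; $\partial_q^n$ is its $n$-th iterate. $\mathcal{S}_q(\mathbb{R}_q)$ is the space of functions $f$ on $\mathbb{R}_q$ such that $\sup_{x\in\mathbb{R}_q}|x^m\partial_q^nf(x)|<\infty$ for all $n,m\in\mathbb{N}$ and $\lim_{x\to0,\,x\in\mathbb{R}_q}\partial_q^nf(x)$ exists for all $n\in\mathbb{N}$ (with $0\in\mathbb{N}$). For $p>0$, $L^p_{\alpha,q}(\mathbb{R}_q)$ is the space of functions $f$ on $\mathbb{R}_q$ with $\|f\|_{p,\alpha,q}=\left(\int_{-\infty}^\infty|f(x)|^p|x|^{2\alpha+1}d_qx\right)^{1/p}<\infty$.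 $j_\alpha(x;q^2)=\sum_{n\ge0}(-1)^n\frac{\Gamma_{q^2}(\alpha+1)q^{n(n+1)}}{\Gamma_{q^2}(\alpha+n+1)\Gamma_{q^2}(n+1)}\left(\frac{x}{1+q}\right)^{2n}$ and $\psi_\lambda^{\alpha,q}(x)=j_\alpha(\lambda x;q^2)+\frac{i\lambda x}{[2\alpha+2]_q}j_{\alpha+1}(\lambda x;q^2)$. $q$-Dunkl transform: $F_D^{\alpha,q}(f)(\lambda)=\frac{c_{\alpha,q}}{2}\int_{-\infty}^{+\infty}f(x)\psi_{-\lambda}^{\alpha,q}(x)|x|^{2\alpha+1}d_qx$ for $f\in L^1_{\alpha,q}(\mathbb{R}_q)$, $\lambda\in\mathbb{R}_q$. In (ii), the extension is that of $F_D^{\alpha,q}$ from the dense subspace $\mathcal{S}_q(\mathbb{R}_q)$ of $L^2_{\alpha,q}(\mathbb{R}_q)$, and in the last formula $F_D^{\alpha,q}$ denotes this extension. *)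

theory Defs
  imports "HOL-Analysis.Analysis"
begin

definition q_lattice :: "real \<Rightarrow> real set" where
  "q_lattice q = {x. \<exists>n::int. x = q powi n \<or> x = - (q powi n)}"

definition qpoch_inf :: "real \<Rightarrow> real \<Rightarrow> real" where
  "qpoch_inf a q = (\<Prod>k. 1 - a * q ^ k)"

definition q_number :: "real \<Rightarrow> real \<Rightarrow> real" where
  "q_number q x = (1 - q powr x) / (1 - q)"

text \<open>The $q^2$-Gamma function; the argument \<open>q\<close> is the unsquared base.\<close>

definition Gamma_q2 :: "real \<Rightarrow> real \<Rightarrow> real" where
  "Gamma_q2 q x =
     qpoch_inf (q\<^sup>2) (q\<^sup>2) / qpoch_inf (q powr (2 * x)) (q\<^sup>2) * (1 - q\<^sup>2) powr (1 - x)"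

definition c_const :: "real \<Rightarrow> real \<Rightarrow> real" where
  "c_const q \<alpha> = (1 + q) powr (- \<alpha>) / Gamma_q2 q (\<alpha> + 1)"

text \<open>The Jackson integral over the whole line. It is meaningful only for functions satisfying
  \<open>jackson_integrable\<close>, which is absolute convergence on both half-lines.\<close>

definition jackson_integrable :: "real \<Rightarrow> (real \<Rightarrow> 'a::real_normed_vector) \<Rightarrow> bool" where
  "jackson_integrable q f \<longleftrightarrow>
     (\<lambda>n::int. q powi n * (norm (f (q powi n)) + norm (f (- (q powi n))))) summable_on UNIV"

definition jackson_integral :: "real \<Rightarrow> (real \<Rightarrow> 'a::real_normed_vector) \<Rightarrow> 'a" where
  "jackson_integral q f =
     (1 - q) *\<^sub>R (\<Sum>\<^sub>\<infinity>n::int. q powi n *\<^sub>R (f (q powi n) + f (- (q powi n))))"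

definition q_deriv :: "real \<Rightarrow> (real \<Rightarrow> complex) \<Rightarrow> real \<Rightarrow> complex" where
  "q_deriv q f z =
     (f (inverse q * z) + f (- (inverse q * z)) - f (q * z) + f (- (q * z)) - 2 * f (- z))
       / complex_of_real (2 * (1 - q) * z)"

text \<open>A function on \<open>q_lattice q\<close> is represented by its extension by zero to all reals. This
  makes the representative unique and is preserved by the pointwise linear operations and by
  \<open>q_deriv q\<close> (at \<open>z = 0\<close> through division by zero).\<close>

definition lattice_fun :: "real \<Rightarrow> (real \<Rightarrow> complex) \<Rightarrow> bool" where
  "lattice_fun q f \<longleftrightarrow> (\<forall>x. x \<notin> q_lattice q \<longrightarrow> f x = 0)"

definition q_schwartz :: "real \<Rightarrow> (real \<Rightarrow> complex) set" where
  "q_schwartz q = {f. lattice_fun q f \<and>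
     (\<forall>n m. bdd_above ((\<lambda>x. norm (complex_of_real (x ^ m) * (q_deriv q ^^ n) f x)) ` q_lattice q)) \<and>
     (\<forall>n. \<exists>l. ((q_deriv q ^^ n) f \<longlongrightarrow> l) (at 0 within q_lattice q))}"

definition Lq :: "real \<Rightarrow> real \<Rightarrow> real \<Rightarrow> (real \<Rightarrow> complex) set" where
  "Lq p \<alpha> q = {f. lattice_fun q f \<and>
     jackson_integrable q (\<lambda>x. norm (f x) powr p * \<bar>x\<bar> powr (2 * \<alpha> + 1))}"

definition Lq_norm :: "real \<Rightarrow> real \<Rightarrow> real \<Rightarrow> (real \<Rightarrow> complex) \<Rightarrow> real" where
  "Lq_norm p \<alpha> q f =
     (jackson_integral q (\<lambda>x. norm (f x) powr p * \<bar>x\<bar> powr (2 * \<alpha> + 1))) powr (1 / p)"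

definition q_bessel :: "real \<Rightarrow> real \<Rightarrow> real \<Rightarrow> real" where
  "q_bessel q \<alpha> x =
     (\<Sum>n. (-1) ^ n * (Gamma_q2 q (\<alpha> + 1) * q ^ (n * (n + 1)))
            / (Gamma_q2 q (\<alpha> + real n + 1) * Gamma_q2 q (real n + 1))
            * (x / (1 + q)) ^ (2 * n))"

definition dunkl_kernel :: "real \<Rightarrow> real \<Rightarrow> real \<Rightarrow> real \<Rightarrow> complex" where
  "dunkl_kernel q \<alpha> l x =
     complex_of_real (q_bessel q \<alpha> (l * x))
     + \<i> * complex_of_real (l * x) / complex_of_real (q_number q (2 * \<alpha> + 2))
         * complex_of_real (q_bessel q (\<alpha> + 1) (l * x))"

definition q_dunkl :: "real \<Rightarrow> real \<Rightarrow> (real \<Rightarrow> complex) \<Rightarrow> real \<Rightarrow> complex" where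
  "q_dunkl q \<alpha> f l =
     (if l \<in> q_lattice q
      then complex_of_real (c_const q \<alpha> / 2)
           * jackson_integral q
               (\<lambda>x. f x * dunkl_kernel q \<alpha> (- l) x * complex_of_real (\<bar>x\<bar> powr (2 * \<alpha> + 1)))
      else 0)"

definition linear_iso_onto :: "(real \<Rightarrow> complex) set \<Rightarrow> ((real \<Rightarrow> complex) \<Rightarrow> (real \<Rightarrow> complex)) \<Rightarrow> bool"
  where
  "linear_iso_onto V T \<longleftrightarrow>
     (\<forall>f\<in>V. \<forall>g\<in>V. T (\<lambda>x. f x + g x) = (\<lambda>x. T f x + T g x)) \<and>
     (\<forall>c. \<forall>f\<in>V. T (\<lambda>x. c * f x) = (\<lambda>x. c * T f x)) \<and>
     bij_betw T V V"

definition isometric_extension ::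
  "real \<Rightarrow> real \<Rightarrow> ((real \<Rightarrow> complex) \<Rightarrow> (real \<Rightarrow> complex)) \<Rightarrow> bool" where
  "isometric_extension q \<alpha> T \<longleftrightarrow>
     linear_iso_onto (Lq 2 \<alpha> q) T \<and>
     (\<forall>f\<in>Lq 2 \<alpha> q. Lq_norm 2 \<alpha> q (T f) = Lq_norm 2 \<alpha> q f) \<and>
     (\<forall>f\<in>q_schwartz q. T f = q_dunkl q \<alpha> f)"

end

theory Submission
  imports Defs
begin

text \<open>
  On the lattice the even and odd parts of \<open>f\<close> decouple: with \<open>x = q\<^sup>n\<close>,
  \<open>\<lambda> = q\<^sup>m\<close> and \<open>1 - q = q\<^sup>K\<close>, both become matrix transforms with a kernel that depends
  on \<open>n + m + K\<close> only, the Hahn-Exton \<open>q\<close>-Bessel function of order \<open>\<alpha>\<close> (even part) or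
  \<open>\<alpha> + 1\<close> (odd part, divided by \<open>x\<close>). Rows of these symmetric matrices are orthogonal because
  they are eigenfunctions of a \<open>q\<close>-difference operator for different eigenvalues, and their norm
  is found by shifting the order up to infinity, which leaves it invariant. A symmetric matrix with
  orthonormal rows is an isometric involution of \<open>\<ell>\<^sup>2\<close>; this gives the Plancherel theorem and shows
  that applying the transform twice is the reflection \<open>f(x) \<mapsto> f(-x)\<close>.

  An even function is Schwartz iff it decays rapidly and all iterates of \<open>x\<^sup>-\<^sup>1\<partial>\<^sub>q\<close> of it are bounded
  near \<open>0\<close>. The transform of order \<open>\<nu>\<close> intertwines \<open>x\<^sup>-\<^sup>1\<partial>\<^sub>q\<close> with minus the transform of order
  \<open>\<nu> + 1\<close>, and multiplication of the transform by \<open>\<lambda>\<^sup>2\<close> with a second-order difference operator on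
  \<open>f\<close>, so it preserves this class.
\<close>

section \<open>The Euler series and the \<open>q\<close>-Bessel function on the lattice\<close>

text \<open>The series of the q-Bessel function alternates with huge terms at large arguments, so
  decay there cannot be read off termwise. On the lattice it comes from a symmetry: in the double
  series behind it, order and argument can exchange roles, and then the leading coefficients vanish
  because (a;Q)_inf is zero at Q^(-n). This is where the condition on log(1-q)/log q enters: the
  kernel contains (1-q) x, which must again be a lattice point. The decay makes all sums over \<int>
  absolutely convergent, so that summation by parts has no boundary terms.

  It also makes the matrix rows square-summable. The integral defining the transform therefore
  converges on all of L^2, and the extension is given by the same formula; density of Schwartz
  functions enters in the uniqueness.

  In the description of Schwartz functions the delicate point is to bound the odd part divided by x
  near 0: the hypotheses bound only a first-order difference of it, and the common limit from both
  sides of 0 rules out the homogeneous solution.\<close>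

lemma summable_on_int_geometric:
  fixes f :: "int \<Rightarrow> 'a::banach"
  assumes r: "0 \<le> r" "r < 1"
    and pos: "\<And>k::nat. norm (f (int k)) \<le> B * r ^ k"
    and neg: "\<And>k::nat. norm (f (- int k)) \<le> B * r ^ k"
  shows "(\<lambda>n. norm (f n)) summable_on UNIV" "f summable_on UNIV"
    "norm (infsum f UNIV - f 0) \<le> 2 * B * r / (1 - r)"
proof -
  have gs: "(\<lambda>k. B * r ^ k) summable_on (UNIV::nat set)"
    using r by (intro summable_on_cmult_right norm_summable_imp_summable_on) (auto simp: summable_geometric)
  have geo: "(\<Sum>\<^sub>\<infinity>k::nat. B * r ^ k) = B / (1 - r)"
  proof -
    have "(\<lambda>k. r ^ k) sums (1 / (1 - r))" using r by (intro geometric_sums) auto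
    then have "((\<lambda>k. r ^ k) has_sum (1 / (1 - r))) UNIV"
      using r by (intro sums_nonneg_imp_has_sum) auto
    then have "((\<lambda>k. B * r ^ k) has_sum (B * (1 / (1 - r)))) UNIV" by (rule has_sum_cmult_right)
    then show ?thesis by (simp add: infsumI)
  qed
  define P where "P = range (\<lambda>k. int (Suc k))"
  define N where "N = range (\<lambda>k. - int (Suc k))"
  have UN: "UNIV = insert 0 (P \<union> N)"
  proof -
    have "x \<in> insert 0 (P \<union> N)" for x
      by (cases x rule: int_cases3)
        (auto simp: P_def N_def image_iff intro: exI[of _ "nat x - 1"] exI[of _ "nat (-x) - 1"])
    then show ?thesis by auto
  qed
  have disj: "P \<inter> N = {}" "0 \<notin> P" "0 \<notin> N" by (auto simp: P_def N_def)
  have injs: "inj (\<lambda>k. int (Suc k))" "inj (\<lambda>k. - int (Suc k))" by (auto simp: inj_on_def)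
  have half: "(\<lambda>n. norm (f n)) summable_on A \<and> (\<Sum>\<^sub>\<infinity>n\<in>A. norm (f n)) \<le> B * r / (1 - r)"
    if inj: "inj g" and A: "A = range g" and b: "\<And>k::nat. norm (f (g k)) \<le> B * r ^ Suc k" for g :: "nat \<Rightarrow> int" and A
  proof -
    have gs': "(\<lambda>k. r * (B * r ^ k)) summable_on (UNIV::nat set)"
      by (intro summable_on_cmult_right gs)
    have b': "norm (f (g k)) \<le> r * (B * r ^ k)" for k
      using b[of k] by (simp add: mult_ac)
    have s: "(\<lambda>k. norm (f (g k))) summable_on UNIV"
      by (rule summable_on_comparison_test[OF gs']) (auto simp: b')
    have "(\<Sum>\<^sub>\<infinity>k. norm (f (g k))) \<le> (\<Sum>\<^sub>\<infinity>k. r * (B * r ^ k))"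
      by (rule infsum_mono[OF s gs' b'])
    also have "\<dots> = r * (B / (1 - r))" using geo by (simp add: infsum_cmult_right')
    finally show ?thesis
      using s summable_on_reindex[OF inj, of "\<lambda>n. norm (f n)"] infsum_reindex[OF inj, of "\<lambda>n. norm (f n)"]
      by (simp add: A o_def mult.commute)
  qed
  have hP: "(\<lambda>n. norm (f n)) summable_on P \<and> (\<Sum>\<^sub>\<infinity>n\<in>P. norm (f n)) \<le> B * r / (1 - r)"
    using half[OF injs(1) P_def] pos by blast
  have hN: "(\<lambda>n. norm (f n)) summable_on N \<and> (\<Sum>\<^sub>\<infinity>n\<in>N. norm (f n)) \<le> B * r / (1 - r)"
    using half[OF injs(2) N_def] neg by blast
  have sPN: "(\<lambda>n. norm (f n)) summable_on (P \<union> N)"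
    using hP hN disj by (intro summable_on_Un_disjoint) auto
  show s1: "(\<lambda>n. norm (f n)) summable_on UNIV"
    using sPN unfolding UN by (simp add: summable_on_insert_iff)
  show s2: "f summable_on UNIV" by (rule abs_summable_summable[OF s1])
  have tail: "(\<Sum>\<^sub>\<infinity>n\<in>P \<union> N. norm (f n)) \<le> 2 * (B * r / (1 - r))"
    using hP hN disj by (subst infsum_Un_disjoint) auto
  have "infsum f UNIV = f 0 + infsum f (P \<union> N)"
    unfolding UN using disj abs_summable_summable[OF sPN] by (intro infsum_insert) auto
  then have "norm (infsum f UNIV - f 0) \<le> (\<Sum>\<^sub>\<infinity>n\<in>P \<union> N. norm (f n))"
    using norm_infsum_bound[OF sPN] by simp
  then show "norm (infsum f UNIV - f 0) \<le> 2 * B * r / (1 - r)" using tail by simp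
qed

lemma summable_on_int_shift:
  fixes f :: "int \<Rightarrow> 'a::{comm_monoid_add, topological_space}"
  shows "(\<lambda>n. f (n + c)) summable_on UNIV \<longleftrightarrow> f summable_on UNIV"
  by (rule summable_on_reindex_bij_betw) (rule bij_plus_right)

lemma infsum_int_shift:
  fixes f :: "int \<Rightarrow> 'a::{comm_monoid_add, t2_space}"
  shows "(\<Sum>\<^sub>\<infinity>n. f (n + c)) = infsum f UNIV"
  by (rule infsum_reindex_bij_betw) (rule bij_plus_right)

section \<open>Euler's power series for (a;Q)_inf\<close>

locale q_base =
  fixes Q :: real
  assumes Q_pos: "0 < Q" and Q_less_1: "Q < 1"
begin

text \<open>Coefficients of Euler's expansion of (a;Q)_inf, in closed form (-1)^k Q^(k(k-1)/2) /
  (Q;Q)_k. The recursion is what the index shifts in \<open>E_step\<close> and \<open>G_step\<close>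
  consume.\<close>

primrec eul :: "nat \<Rightarrow> real" where
  "eul 0 = 1"
| "eul (Suc k) = - (Q ^ k / (1 - Q ^ Suc k)) * eul k"

lemma Q_power_less_1: "Q ^ Suc k < 1"
  using Q_pos Q_less_1 by (intro power_Suc_less_one) auto

lemma eul_Suc: "eul (Suc k) * (1 - Q ^ Suc k) = - (Q ^ k * eul k)"
  using Q_power_less_1[of k] by (simp add: field_simps)

lemma summable_eul: "summable (\<lambda>k. \<bar>eul k * a ^ k\<bar>)"
proof -
  have "(\<lambda>k. \<bar>a\<bar> * Q ^ k / (1 - Q)) \<longlonglongrightarrow> \<bar>a\<bar> * 0 / (1 - Q)"
    using Q_pos Q_less_1 by (intro tendsto_intros LIMSEQ_power_zero) auto
  then have "eventually (\<lambda>k. \<bar>a\<bar> * Q ^ k / (1 - Q) < 1/2) sequentially"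
    by (rule order_tendstoD) auto
  then obtain N where N: "\<And>k. k \<ge> N \<Longrightarrow> \<bar>a\<bar> * Q ^ k / (1 - Q) < 1/2"
    by (auto simp: eventually_sequentially)
  have "norm (eul (Suc k) * a ^ Suc k) \<le> 1/2 * norm (eul k * a ^ k)" if "k \<ge> N" for k
  proof -
    have "Q ^ Suc k \<le> Q" using Q_pos Q_less_1 by (simp add: power_le_one mult_left_le)
    then have "\<bar>a\<bar> * Q ^ k / (1 - Q ^ Suc k) \<le> \<bar>a\<bar> * Q ^ k / (1 - Q)"
      using Q_pos Q_less_1 Q_power_less_1[of k] by (intro divide_left_mono mult_pos_pos) auto
    with N[OF that] have l: "\<bar>a\<bar> * Q ^ k / (1 - Q ^ Suc k) \<le> 1/2" by linarith
    have "norm (eul (Suc k) * a ^ Suc k) = (\<bar>a\<bar> * Q ^ k / (1 - Q ^ Suc k)) * norm (eul k * a ^ k)"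
      using Q_power_less_1[of k] Q_pos by (simp add: abs_mult power_abs)
    also have "\<dots> \<le> 1/2 * norm (eul k * a ^ k)" using l by (intro mult_right_mono) auto
    finally show ?thesis .
  qed
  then have "summable (\<lambda>k. norm (eul k * a ^ k))"
    by (intro summable_ratio_test[of "1/2" N]) auto
  then show ?thesis by simp
qed

lemma summable_eul': "summable (\<lambda>k. eul k * a ^ k)"
  using summable_rabs_cancel[OF summable_eul] .

lemma summable_abs_eul: "summable (\<lambda>k. \<bar>eul k\<bar>)"
  using summable_eul[of 1] by simp

text \<open>The series rather than the product is primary: rearranging double sums and bounding
  uniformly both need the coefficients. The product returns in \<open>E_prod\<close> and
  \<open>qpoch_inf_eq_E\<close>.\<close>

definition E :: "real \<Rightarrow> real" where "E a = (\<Sum>k. eul k * a ^ k)"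

definition S :: real where "S = (\<Sum>k. \<bar>eul k\<bar>)"

lemma S_nonneg: "0 \<le> S" unfolding S_def by (intro suminf_nonneg summable_abs_eul) auto

lemma E_step: "E a = (1 - a) * E (a * Q)"
proof -
  have "E a - E (a * Q) = (\<Sum>k. eul k * a ^ k * (1 - Q ^ k))"
    unfolding E_def by (subst suminf_diff[OF summable_eul' summable_eul'])
      (auto intro!: suminf_cong simp: algebra_simps power_mult_distrib)
  also have "\<dots> = (\<Sum>k. eul (Suc k) * a ^ Suc k * (1 - Q ^ Suc k))"
  proof -
    have "summable (\<lambda>k. eul k * a ^ k * (1 - Q ^ k))"
      using summable_diff[OF summable_eul'[of a] summable_eul'[of "a * Q"]]
      by (simp add: algebra_simps power_mult_distrib)
    from suminf_split_head[OF this] show ?thesis by simp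
  qed
  also have "\<dots> = (\<Sum>k. - a * (eul k * (a * Q) ^ k))"
  proof (rule suminf_cong)
    fix k
    have "eul (Suc k) * a ^ Suc k * (1 - Q ^ Suc k) = a ^ Suc k * (eul (Suc k) * (1 - Q ^ Suc k))"
      by (simp only: mult_ac)
    then show "eul (Suc k) * a ^ Suc k * (1 - Q ^ Suc k) = - a * (eul k * (a * Q) ^ k)"
      unfolding eul_Suc by (simp add: power_mult_distrib)
  qed
  also have "\<dots> = - a * E (a * Q)"
    unfolding E_def by (rule suminf_mult[OF summable_eul'])
  finally show ?thesis by (simp add: algebra_simps)
qed

lemma abs_E_le: "\<bar>a\<bar> \<le> 1 \<Longrightarrow> \<bar>E a\<bar> \<le> S"
proof -
  assume a: "\<bar>a\<bar> \<le> 1"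
  have "\<bar>E a\<bar> \<le> (\<Sum>k. \<bar>eul k * a ^ k\<bar>)"
    unfolding E_def by (rule summable_rabs[OF summable_eul])
  also have "\<dots> \<le> S" unfolding S_def
    using a by (intro suminf_le summable_eul summable_abs_eul)
      (auto simp: abs_mult power_abs power_le_one mult_left_le)
  finally show ?thesis .
qed

lemma E_near_0: "\<bar>a\<bar> \<le> 1 \<Longrightarrow> \<bar>E a - 1\<bar> \<le> \<bar>a\<bar> * S"
proof -
  assume a: "\<bar>a\<bar> \<le> 1"
  have s: "summable (\<lambda>k. \<bar>eul (Suc k) * a ^ Suc k\<bar>)"
    using summable_eul[of a] by (subst summable_Suc_iff[of "\<lambda>k. \<bar>eul k * a ^ k\<bar>"])
  have s': "summable (\<lambda>k. \<bar>a\<bar> * \<bar>eul (Suc k)\<bar>)"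
    using summable_abs_eul by (intro summable_mult) (subst summable_Suc_iff[of "\<lambda>k. \<bar>eul k\<bar>"])
  have "E a - 1 = (\<Sum>k. eul (Suc k) * a ^ Suc k)"
    unfolding E_def using suminf_split_head[OF summable_eul'[of a]] by simp
  also have "\<bar>\<dots>\<bar> \<le> (\<Sum>k. \<bar>eul (Suc k) * a ^ Suc k\<bar>)" by (rule summable_rabs[OF s])
  also have "\<dots> \<le> (\<Sum>k. \<bar>a\<bar> * \<bar>eul (Suc k)\<bar>)"
  proof (intro suminf_le s s')
    fix k
    have "\<bar>a\<bar> ^ k * (\<bar>a\<bar> * \<bar>eul (Suc k)\<bar>) \<le> 1 * (\<bar>a\<bar> * \<bar>eul (Suc k)\<bar>)"
      using a by (intro mult_right_mono) (auto simp: power_le_one)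
    then show "\<bar>eul (Suc k) * a ^ Suc k\<bar> \<le> \<bar>a\<bar> * \<bar>eul (Suc k)\<bar>"
      by (simp only: abs_mult power_abs power_Suc mult_ac mult_1)
  qed
  also have "\<dots> = \<bar>a\<bar> * (\<Sum>k. \<bar>eul (Suc k)\<bar>)"
    using summable_abs_eul by (intro suminf_mult) (subst summable_Suc_iff[of "\<lambda>k. \<bar>eul k\<bar>"])
  also have "\<dots> \<le> \<bar>a\<bar> * S"
    unfolding S_def using suminf_split_head[OF summable_abs_eul] by (intro mult_left_mono) auto
  finally show ?thesis .
qed

lemma E_prod: "E a = (\<Prod>k<n. 1 - a * Q ^ k) * E (a * Q ^ n)"
proof (induction n)
  case (Suc n)
  then show ?case using E_step[of "a * Q ^ n"] by (simp add: mult_ac)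
qed simp

lemma E_tendsto: "(\<lambda>n. E (a * Q ^ n)) \<longlonglongrightarrow> 1"
proof -
  have z: "(\<lambda>n. a * Q ^ n) \<longlonglongrightarrow> 0"
    using Q_pos Q_less_1 by (intro tendsto_mult_right_zero LIMSEQ_power_zero) auto
  then have "eventually (\<lambda>n. \<bar>a * Q ^ n\<bar> < 1) sequentially"
    by (intro order_tendstoD(2)[OF tendsto_rabs_zero]) auto
  then have "eventually (\<lambda>n. norm (E (a * Q ^ n) - 1) \<le> \<bar>a * Q ^ n\<bar> * S) sequentially"
    by eventually_elim (use E_near_0 in auto)
  moreover have "(\<lambda>n. \<bar>a * Q ^ n\<bar> * S) \<longlonglongrightarrow> 0"
    using z by (intro tendsto_mult_left_zero tendsto_rabs_zero)
  ultimately have "(\<lambda>n. E (a * Q ^ n) - 1) \<longlonglongrightarrow> 0" by (rule Lim_null_comparison)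
  then show ?thesis by (simp add: LIM_zero_iff)
qed

text \<open>All factors of \<open>E_prod\<close> are positive, and the remaining factor tends to 1,
  so it is positive for large n.\<close>

lemma E_pos: assumes "a < 1" shows "0 < E a"
proof -
  have "eventually (\<lambda>n. 0 < E (a * Q ^ n)) sequentially"
    by (rule order_tendstoD[OF E_tendsto]) auto
  then obtain n where "0 < E (a * Q ^ n)" by (auto simp: eventually_sequentially)
  moreover have "a * Q ^ k < 1" for k
  proof (cases "a \<le> 0")
    case True
    then have "a * Q ^ k \<le> 0" using Q_pos by (simp add: mult_nonpos_nonneg)
    then show ?thesis by simp
  next
    case False
    then have "a * Q ^ k \<le> a" using Q_pos Q_less_1 by (simp add: mult_left_le power_le_one)
    then show ?thesis using assms by simp
  qed
  ultimately show ?thesis by (subst E_prod[of _ n]) (auto intro!: mult_pos_pos prod_pos)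
qed

lemma qpoch_inf_eq_E: assumes "a < 1" shows "qpoch_inf a Q = E a"
proof -
  have "summable (\<lambda>k. norm (1 - a * Q ^ k - 1))"
    using Q_pos Q_less_1 by (auto simp: abs_mult power_abs intro!: summable_mult summable_geometric)
  then have "convergent_prod (\<lambda>k. 1 - a * Q ^ k)"
    by (intro abs_convergent_prod_imp_convergent_prod summable_imp_abs_convergent_prod)
  then have "(\<lambda>n. \<Prod>k\<le>n. 1 - a * Q ^ k) \<longlonglongrightarrow> qpoch_inf a Q"
    unfolding qpoch_inf_def by (rule convergent_prod_LIMSEQ)
  then have "(\<lambda>n. (\<Prod>k\<le>n. 1 - a * Q ^ k) * E (a * Q ^ Suc n)) \<longlonglongrightarrow> qpoch_inf a Q * 1"
    by (intro tendsto_mult LIMSEQ_Suc[OF E_tendsto])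
  then have "(\<lambda>n::nat. E a) \<longlonglongrightarrow> qpoch_inf a Q"
    using E_prod[of a "Suc n" for n] by (simp add: lessThan_Suc_atMost)
  then show ?thesis using LIMSEQ_unique tendsto_const by blast
qed

text \<open>The factor 1 - a Q^n of the product vanishes at a = Q^(-n). These zeros are the source
  of the decay of the q-Bessel function at large lattice points.\<close>

lemma E_power_int_nonpos: assumes "i \<le> 0" shows "E (Q powi i) = 0"
proof -
  have "E (Q powi (- int n)) = 0" for n
  proof (induction n)
    case 0 then show ?case using E_step[of 1] by simp
  next
    case (Suc n)
    have "Q powi (- int (Suc n)) * Q = Q powi (- int n)"
      using Q_pos by (simp add: power_int_minus field_simps del: power_int_add_1 of_nat_Suc)
    then show ?case using E_step[of "Q powi (- int (Suc n))"] Suc by simp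
  qed
  from this[of "nat (- i)"] show ?thesis using assms by simp
qed

section \<open>The function (w;Q)_inf 1phi1(0; w; Q, z) as a symmetric double series\<close>

definition G :: "real \<Rightarrow> real \<Rightarrow> real" where
  "G w z = (\<Sum>k. eul k * z ^ k * E (w * Q ^ k))"

text \<open>Since Q^(kj) \<le> 1, the double series is dominated by the product of two absolutely
  convergent Euler series.\<close>

lemma summable_G_double:
  "(\<lambda>x. norm (case x of (k, j) \<Rightarrow> eul k * z ^ k * (eul j * (w * Q ^ k) ^ j))) summable_on UNIV \<times> UNIV"
proof -
  have a: "(\<lambda>k. norm (eul k * a ^ k)) summable_on UNIV" for a
    using summable_eul by (auto intro!: norm_summable_imp_summable_on)
  show ?thesis
  proof (rule Infinite_Sum.abs_summable_on_comparison_test)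
    show "(\<lambda>x. norm (case x of (k, j) \<Rightarrow> eul k * z ^ k * (eul j * w ^ j))) summable_on UNIV \<times> UNIV"
      using a[of w] a[of z]
      by (intro iffD2[OF Infinite_Sum.abs_summable_on_Sigma_iff])
        (auto simp: abs_mult infsum_cmult_right' intro!: summable_on_cmult_right summable_on_cmult_left)
  next
    fix x :: "nat \<times> nat"
    obtain k j where x: "x = (k, j)" by (cases x)
    have "\<bar>Q ^ k\<bar> ^ j \<le> 1" using Q_pos Q_less_1 by (simp add: power_le_one)
    then have "\<bar>eul k * z ^ k * (eul j * w ^ j)\<bar> * \<bar>Q ^ k\<bar> ^ j \<le> \<bar>eul k * z ^ k * (eul j * w ^ j)\<bar>"
      by (intro mult_left_le) auto
    then show "norm (case x of (k, j) \<Rightarrow> eul k * z ^ k * (eul j * (w * Q ^ k) ^ j))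
        \<le> norm (case x of (k, j) \<Rightarrow> eul k * z ^ k * (eul j * w ^ j))"
      by (simp add: x abs_mult power_mult_distrib power_abs mult_ac)
  qed
qed

lemma E_infsum: "E a = (\<Sum>\<^sub>\<infinity>k. eul k * a ^ k)"
proof -
  have "((\<lambda>k. eul k * a ^ k) has_sum E a) UNIV"
    unfolding E_def using summable_eul[of a]
    by (intro norm_summable_imp_has_sum summable_sums summable_eul') auto
  then show ?thesis by (simp add: infsumI)
qed

lemma summable_G: "summable (\<lambda>k. \<bar>eul k * z ^ k * E (w * Q ^ k)\<bar>)"
proof -
  have "(\<lambda>k. w * Q ^ k) \<longlonglongrightarrow> 0"
    using Q_pos Q_less_1 by (intro tendsto_mult_right_zero LIMSEQ_power_zero) auto
  then have "eventually (\<lambda>k. \<bar>w * Q ^ k\<bar> < 1) sequentially"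
    by (intro order_tendstoD(2)[OF tendsto_rabs_zero]) auto
  then have "eventually (\<lambda>k. norm \<bar>eul k * z ^ k * E (w * Q ^ k)\<bar> \<le> S * \<bar>eul k * z ^ k\<bar>) sequentially"
  proof eventually_elim
    case (elim k)
    then show ?case using mult_right_mono[OF abs_E_le[of "w * Q ^ k"], of "\<bar>eul k * z ^ k\<bar>"]
      by (simp add: abs_mult mult_ac)
  qed
  then show ?thesis by (rule summable_comparison_test_ev) (intro summable_mult summable_eul)
qed

lemma summable_G': "summable (\<lambda>k. eul k * z ^ k * E (w * Q ^ k))"
  using summable_rabs_cancel[OF summable_G] .

lemma G_infsum: "G w z = (\<Sum>\<^sub>\<infinity>k. \<Sum>\<^sub>\<infinity>j. eul k * z ^ k * (eul j * (w * Q ^ k) ^ j))"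
proof -
  have "((\<lambda>k. eul k * z ^ k * E (w * Q ^ k)) has_sum G w z) UNIV"
    unfolding G_def using summable_G[of z w]
    by (intro norm_summable_imp_has_sum summable_sums summable_G') auto
  then have "G w z = (\<Sum>\<^sub>\<infinity>k. eul k * z ^ k * E (w * Q ^ k))" by (simp add: infsumI)
  then show ?thesis by (simp add: E_infsum infsum_cmult_right')
qed

text \<open>The general term is \<open>eul k * eul j * z ^ k * w ^ j * Q ^ (k * j)\<close>, which is
  invariant under exchanging (k, z) with (j, w).\<close>

lemma G_sym: "G w z = G z w"
proof -
  have "G w z = (\<Sum>\<^sub>\<infinity>j. \<Sum>\<^sub>\<infinity>k. eul k * z ^ k * (eul j * (w * Q ^ k) ^ j))"
    unfolding G_infsum
    by (rule infsum_swap_banach) (rule abs_summable_summable, use summable_G_double in simp)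
  also have "\<dots> = G z w"
    unfolding G_infsum
    by (intro infsum_cong) (simp add: power_mult_distrib mult_ac flip: power_mult)
  finally show ?thesis .
qed

text \<open>The factor 1 - Q^k kills the term k = 0 and, after the index shift, turns
  \<open>eul (Suc k)\<close> into \<open>eul k\<close>; what remains has both arguments multiplied
  by Q.\<close>

lemma G_step: "G w z - G w (Q * z) = - z * G (Q * w) (Q * z)"
proof -
  have "G w z - G w (Q * z) = (\<Sum>k. eul k * z ^ k * E (w * Q ^ k) * (1 - Q ^ k))"
    unfolding G_def by (subst suminf_diff[OF summable_G' summable_G'])
      (auto intro!: suminf_cong simp: algebra_simps power_mult_distrib)
  also have "\<dots> = (\<Sum>k. eul (Suc k) * z ^ Suc k * E (w * Q ^ Suc k) * (1 - Q ^ Suc k))"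
  proof -
    have "summable (\<lambda>k. eul k * z ^ k * E (w * Q ^ k) * (1 - Q ^ k))"
      using summable_diff[OF summable_G'[of z w] summable_G'[of "Q * z" w]]
      by (simp add: algebra_simps power_mult_distrib)
    from suminf_split_head[OF this] show ?thesis by simp
  qed
  also have "\<dots> = (\<Sum>k. - z * (eul k * (Q * z) ^ k * E (Q * w * Q ^ k)))"
  proof (rule suminf_cong)
    fix k
    have "eul (Suc k) * z ^ Suc k * E (w * Q ^ Suc k) * (1 - Q ^ Suc k)
        = z ^ Suc k * E (w * Q ^ Suc k) * (eul (Suc k) * (1 - Q ^ Suc k))"
      by (simp only: mult_ac)
    then show "eul (Suc k) * z ^ Suc k * E (w * Q ^ Suc k) * (1 - Q ^ Suc k)
        = - z * (eul k * (Q * z) ^ k * E (Q * w * Q ^ k))"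
      unfolding eul_Suc by (simp add: power_mult_distrib mult_ac)
  qed
  also have "\<dots> = - z * G (Q * w) (Q * z)"
    unfolding G_def by (rule suminf_mult[OF summable_G'])
  finally show ?thesis .
qed

text \<open>With w = Q^(nu+1), this is (Q;Q)_inf x^(-nu) times the Hahn-Exton function J_nu(x;Q) at
  x^2 = Q^m. The offset m + 1 is the factor Q in its argument Q x^2.\<close>

definition h :: "real \<Rightarrow> int \<Rightarrow> real" where "h w m = G w (Q powi (m + 1))"

lemma Q_powi_Suc: "Q powi (m + 1) = Q * Q powi m"
  using Q_pos by (simp add: power_int_add)

lemma h_step: "h w (m - 1) - h w m = - (Q powi m * h (Q * w) m)"
  using G_step[of w "Q powi m"] by (simp add: h_def Q_powi_Suc)

text \<open>\<open>G_step\<close> in the other variable, by symmetry. Together with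
  \<open>h_step\<close> it links the orders nu and nu + 1 by a first-order system, which is handier
  than the second-order q-difference equation.\<close>

lemma h_raise: "h w m = h (Q * w) m - w * h (Q * w) (m + 1)"
proof -
  have "G w z - G (Q * w) z = - w * G (Q * w) (Q * z)" for z
    using G_step[of z w] by (simp only: G_sym[of z] G_sym[of "Q * z"])
  from this[of "Q powi (m + 1)"] show ?thesis
    using Q_powi_Suc[of "m + 1"] by (simp add: h_def add.assoc)
qed

text \<open>Expand in powers of w instead of z: the coefficients E (z Q^k) with k < n vanish, so a
  factor w^n splits off.\<close>

lemma abs_G_le:
  assumes "0 \<le> w" "w \<le> 1" "\<And>k. k < n \<Longrightarrow> E (z * Q ^ k) = 0" "\<And>k. n \<le> k \<Longrightarrow> \<bar>z * Q ^ k\<bar> \<le> 1"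
  shows "\<bar>G w z\<bar> \<le> S * S * w ^ n"
proof -
  have "\<bar>eul k * w ^ k * E (z * Q ^ k)\<bar> \<le> S * w ^ n * \<bar>eul k\<bar>" for k
  proof (cases "k < n")
    case True
    then show ?thesis using assms S_nonneg by simp
  next
    case False
    then have "\<bar>w\<bar> ^ k \<le> w ^ n" using assms by (simp add: power_decreasing)
    then have "\<bar>w\<bar> ^ k * \<bar>E (z * Q ^ k)\<bar> \<le> w ^ n * S"
      using False assms S_nonneg by (intro mult_mono abs_E_le) auto
    then have "\<bar>eul k\<bar> * (\<bar>w\<bar> ^ k * \<bar>E (z * Q ^ k)\<bar>) \<le> \<bar>eul k\<bar> * (w ^ n * S)"
      by (intro mult_left_mono) auto
    then show ?thesis by (simp add: abs_mult power_abs mult_ac)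
  qed
  then have "(\<Sum>k. \<bar>eul k * w ^ k * E (z * Q ^ k)\<bar>) \<le> (\<Sum>k. S * w ^ n * \<bar>eul k\<bar>)"
    by (intro suminf_le summable_G summable_mult summable_abs_eul)
  also have "\<dots> = S * w ^ n * S" using suminf_mult[OF summable_abs_eul] S_def by simp
  finally show ?thesis
    using summable_rabs[OF summable_G[of w z]] unfolding G_sym[of w z] G_def[of z w] by (simp add: mult_ac)
qed

lemma abs_h_nonneg_le: assumes "0 \<le> w" "w \<le> 1" shows "\<bar>h w (int k)\<bar> \<le> S * S"
proof -
  have "\<bar>Q ^ Suc k * Q ^ j\<bar> \<le> 1" for j
    using Q_pos Q_less_1 by (simp add: power_le_one flip: power_add power_Suc)
  moreover have "Q powi (int k + 1) = Q ^ Suc k"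
    by (metis power_int_of_nat of_nat_Suc add.commute)
  ultimately show ?thesis using abs_G_le[OF assms, of 0 "Q ^ Suc k"] by (simp add: h_def)
qed

lemma abs_h_nonpos_le: assumes "0 \<le> w" "w \<le> 1" shows "\<bar>h w (- int k)\<bar> \<le> S * S * w ^ k"
  unfolding h_def
\<comment> \<open>Here z = Q^(1-k), and z Q^j = Q^(j+1-k) is a zero of \<open>E\<close> exactly for
  j < k and has modulus at most 1 from j = k on.\<close>
proof (rule abs_G_le[OF assms])
  have e: "Q powi (- int k + 1) * Q ^ j = Q powi (int j + 1 - int k)" for j
  proof -
    have "Q powi (- int k + 1) * Q powi int j = Q powi (- int k + 1 + int j)"
      using Q_pos by (intro power_int_add[symmetric]) auto
    then show ?thesis by (simp add: algebra_simps)
  qed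
  show "E (Q powi (- int k + 1) * Q ^ j) = 0" if "j < k" for j
    unfolding e using that by (intro E_power_int_nonpos) auto
  show "\<bar>Q powi (- int k + 1) * Q ^ j\<bar> \<le> 1" if "k \<le> j" for j
  proof -
    have "int j + 1 - int k = int (j + 1 - k)" using that by simp
    then show ?thesis unfolding e using Q_pos Q_less_1 by (simp add: power_le_one del: of_nat_diff)
  qed
qed

text \<open>The limit of infinite order, w -> 0: in the expansion in powers of w the constant term
  is E (Q).\<close>

lemma h_0_near: assumes "0 \<le> w" "w \<le> 1" shows "\<bar>h w 0 - E Q\<bar> \<le> w * (S * S)"
proof -
  have s: "summable (\<lambda>k. eul k * w ^ k * E (Q * Q ^ k))" by (rule summable_G')
  have s1: "summable (\<lambda>k. \<bar>eul (Suc k) * w ^ Suc k * E (Q * Q ^ Suc k)\<bar>)"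
    using summable_G[of w Q] by (subst summable_Suc_iff[of "\<lambda>k. \<bar>eul k * w ^ k * E (Q * Q ^ k)\<bar>"])
  have s2: "summable (\<lambda>k. \<bar>eul (Suc k)\<bar>)" using summable_abs_eul by (subst summable_Suc_iff[of "\<lambda>k. \<bar>eul k\<bar>"])
  have "h w 0 - E Q = (\<Sum>k. eul (Suc k) * w ^ Suc k * E (Q * Q ^ Suc k))"
    using suminf_split_head[OF s] by (simp add: h_def G_sym[of w Q] G_def[of Q w])
  also have "\<bar>\<dots>\<bar> \<le> (\<Sum>k. \<bar>eul (Suc k) * w ^ Suc k * E (Q * Q ^ Suc k)\<bar>)" by (rule summable_rabs[OF s1])
  also have "\<dots> \<le> (\<Sum>k. w * S * \<bar>eul (Suc k)\<bar>)"
  proof (intro suminf_le s1 summable_mult s2)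
    fix k
    have "w ^ Suc k \<le> w" using assms power_decreasing[of 1 "Suc k" w] by simp
    then have "w ^ Suc k * \<bar>E (Q * Q ^ Suc k)\<bar> \<le> w * S"
      using assms Q_pos Q_less_1 S_nonneg
      by (intro mult_mono abs_E_le) (auto simp: power_le_one mult_left_le simp flip: power_Suc)
    then have "\<bar>eul (Suc k)\<bar> * (w ^ Suc k * \<bar>E (Q * Q ^ Suc k)\<bar>) \<le> \<bar>eul (Suc k)\<bar> * (w * S)"
      by (intro mult_left_mono) auto
    then show "\<bar>eul (Suc k) * w ^ Suc k * E (Q * Q ^ Suc k)\<bar> \<le> w * S * \<bar>eul (Suc k)\<bar>"
      using assms by (simp only: abs_mult power_abs abs_of_nonneg mult_ac)
  qed
  also have "\<dots> = w * S * (\<Sum>k. \<bar>eul (Suc k)\<bar>)" by (rule suminf_mult[OF s2])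
  also have "\<dots> \<le> w * S * S" unfolding S_def
    using suminf_split_head[OF summable_abs_eul] assms S_nonneg
    by (intro mult_left_mono) (auto simp: S_def)
  finally show ?thesis by simp
qed

end

section \<open>Orthogonality of the \<open>q\<close>-Bessel functions\<close>

lemma has_sum_diff:
  fixes f g :: "'a \<Rightarrow> 'b::real_normed_vector"
  assumes "(f has_sum a) A" "(g has_sum b) A"
  shows "((\<lambda>x. f x - g x) has_sum a - b) A"
  using has_sum_add[OF assms(1), of "\<lambda>x. - g x" "- b"] assms(2) by (simp add: has_sum_uminus)

lemma power_int_inject_real:
  assumes "0 < a" "a < (1::real)" "a powi m = a powi n"
  shows "m = n"
  using power_int_strict_decreasing[of m n a] power_int_strict_decreasing[of n m a] assms
  by (cases m n rule: linorder_cases) auto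

context q_base
begin

lemma abs_h_le_powi:
  assumes "0 < w" "w \<le> 1"
  shows "\<bar>h w i\<bar> \<le> S * S * w powi (- i)"
proof (cases "i \<ge> 0")
  case True
  have "1 \<le> w powi (- i)"
    using assms True one_le_power_int[of "inverse w" i] by (simp add: power_int_minus power_int_inverse one_le_inverse)
  then have "S * S * 1 \<le> S * S * w powi (- i)" using S_nonneg by (intro mult_left_mono) auto
  then show ?thesis using abs_h_nonneg_le[of w "nat i"] assms True by simp
next
  case False
  then show ?thesis using abs_h_nonpos_le[of w "nat (- i)"] assms by (simp add: power_int_def)
qed

lemma abs_h_le:
  assumes "0 < w" "w \<le> 1"
  shows "\<bar>h w i\<bar> \<le> S * S"
proof (cases "i \<ge> 0")
  case True
  then show ?thesis using abs_h_nonneg_le[of w "nat i"] assms by simp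
next
  case False
  have "S * S * w ^ nat (- i) \<le> S * S * 1"
    using assms S_nonneg by (intro mult_left_mono power_le_one) auto
  then show ?thesis using False abs_h_nonpos_le[of w "nat (- i)"] assms by simp
qed

lemma h_product_bounds:
  assumes w: "0 < w1" "w1 \<le> 1" "0 < w2" "w2 \<le> 1" and v: "0 < v"
  shows "norm (v powi (int k) * (h w1 (int k + m) * h w2 (int k + l))) \<le> (S * S) ^ 2 * v ^ k"
    "norm (v powi (- int k) * (h w1 (- int k + m) * h w2 (- int k + l)))
      \<le> (S * S) ^ 2 * (w1 powi (- m) * w2 powi (- l)) * (w1 * w2 / v) ^ k"
proof -
  have "\<bar>h w1 (int k + m)\<bar> * \<bar>h w2 (int k + l)\<bar> \<le> (S * S) * (S * S)"
    using w by (intro mult_mono abs_h_le) auto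
  then have "v ^ k * (\<bar>h w1 (int k + m)\<bar> * \<bar>h w2 (int k + l)\<bar>) \<le> v ^ k * ((S * S) * (S * S))"
    using v by (intro mult_left_mono) auto
  then show "norm (v powi (int k) * (h w1 (int k + m) * h w2 (int k + l))) \<le> (S * S) ^ 2 * v ^ k"
    using v by (simp add: abs_mult power2_eq_square mult_ac)
  have e: "a powi (- (- int k + j)) = a ^ k * a powi (- j)" if "0 < a" for a :: real and j
    using that power_int_add[of a "int k" "- j"] by simp
  have "\<bar>h w1 (- int k + m)\<bar> * \<bar>h w2 (- int k + l)\<bar>
      \<le> (S * S * w1 powi (- (- int k + m))) * (S * S * w2 powi (- (- int k + l)))"
    using w S_nonneg by (intro mult_mono abs_h_le_powi) auto
  then have "inverse (v ^ k) * (\<bar>h w1 (- int k + m)\<bar> * \<bar>h w2 (- int k + l)\<bar>)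
      \<le> inverse (v ^ k) * ((S * S * (w1 ^ k * w1 powi (- m))) * (S * S * (w2 ^ k * w2 powi (- l))))"
    unfolding e[OF w(1)] e[OF w(3)] using v by (intro mult_left_mono) auto
  then show "norm (v powi (- int k) * (h w1 (- int k + m) * h w2 (- int k + l)))
      \<le> (S * S) ^ 2 * (w1 powi (- m) * w2 powi (- l)) * (w1 * w2 / v) ^ k"
    using v by (simp add: abs_mult power2_eq_square power_int_minus power_divide power_mult_distrib field_simps)
qed

text \<open>Towards +inf both factors are bounded and v^n decays. At n = -k they decay like w1^k and
  w2^k, which beats v^(-k) because \<open>w1 * w2 < v\<close>.\<close>

lemma h_product_summable:
  assumes w: "0 < w1" "w1 \<le> 1" "0 < w2" "w2 \<le> 1" and v: "0 < v" "v < 1" "w1 * w2 < v"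
  shows "(\<lambda>n. v powi n * (h w1 (n + m) * h w2 (n + l))) summable_on UNIV"
proof (rule summable_on_int_geometric(2))
  define c where "c = (S * S) ^ 2 * (w1 powi (- m) * w2 powi (- l))"
  have c: "0 \<le> c" using w by (simp add: c_def)
  define r where "r = max v (w1 * w2 / v)"
  show r: "0 \<le> r" "r < 1" using w v by (auto simp: r_def)
  show "norm (v powi (int k) * (h w1 (int k + m) * h w2 (int k + l))) \<le> ((S * S) ^ 2 + c) * r ^ k" for k
    by (rule order_trans[OF h_product_bounds(1)[OF w v(1)]])
      (intro mult_mono power_mono, use v c in \<open>auto simp: r_def\<close>)
  show "norm (v powi (- int k) * (h w1 (- int k + m) * h w2 (- int k + l))) \<le> ((S * S) ^ 2 + c) * r ^ k" for k
    by (rule order_trans[OF h_product_bounds(2)[OF w v(1)]], fold c_def)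
      (intro mult_mono power_mono, use w v c in \<open>auto simp: r_def\<close>)
qed

lemma Qw: assumes "0 < w" "w < 1" shows "0 < Q * w" "Q * w < 1" "Q * w < w"
proof -
  show "Q * w < w" using mult_strict_right_mono[OF Q_less_1] assms by simp
  then show "Q * w < 1" using assms by linarith
qed (use assms Q_pos in simp)

lemma mult_less_left: "0 < a \<Longrightarrow> b < 1 \<Longrightarrow> a * b < (a::real)"
  using mult_strict_left_mono[of b 1 a] by simp

text \<open>The discrete Wronskian of two solutions of the second-order \<open>q\<close>-difference equation is
  summable over \<open>\<int>\<close>, so the sum of its differences vanishes; this replaces boundary terms.\<close>

lemma h_orthogonal_ne:
  assumes w: "0 < w" "w < 1" and ne: "m \<noteq> l"
  shows "(\<Sum>\<^sub>\<infinity>n. w powi n * (h w (n + m) * h w (n + l))) = 0"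
proof -
  note qw = Qw[OF w]
  define W where "W n = w powi n * (Q powi m * (h (Q * w) (n + m) * h w (n + l))
      - Q powi l * (h w (n + m) * h (Q * w) (n + l)))" for n
  have prod: "w * (Q * w) < w" "Q * w * w < w"
    using mult_less_left[OF w(1) qw(2)] by (simp_all add: mult_ac)
  have sW: "W summable_on UNIV"
  proof -
    have "(\<lambda>n. Q powi m * (w powi n * (h (Q * w) (n + m) * h w (n + l)))
        + - (Q powi l) * (w powi n * (h w (n + m) * h (Q * w) (n + l)))) summable_on UNIV"
      using w qw prod by (intro summable_on_add summable_on_cmult_right h_product_summable) auto
    then show ?thesis by (simp add: W_def[abs_def] algebra_simps)
  qed
  have diff: "(Q powi m - Q powi l) * (w powi n * (h w (n + m) * h w (n + l))) = W n - W (n + 1)" for n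
  proof -
    \<comment> \<open>Everything is expressed through \<open>h w (n + i)\<close> and
      \<open>h (Q * w) (n + i + 1)\<close> for i = m and i = l. In these variables the products of
      the two \<open>h (Q * w)\<close> terms cancel, and the telescoping identity is pure
      algebra.\<close>
    have st: "h w (n + i + 1) = h w (n + i) + Q * Q powi n * Q powi i * h (Q * w) (n + i + 1)" for i
        using h_step[of w "n + i + 1"] Q_pos by (simp add: power_int_add algebra_simps)
    have ra: "h (Q * w) (n + i) = h w (n + i) + w * h (Q * w) (n + i + 1)" for i
      using h_raise[of w "n + i"] by simp
    have sh: "n + 1 + i = n + i + 1" for i by simp
    have wp: "w powi (n + 1) = w * w powi n" using w by (simp add: power_int_add)
    show ?thesis unfolding W_def sh wp unfolding st ra by (simp add: algebra_simps)
  qed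
  have "(Q powi m - Q powi l) * (\<Sum>\<^sub>\<infinity>n. w powi n * (h w (n + m) * h w (n + l))) = (\<Sum>\<^sub>\<infinity>n. W n - W (n + 1))"
    by (simp add: diff flip: infsum_cmult_right')
  also have "\<dots> = infsum W UNIV - (\<Sum>\<^sub>\<infinity>n. W (n + 1))"
    using sW has_sum_diff[where f = W and g = "\<lambda>n. W (n + 1)" and A = UNIV]
    by (intro infsumI) (auto simp: summable_on_int_shift)
  also have "\<dots> = 0" by (simp add: infsum_int_shift)
  finally have "Q powi m = Q powi l \<or> ?thesis" by simp
  moreover have "Q powi m \<noteq> Q powi l"
    using power_int_inject_real[OF Q_pos Q_less_1] ne by blast
  ultimately show ?thesis by simp
qed

section \<open>The row norms and their independence of the order\<close>

definition N :: "real \<Rightarrow> real" where "N w = (\<Sum>\<^sub>\<infinity>n. w powi n * (h w n * h w n))"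

text \<open>Both norms are expanded in F = \<open>h (Q * w)\<close> alone and become A - 2wB + wA.
  For N (w), \<open>h_raise\<close> is squared; for N (Q w), one factor Q^n F n is replaced through
  the three-term recurrence of F.\<close>

lemma N_step: assumes w: "0 < w" "w < 1" shows "N (Q * w) = N w"
proof -
  note qw = Qw[OF w]
  define F where "F = h (Q * w)"
  have ww: "Q * w * (Q * w) < w" using mult_strict_mono[of "Q * w" w "Q * w" 1] w qw by simp
  have s: "(\<lambda>n. w powi n * (F (n + m) * F (n + l))) summable_on UNIV" for m l
    unfolding F_def using w qw ww by (intro h_product_summable) auto
  define A where "A = (\<Sum>\<^sub>\<infinity>n. w powi n * (F n * F n))"
  define B where "B = (\<Sum>\<^sub>\<infinity>n. w powi n * (F n * F (n + 1)))"
  have hs: "((\<lambda>n. w powi n * (F n * F n)) has_sum A) UNIV"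
    "((\<lambda>n. w powi n * (F n * F (n + 1))) has_sum B) UNIV"
    using s[of 0 0] s[of 0 1] by (auto simp: A_def B_def)
  have shift: "((\<lambda>n. f (n + c)) has_sum x) UNIV" if "(f has_sum x) UNIV" for f :: "int \<Rightarrow> real" and c x
    using that has_sum_reindex_bij_betw[OF bij_plus_right, of f c x] by simp
  have wp: "w powi (n + 1) = w * w powi n" "w powi (n + - 1) = w powi n / w" for n
    using w power_int_add[of w n 1] power_int_add[of w n "-1"] by (simp_all add: field_simps)
  have hs2: "((\<lambda>n. w * (w powi n * (F (n + 1) * F (n + 1)))) has_sum A) UNIV"
    using shift[OF hs(1), of 1] unfolding wp by (simp add: mult_ac)
  have hs3: "((\<lambda>n. w powi n / w * (F (n - 1) * F n)) has_sum B) UNIV"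
    using shift[OF hs(2), of "- 1"] unfolding wp by simp
  have hs4: "((\<lambda>n. w powi n * (F (n - 1) * F n)) has_sum w * B) UNIV"
    using has_sum_cmult_right[OF hs3, of w] w by simp
  have "((\<lambda>n. w powi n * (F n * F n) - 2 * w * (w powi n * (F n * F (n + 1)))
      + w * (w * (w powi n * (F (n + 1) * F (n + 1))))) has_sum A - 2 * w * B + w * A) UNIV"
    by (intro has_sum_add has_sum_diff has_sum_cmult_right hs hs2)
  moreover have "w powi n * (F n * F n) - 2 * w * (w powi n * (F n * F (n + 1)))
      + w * (w * (w powi n * (F (n + 1) * F (n + 1)))) = w powi n * (h w n * h w n)" for n
    unfolding h_raise[of w n] F_def[symmetric] by (simp add: algebra_simps)
  ultimately have 1: "N w = A - 2 * w * B + w * A" unfolding N_def by (simp add: infsumI)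
  have "((\<lambda>n. w powi n * (F n * F n) - w * (w powi n * (F n * F (n + 1)))
      - w powi n * (F (n - 1) * F n) + w * (w powi n * (F n * F n))) has_sum A - w * B - w * B + w * A) UNIV"
    by (intro has_sum_add has_sum_diff has_sum_cmult_right hs hs4)
  moreover have "w powi n * (F n * F n) - w * (w powi n * (F n * F (n + 1)))
      - w powi n * (F (n - 1) * F n) + w * (w powi n * (F n * F n)) = (Q * w) powi n * (F n * F n)" for n
  proof -
    \<comment> \<open>Eliminating \<open>h w\<close> between \<open>h_step\<close> and
      \<open>h_raise\<close> leaves the three-term recurrence in n.\<close>
    have "Q powi n * F n = F n - w * F (n + 1) - (F (n - 1) - w * F n)"
      using h_step[of w n] h_raise[of w n] h_raise[of w "n - 1"] by (simp add: F_def)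
    then have "w powi n * F n * (Q powi n * F n) = w powi n * F n * (F n - w * F (n + 1) - (F (n - 1) - w * F n))"
      by simp
    then show ?thesis by (simp add: power_int_mult_distrib algebra_simps)
  qed
  ultimately have "N (Q * w) = A - w * B - w * B + w * A" unfolding N_def F_def by (simp add: infsumI)
  then show ?thesis using 1 by simp
qed

text \<open>Both tails are geometric with ratio w; towards -inf the ratio arises as w * w / w. So
  the sum concentrates on its term n = 0 as w -> 0.\<close>

lemma N_near: assumes w: "0 < w" "w < 1"
  shows "\<bar>N w - h w 0 * h w 0\<bar> \<le> 2 * (S * S) ^ 2 * w / (1 - w)"
proof -
  have "norm (infsum (\<lambda>n. w powi n * (h w n * h w n)) UNIV - w powi 0 * (h w 0 * h w 0))
      \<le> 2 * (S * S) ^ 2 * w / (1 - w)"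
  proof (rule summable_on_int_geometric(3))
    show "norm (w powi (int k) * (h w (int k) * h w (int k))) \<le> (S * S) ^ 2 * w ^ k" for k
      using h_product_bounds(1)[of w w w k 0 0] w by simp
    show "norm (w powi (- int k) * (h w (- int k) * h w (- int k))) \<le> (S * S) ^ 2 * w ^ k" for k
      using h_product_bounds(2)[of w w w k 0 0] w by simp
  qed (use w in auto)
  then show ?thesis by (simp add: N_def)
qed

text \<open>Along w Q^k -> 0 the value does not change while only the term n = 0 survives, and
  \<open>h_0_near\<close> evaluates that term.\<close>

lemma N_eq: assumes w: "0 < w" "w < 1" shows "N w = E Q * E Q"
proof -
  define v where "v k = w * Q ^ k" for k
  have v: "0 < v k \<and> v k < 1 \<and> N (v k) = N w" for k
  proof (induction k)
    case (Suc k)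
    have "v (Suc k) = Q * v k" by (simp add: v_def)
    then show ?case using Suc N_step[of "v k"] Qw[of "v k"] by simp
  qed (use w in \<open>simp add: v_def\<close>)
  have v0: "v \<longlonglongrightarrow> 0" unfolding v_def
    using Q_pos Q_less_1 by (intro tendsto_mult_right_zero LIMSEQ_power_zero) auto
  have "(\<lambda>k. h (v k) 0 - E Q) \<longlonglongrightarrow> 0"
  proof (rule Lim_null_comparison)
    show "\<forall>\<^sub>F k in sequentially. norm (h (v k) 0 - E Q) \<le> v k * (S * S)"
      using v h_0_near by (auto intro!: always_eventually simp: less_imp_le)
    show "(\<lambda>k. v k * (S * S)) \<longlonglongrightarrow> 0" by (intro tendsto_mult_left_zero v0)
  qed
  then have "(\<lambda>k. h (v k) 0) \<longlonglongrightarrow> E Q" by (simp add: LIM_zero_iff)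
  then have l: "(\<lambda>k. h (v k) 0 * h (v k) 0) \<longlonglongrightarrow> E Q * E Q" by (intro tendsto_mult)
  have "(\<lambda>k. h (v k) 0 * h (v k) 0 - N w) \<longlonglongrightarrow> 0"
  proof (rule Lim_null_comparison)
    show "\<forall>\<^sub>F k in sequentially. norm (h (v k) 0 * h (v k) 0 - N w) \<le> 2 * (S * S) ^ 2 * v k / (1 - v k)"
    proof (rule always_eventually, rule allI)
      fix k
      show "norm (h (v k) 0 * h (v k) 0 - N w) \<le> 2 * (S * S) ^ 2 * v k / (1 - v k)"
        using N_near[of "v k"] v[of k] by (simp add: abs_minus_commute)
    qed
    have "(\<lambda>k. 2 * (S * S) ^ 2 * v k / (1 - v k)) \<longlonglongrightarrow> 2 * (S * S) ^ 2 * 0 / (1 - 0)"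
      by (intro tendsto_intros v0) auto
    then show "(\<lambda>k. 2 * (S * S) ^ 2 * v k / (1 - v k)) \<longlonglongrightarrow> 0" by simp
  qed
  then have "(\<lambda>k. h (v k) 0 * h (v k) 0) \<longlonglongrightarrow> N w" by (simp add: LIM_zero_iff)
  then show ?thesis using l LIMSEQ_unique by blast
qed

lemma h_orthogonal:
  assumes w: "0 < w" "w < 1"
  shows "((\<lambda>n. w powi n * (h w (n + m) * h w (n + l))) has_sum
    (if m = l then E Q * E Q * w powi (- m) else 0)) UNIV"
proof -
  have "(\<Sum>\<^sub>\<infinity>n. w powi n * (h w (n + m) * h w (n + m))) = E Q * E Q * w powi (- m)"
  proof -
    have "w powi n * (h w (n + m) * h w (n + m)) = w powi (- m) * (w powi (n + m) * (h w (n + m) * h w (n + m)))" for n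
      using w power_int_add[of w "- m" "n + m"] by simp
    then have "(\<Sum>\<^sub>\<infinity>n. w powi n * (h w (n + m) * h w (n + m)))
        = w powi (- m) * (\<Sum>\<^sub>\<infinity>n. w powi (n + m) * (h w (n + m) * h w (n + m)))"
      by (simp only: infsum_cmult_right')
    also have "(\<Sum>\<^sub>\<infinity>n. w powi (n + m) * (h w (n + m) * h w (n + m))) = N w"
      unfolding N_def by (rule infsum_int_shift)
    finally show ?thesis using N_eq[OF w] by simp
  qed
  moreover have "(\<lambda>n. w powi n * (h w (n + m) * h w (n + l))) summable_on UNIV"
    using w by (intro h_product_summable) (auto simp: mult_less_left)
  ultimately show ?thesis using h_orthogonal_ne[OF w, of m l] by (auto simp: has_sum_iff)
qed

end

section \<open>Symmetric orthogonal matrices on square-summable sequences\<close>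

lemma has_sum_sum:
  fixes f :: "'k \<Rightarrow> 'i \<Rightarrow> 'b::topological_comm_monoid_add"
  assumes "finite F" "\<And>k. k \<in> F \<Longrightarrow> (f k has_sum s k) A"
  shows "((\<lambda>i. \<Sum>k\<in>F. f k i) has_sum (\<Sum>k\<in>F. s k)) A"
  using assms by (induction F) (auto intro!: has_sum_add)

definition l2 :: "('i \<Rightarrow> complex) \<Rightarrow> bool" where
  "l2 a \<longleftrightarrow> (\<lambda>k. (norm (a k))\<^sup>2) summable_on UNIV"

definition l2_norm2 :: "('i \<Rightarrow> complex) \<Rightarrow> real" where
  "l2_norm2 a = (\<Sum>\<^sub>\<infinity>k. (norm (a k))\<^sup>2)"

lemma norm_add_squared_le: "(norm (x + y :: complex))\<^sup>2 \<le> 2 * (norm x)\<^sup>2 + 2 * (norm y)\<^sup>2"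
proof -
  have "(norm (x + y))\<^sup>2 \<le> (norm x + norm y)\<^sup>2" by (intro power_mono norm_triangle_ineq) auto
  also have "\<dots> \<le> 2 * (norm x)\<^sup>2 + 2 * (norm y)\<^sup>2"
    using zero_le_power2[of "norm x - norm y"] unfolding power2_sum power2_diff by linarith
  finally show ?thesis .
qed

lemma l2_add: assumes "l2 a" "l2 b" shows "l2 (\<lambda>k. a k + b k)"
  using summable_on_add[OF summable_on_cmult_right[OF assms(1)[unfolded l2_def], of 2]
      summable_on_cmult_right[OF assms(2)[unfolded l2_def], of 2]] norm_add_squared_le
  unfolding l2_def by (rule summable_on_comparison_test) auto

lemma l2_cmult: "l2 a \<Longrightarrow> l2 (\<lambda>k. c * a k)"
  unfolding l2_def by (auto simp: norm_mult power_mult_distrib intro!: summable_on_cmult_right)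

lemma l2_norm2_cmult: "l2_norm2 (\<lambda>k. c * a k) = (norm c)\<^sup>2 * l2_norm2 a"
  unfolding l2_norm2_def by (simp add: norm_mult power_mult_distrib infsum_cmult_right')

lemma l2_point_le: "l2 a \<Longrightarrow> (norm (a i))\<^sup>2 \<le> l2_norm2 a"
  using finite_sum_le_infsum[of "\<lambda>k. (norm (a k))\<^sup>2" UNIV "{i}"] by (auto simp: l2_def l2_norm2_def)

lemma l2_product_summable:
  assumes "l2 a" "l2 b"
  shows "(\<lambda>k. norm (a k * b k)) summable_on UNIV"
proof (rule summable_on_comparison_test)
  show "(\<lambda>k. (norm (a k))\<^sup>2 + (norm (b k))\<^sup>2) summable_on UNIV"
    using assms unfolding l2_def by (rule summable_on_add)
  show "norm (a k * b k) \<le> (norm (a k))\<^sup>2 + (norm (b k))\<^sup>2" for k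
    using sum_squares_bound[of "norm (a k)" "norm (b k)"]
      mult_nonneg_nonneg[OF norm_ge_zero[of "a k"] norm_ge_zero[of "b k"]]
    unfolding norm_mult by linarith
qed auto

definition mat_app :: "('i \<Rightarrow> 'i \<Rightarrow> real) \<Rightarrow> ('i \<Rightarrow> complex) \<Rightarrow> 'i \<Rightarrow> complex" where
  "mat_app M a i = (\<Sum>\<^sub>\<infinity>k. complex_of_real (M i k) * a k)"

text \<open>This holds for every sequence: a nonzero factor does not affect summability, and the
  default value 0 of a divergent \<open>infsum\<close> scales correctly.\<close>

lemma mat_app_cmult: "mat_app M (\<lambda>k. c * a k) i = c * mat_app M a i"
  unfolding mat_app_def infsum_cmult_right'[symmetric] by (simp only: mult.left_commute)

lemma l2_truncate:
  assumes a: "l2 a" and F: "finite F"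
  shows "l2 (\<lambda>k. if k \<in> F then a k else 0)" "l2 (\<lambda>k. if k \<in> F then 0 else a k)"
    "l2_norm2 (\<lambda>k. if k \<in> F then 0 else a k) = l2_norm2 a - (\<Sum>k\<in>F. (norm (a k))\<^sup>2)"
proof -
  define b where "b k = (if k \<in> F then 0 else a k)" for k
  define c where "c k = (if k \<in> F then a k else 0)" for k
  have sc: "(\<lambda>k. (norm (c k))\<^sup>2) summable_on UNIV"
    using F by (intro summable_on_cong_neutral[THEN iffD1, OF _ _ _ summable_on_finite[OF F]])
      (auto simp: c_def)
  have sb: "(\<lambda>k. (norm (b k))\<^sup>2) summable_on UNIV"
    using a unfolding l2_def by (rule summable_on_comparison_test) (auto simp: b_def)
  show "l2 (\<lambda>k. if k \<in> F then a k else 0)" "l2 (\<lambda>k. if k \<in> F then 0 else a k)"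
    using sb sc by (auto simp: l2_def b_def c_def)
  have "(\<lambda>k. (norm (a k))\<^sup>2) = (\<lambda>k. (norm (b k))\<^sup>2 + (norm (c k))\<^sup>2)" by (auto simp: b_def c_def)
  then have "l2_norm2 a = l2_norm2 b + l2_norm2 c"
    unfolding l2_norm2_def using infsum_add[OF sb sc] by simp
  moreover have "l2_norm2 c = (\<Sum>\<^sub>\<infinity>k\<in>F. (norm (a k))\<^sup>2)"
    unfolding l2_norm2_def by (rule infsum_cong_neutral) (auto simp: c_def)
  ultimately show "l2_norm2 (\<lambda>k. if k \<in> F then 0 else a k) = l2_norm2 a - (\<Sum>k\<in>F. (norm (a k))\<^sup>2)"
    using F by (simp add: b_def[abs_def])
qed

lemma l2_tail_tendsto:
  assumes a: "l2 a"
  shows "((\<lambda>F. l2_norm2 (\<lambda>k. if k \<in> F then 0 else a k)) \<longlongrightarrow> 0) (finite_subsets_at_top UNIV)"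
proof -
  have "((\<lambda>F. l2_norm2 a - (\<Sum>k\<in>F. (norm (a k))\<^sup>2)) \<longlongrightarrow> l2_norm2 a - l2_norm2 a) (finite_subsets_at_top UNIV)"
    using a unfolding l2_def l2_norm2_def by (intro tendsto_diff tendsto_const infsum_tendsto)
  moreover have "\<forall>\<^sub>F F in finite_subsets_at_top UNIV.
      l2_norm2 a - (\<Sum>k\<in>F. (norm (a k))\<^sup>2) = l2_norm2 (\<lambda>k. if k \<in> F then 0 else a k)"
    unfolding eventually_finite_subsets_at_top using l2_truncate(3)[OF a] by auto
  ultimately show ?thesis by (simp add: tendsto_cong)
qed

locale symmetric_orthogonal =
  fixes M :: "'i \<Rightarrow> 'i \<Rightarrow> real"
  assumes sym: "M i j = M j i"
    and orthonormal: "((\<lambda>k. M i k * M j k) has_sum (if i = j then 1 else 0)) UNIV"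
begin

lemma l2_row: "l2 (\<lambda>k. complex_of_real (M i k))"
  using orthonormal[of i i] unfolding l2_def by (auto simp: power2_eq_square has_sum_imp_summable)

lemma summable_row: "l2 a \<Longrightarrow> (\<lambda>k. complex_of_real (M i k) * a k) summable_on UNIV"
  by (rule abs_summable_summable[OF l2_product_summable[OF l2_row]])

lemma has_sum_mat_app:
  "l2 a \<Longrightarrow> ((\<lambda>k. complex_of_real (M i k) * a k) has_sum mat_app M a i) UNIV"
  unfolding mat_app_def by (intro has_sum_infsum summable_row)

lemma mat_app_add:
  "l2 a \<Longrightarrow> l2 b \<Longrightarrow> mat_app M (\<lambda>k. a k + b k) i = mat_app M a i + mat_app M b i"
  unfolding mat_app_def distrib_left by (intro infsum_add summable_row)

text \<open>By symmetry the columns are orthonormal too, so this is Pythagoras for a finite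
  combination of columns.\<close>

lemma finite_column_norm:
  assumes "finite F"
  shows "((\<lambda>i. (norm (\<Sum>k\<in>F. complex_of_real (M i k) * a k))\<^sup>2) has_sum (\<Sum>k\<in>F. (norm (a k))\<^sup>2)) UNIV"
proof -
  have 1: "((\<lambda>i. complex_of_real (M k i * M l i) * (a k * cnj (a l))) has_sum
      (if k = l then of_real ((norm (a k))\<^sup>2) else 0)) UNIV" for k l
    using has_sum_cmult_left[OF has_sum_of_real[OF orthonormal[of k l]], of "a k * cnj (a l)"]
    by (auto simp: complex_norm_square simp del: of_real_power)
  have "((\<lambda>i. \<Sum>k\<in>F. \<Sum>l\<in>F. complex_of_real (M k i * M l i) * (a k * cnj (a l))) has_sum
      (\<Sum>k\<in>F. \<Sum>l\<in>F. if k = l then complex_of_real ((norm (a k))\<^sup>2) else 0)) UNIV"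
    by (intro has_sum_sum assms 1)
  moreover have "(\<Sum>k\<in>F. \<Sum>l\<in>F. if k = l then complex_of_real ((norm (a k))\<^sup>2) else 0)
      = of_real (\<Sum>k\<in>F. (norm (a k))\<^sup>2)"
    using assms by simp
  moreover have "(\<Sum>k\<in>F. \<Sum>l\<in>F. complex_of_real (M k i * M l i) * (a k * cnj (a l)))
      = complex_of_real ((norm (\<Sum>k\<in>F. complex_of_real (M i k) * a k))\<^sup>2)" for i
    unfolding complex_norm_square cnj_sum sum_product
  proof (intro sum.cong refl)
    show "complex_of_real (M k i * M l i) * (a k * cnj (a l))
        = complex_of_real (M i k) * a k * cnj (complex_of_real (M i l) * a l)" for k l
      using sym[of k i] sym[of l i] by simp
  qed
  ultimately have "((\<lambda>i. complex_of_real ((norm (\<Sum>k\<in>F. complex_of_real (M i k) * a k))\<^sup>2))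
      has_sum complex_of_real (\<Sum>k\<in>F. (norm (a k))\<^sup>2)) UNIV"
    by (simp only:)
  then show ?thesis by (simp only: has_sum_of_real_iff)
qed

text \<open>Finitely many coordinates pass to the limit along finite truncations of
  \<open>a\<close>, for which \<open>finite_column_norm\<close> gives the bound. This avoids
  exchanging two infinite sums.\<close>

lemma mat_app_partial_norm:
  assumes "l2 a" "finite G"
  shows "(\<Sum>i\<in>G. (norm (mat_app M a i))\<^sup>2) \<le> l2_norm2 a"
proof (rule tendsto_upperbound)
  have "((\<lambda>F. \<Sum>k\<in>F. complex_of_real (M i k) * a k) \<longlongrightarrow> mat_app M a i) (finite_subsets_at_top UNIV)" for i
    using has_sum_mat_app[OF assms(1)] by (simp add: has_sum_def)
  then show "((\<lambda>F. \<Sum>i\<in>G. (norm (\<Sum>k\<in>F. complex_of_real (M i k) * a k))\<^sup>2) \<longlongrightarrow>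
      (\<Sum>i\<in>G. (norm (mat_app M a i))\<^sup>2)) (finite_subsets_at_top UNIV)"
    by (intro tendsto_sum tendsto_power tendsto_norm)
  have "(\<Sum>i\<in>G. (norm (\<Sum>k\<in>F. complex_of_real (M i k) * a k))\<^sup>2) \<le> l2_norm2 a" if "finite F" for F
  proof -
    have "(\<Sum>i\<in>G. (norm (\<Sum>k\<in>F. complex_of_real (M i k) * a k))\<^sup>2) \<le> (\<Sum>k\<in>F. (norm (a k))\<^sup>2)"
      by (rule finite_sum_le_has_sum[OF finite_column_norm[OF that]]) (use assms in auto)
    also have "\<dots> \<le> l2_norm2 a"
      using assms that unfolding l2_def l2_norm2_def by (intro finite_sum_le_infsum) auto
    finally show ?thesis .
  qed
  then show "\<forall>\<^sub>F F in finite_subsets_at_top UNIV.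
      (\<Sum>i\<in>G. (norm (\<Sum>k\<in>F. complex_of_real (M i k) * a k))\<^sup>2) \<le> l2_norm2 a"
    by (auto simp: eventually_finite_subsets_at_top)
qed simp

lemma mat_app_l2:
  assumes "l2 a"
  shows "l2 (mat_app M a)" "l2_norm2 (mat_app M a) \<le> l2_norm2 a"
proof -
  have "(\<lambda>i. (norm (mat_app M a i))\<^sup>2) summable_on UNIV"
    by (rule nonneg_bdd_above_summable_on)
      (auto intro!: bdd_aboveI2[where M = "l2_norm2 a"] mat_app_partial_norm assms)
  then show "l2 (mat_app M a)" by (simp add: l2_def)
  from \<open>(\<lambda>i. _ i) summable_on UNIV\<close> show "l2_norm2 (mat_app M a) \<le> l2_norm2 a"
    unfolding l2_norm2_def[of "mat_app M a"]
    by (rule infsum_le_finite_sums) (auto intro!: mat_app_partial_norm assms)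
qed

text \<open>Truncating \<open>a\<close> to a finite set reduces the identity to finitely supported sequences, because
  the double application is a contraction on the tail.\<close>

lemma mat_app_involution:
  assumes a: "l2 a"
  shows "mat_app M (mat_app M a) i = a i"
proof -
  have bound: "(norm (mat_app M (mat_app M a) i - a i))\<^sup>2 \<le> l2_norm2 (\<lambda>k. if k \<in> F then 0 else a k)"
    if F: "finite F" "i \<in> F" for F
  proof -
    define b where "b = (\<lambda>k. if k \<in> F then 0 else a k)"
    define c where "c = (\<lambda>k. if k \<in> F then a k else 0)"
    have abc: "a = (\<lambda>k. b k + c k)" by (auto simp: b_def c_def)
    have bc: "l2 b" "l2 c" unfolding b_def c_def using l2_truncate[OF a F(1)] by auto
    have "mat_app M c m = (\<Sum>\<^sub>\<infinity>k\<in>F. complex_of_real (M m k) * a k)" for m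
      unfolding mat_app_def by (rule infsum_cong_neutral) (auto simp: c_def)
    then have Mc: "mat_app M c m = (\<Sum>k\<in>F. complex_of_real (M m k) * a k)" for m
      using F by simp
    have "((\<lambda>m. complex_of_real (M i m) * mat_app M c m) has_sum
        (\<Sum>k\<in>F. (if i = k then 1 else 0) * a k)) UNIV"
    proof -
      have "((\<lambda>m. complex_of_real (M i m * M k m) * a k) has_sum ((if i = k then 1 else 0) * a k)) UNIV" for k
        using has_sum_cmult_left[OF has_sum_of_real[OF orthonormal[of i k]], of "a k"]
        by (auto split: if_splits)
      then have "((\<lambda>m. \<Sum>k\<in>F. complex_of_real (M i m * M k m) * a k) has_sum
          (\<Sum>k\<in>F. (if i = k then 1 else 0) * a k)) UNIV"
        using F by (intro has_sum_sum) auto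
      moreover have "(\<Sum>k\<in>F. complex_of_real (M i m * M k m) * a k) = complex_of_real (M i m) * mat_app M c m" for m
        unfolding Mc sum_distrib_left
      proof (rule sum.cong)
        show "complex_of_real (M i m * M k m) * a k = complex_of_real (M i m) * (complex_of_real (M m k) * a k)" for k
          using sym[of k m] by simp
      qed simp
      ultimately show ?thesis by simp
    qed
    then have MMc: "mat_app M (mat_app M c) i = a i"
      using F by (simp add: mat_app_def infsumI if_distrib[of "\<lambda>x. x * _"] cong: if_cong)
    have "mat_app M (mat_app M a) i = mat_app M (mat_app M b) i + mat_app M (mat_app M c) i"
      using bc unfolding abc by (simp add: mat_app_add mat_app_l2 ext[OF mat_app_add[OF bc]])
    with MMc have "(norm (mat_app M (mat_app M a) i - a i))\<^sup>2 = (norm (mat_app M (mat_app M b) i))\<^sup>2" by simp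
    also have "\<dots> \<le> l2_norm2 (mat_app M (mat_app M b))" by (intro l2_point_le mat_app_l2 bc)
    also have "\<dots> \<le> l2_norm2 b" using mat_app_l2[OF bc(1)] mat_app_l2[OF mat_app_l2(1)[OF bc(1)]] by linarith
    finally show ?thesis by (simp only: b_def)
  qed
  have "\<forall>\<^sub>F F in finite_subsets_at_top UNIV.
      (norm (mat_app M (mat_app M a) i - a i))\<^sup>2 \<le> l2_norm2 (\<lambda>k. if k \<in> F then 0 else a k)"
    unfolding eventually_finite_subsets_at_top using bound by (intro exI[of _ "{i}"]) auto
  then have "(norm (mat_app M (mat_app M a) i - a i))\<^sup>2 \<le> 0"
    by (intro tendsto_lowerbound[OF l2_tail_tendsto[OF a]]) auto
  then show ?thesis by simp
qed

text \<open>A contraction that is its own inverse preserves the norm.\<close>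

lemma mat_app_isometry: assumes "l2 a" shows "l2_norm2 (mat_app M a) = l2_norm2 a"
proof (rule antisym)
  have "mat_app M (mat_app M a) = a" using mat_app_involution[OF assms] by auto
  then show "l2_norm2 a \<le> l2_norm2 (mat_app M a)"
    using mat_app_l2(2)[OF mat_app_l2(1)[OF assms]] by simp
qed (rule mat_app_l2(2)[OF assms])

end

section \<open>Sequence model of even Schwartz functions\<close>

context q_base
begin

text \<open>Boundedness near the origin only: the nonnegative indices are the arguments q^k \<le>
  1.\<close>

definition bd :: "(int \<Rightarrow> complex) \<Rightarrow> bool" where
  "bd a \<longleftrightarrow> (\<exists>B. \<forall>k. norm (a (int k)) \<le> B)"

text \<open>Rapid decay at large arguments: index -k is the argument q^(-k), and for Q = q^2 the
  bound (Q^k)^m is its power of exponent -2m, with m arbitrary.\<close>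

definition dec :: "(int \<Rightarrow> complex) \<Rightarrow> bool" where
  "dec a \<longleftrightarrow> (\<forall>m. \<exists>B. \<forall>k. norm (a (- int k)) \<le> B * (Q ^ k) ^ m)"

definition DD :: "(int \<Rightarrow> complex) \<Rightarrow> int \<Rightarrow> complex" where
  "DD a n = (a (n - 1) - a n) / complex_of_real (Q powi n)"

text \<open>Sequences \<open>a n = f (q\<^sup>n)\<close> of even Schwartz functions \<open>f\<close>: the index runs to
  \<open>-\<infinity>\<close> as the argument grows, and \<open>DD\<close> is \<open>q_deriv\<close> divided by the
  argument, up to the factor \<open>1 - q\<close>.\<close>

definition schwartz_seq :: "(int \<Rightarrow> complex) \<Rightarrow> bool" where
  "schwartz_seq a \<longleftrightarrow> dec a \<and> (\<forall>j. bd ((DD ^^ j) a))"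

lemma bd_add: "bd a \<Longrightarrow> bd b \<Longrightarrow> bd (\<lambda>n. a n + b n)"
  unfolding bd_def using norm_triangle_mono by blast

lemma bd_cmult: "bd a \<Longrightarrow> bd (\<lambda>n. c * a n)"
  unfolding bd_def norm_mult using mult_left_mono[OF _ norm_ge_zero[of c]] by blast

text \<open>A shift brings only finitely many new indices into the range, and their values are
  bounded by a maximum.\<close>

lemma bd_shift: assumes "bd a" shows "bd (\<lambda>n. a (n + c))"
proof -
  obtain B where B: "\<And>k. norm (a (int k)) \<le> B" using assms by (auto simp: bd_def)
  define B' where "B' = Max ((\<lambda>i. norm (a i)) ` {-\<bar>c\<bar>..0})"
  have "norm (a (int k + c)) \<le> max B B'" for k
  proof (cases "int k + c \<ge> 0")
    case True
    then show ?thesis using B[of "nat (int k + c)"] by simp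
  next
    case False
    then have "norm (a (int k + c)) \<le> B'" unfolding B'_def by (intro Max_ge) auto
    then show ?thesis by simp
  qed
  then show ?thesis unfolding bd_def by blast
qed

lemma dec_add: assumes "dec a" "dec b" shows "dec (\<lambda>n. a n + b n)"
  unfolding dec_def
proof
  fix m
  obtain B1 where "\<And>k. norm (a (- int k)) \<le> B1 * (Q ^ k) ^ m" using assms(1) unfolding dec_def by blast
  moreover obtain B2 where "\<And>k. norm (b (- int k)) \<le> B2 * (Q ^ k) ^ m" using assms(2) unfolding dec_def by blast
  ultimately have "norm (a (- int k) + b (- int k)) \<le> (B1 + B2) * (Q ^ k) ^ m" for k
    unfolding distrib_right using norm_triangle_mono by blast
  then show "\<exists>B. \<forall>k. norm (a (- int k) + b (- int k)) \<le> B * (Q ^ k) ^ m" by blast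
qed

lemma dec_cmult: assumes "dec a" shows "dec (\<lambda>n. c * a n)"
  unfolding dec_def
proof
  fix m
  obtain B where "\<And>k. norm (a (- int k)) \<le> B * (Q ^ k) ^ m" using assms unfolding dec_def by blast
  then have "norm (c * a (- int k)) \<le> (norm c * B) * (Q ^ k) ^ m" for k
    unfolding norm_mult mult.assoc by (intro mult_left_mono) auto
  then show "\<exists>B. \<forall>k. norm (c * a (- int k)) \<le> B * (Q ^ k) ^ m" by blast
qed

lemma dec_bounded: assumes "dec a" obtains B where "\<And>k. norm (a (- int k)) \<le> B"
proof -
  obtain B where "\<forall>k. norm (a (- int k)) \<le> B * (Q ^ k) ^ 0" using assms unfolding dec_def by blast
  then show ?thesis using that[of B] by simp
qed

lemma dec_shift: assumes "dec a" shows "dec (\<lambda>n. a (n + c))"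
  unfolding dec_def
proof
  fix m
  obtain B where B: "\<And>k. norm (a (- int k)) \<le> B * (Q ^ k) ^ m" using assms unfolding dec_def by blast
  have B0: "0 \<le> B" using order_trans[OF norm_ge_zero B[of 0]] by simp
  define j where "j = nat \<bar>c\<bar>"
  have Qj: "0 < (Q ^ j) ^ m" using Q_pos by simp
  define B' where "B' = Max ((\<lambda>i. norm (a i)) ` {0..\<bar>c\<bar>})"
  have B'0: "0 \<le> B'" unfolding B'_def by (rule order_trans[OF norm_ge_zero[of "a 0"]]) (intro Max_ge, auto)
  have "norm (a (- int k + c)) \<le> (B + B') / (Q ^ j) ^ m * (Q ^ k) ^ m" for k
  proof (cases "- int k + c \<le> 0")
    case True
    define i where "i = nat (int k - c)"
    have i: "int i = int k - c" using True by (simp add: i_def)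
    have "norm (a (- int k + c)) \<le> B * (Q ^ i) ^ m" using B[of i] i by simp
    also have "\<dots> = B / (Q ^ j) ^ m * (Q ^ (i + j)) ^ m" using Q_pos by (simp add: power_add power_mult_distrib)
    also have "\<dots> \<le> (B + B') / (Q ^ j) ^ m * (Q ^ k) ^ m"
    proof (intro mult_mono divide_right_mono power_mono power_decreasing)
      show "k \<le> i + j" using i by (simp add: j_def)
    qed (use B0 B'0 Q_pos Q_less_1 Qj in auto)
    finally show ?thesis .
  next
    case False
    then have "norm (a (- int k + c)) \<le> B'" unfolding B'_def by (intro Max_ge) auto
    also have "B' = B' / (Q ^ j) ^ m * (Q ^ j) ^ m" using Q_pos by simp
    also have "\<dots> \<le> (B + B') / (Q ^ j) ^ m * (Q ^ k) ^ m"
    proof (intro mult_mono divide_right_mono power_mono power_decreasing)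
      show "k \<le> j" using False by (simp add: j_def)
    qed (use B0 B'0 Q_pos Q_less_1 Qj in auto)
    finally show ?thesis .
  qed
  then show "\<exists>B. \<forall>k. norm (a (- int k + c)) \<le> B * (Q ^ k) ^ m" by blast
qed

lemma dec_mult_bounded:
  assumes "dec a" "\<And>k. norm (c (- int k)) \<le> 1"
  shows "dec (\<lambda>n. c n * a n)"
  unfolding dec_def
proof
  fix m
  obtain B where B: "\<And>k. norm (a (- int k)) \<le> B * (Q ^ k) ^ m" using assms unfolding dec_def by blast
  have "norm (c (- int k) * a (- int k)) \<le> B * (Q ^ k) ^ m" for k
    using order_trans[OF mult_left_le_one_le[OF norm_ge_zero norm_ge_zero assms(2)[of k]] B[of k]]
    by (simp add: norm_mult)
  then show "\<exists>B. \<forall>k. norm (c (- int k) * a (- int k)) \<le> B * (Q ^ k) ^ m" by blast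
qed

text \<open>Division by Q^n at n = -k is multiplication by Q^k \<le> 1, so it cannot spoil
  decay.\<close>

lemma dec_DD: assumes "dec a" shows "dec (DD a)"
proof -
  have "dec (\<lambda>n. inverse (complex_of_real (Q powi n)) * (a (n + - 1) + (- 1) * a n))"
    using Q_pos Q_less_1
    by (intro dec_mult_bounded dec_add dec_shift dec_cmult assms)
      (auto simp: norm_inverse norm_power power_int_minus power_le_one)
  then show ?thesis by (simp add: DD_def[abs_def] divide_simps)
qed

lemma DD_add: "DD (\<lambda>n. a n + b n) = (\<lambda>n. DD a n + DD b n)"
  by (auto simp: DD_def add_divide_distrib diff_divide_distrib)

text \<open>A shift by c is the dilation of the argument by q^c; the extra factor is the chain rule
  for this dilation.\<close>

lemma DD_cmult_shift: "DD (\<lambda>n. x * a (n + c)) = (\<lambda>n. x * of_real (Q powi c) * DD a (n + c))"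
proof
  fix n
  have "Q powi (n + c) = Q powi n * Q powi c" using Q_pos by (simp add: power_int_add)
  then show "DD (\<lambda>n. x * a (n + c)) n = x * of_real (Q powi c) * DD a (n + c)"
    using Q_pos by (simp add: DD_def algebra_simps diff_divide_distrib)
qed

lemma funpow_DD_add: "(DD ^^ j) (\<lambda>n. a n + b n) = (\<lambda>n. (DD ^^ j) a n + (DD ^^ j) b n)"
  by (induction j) (simp_all add: DD_add)

lemma funpow_DD_cmult_shift:
  "(DD ^^ j) (\<lambda>n. x * a (n + c)) = (\<lambda>n. x * of_real (Q powi c) ^ j * (DD ^^ j) a (n + c))"
proof (induction j)
  case (Suc j)
  then show ?case
    using DD_cmult_shift[of "x * of_real (Q powi c) ^ j" "(DD ^^ j) a" c] by (simp add: mult_ac)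
qed simp

lemma funpow_DD_cmult: "(DD ^^ j) (\<lambda>n. x * a n) = (\<lambda>n. x * (DD ^^ j) a n)"
  using funpow_DD_cmult_shift[of j x a 0] by simp

lemma schwartz_seq_add:
  "schwartz_seq a \<Longrightarrow> schwartz_seq b \<Longrightarrow> schwartz_seq (\<lambda>n. a n + b n)"
  by (simp add: schwartz_seq_def dec_add funpow_DD_add bd_add)

lemma schwartz_seq_cmult_shift: "schwartz_seq a \<Longrightarrow> schwartz_seq (\<lambda>n. x * a (n + c))"
  by (simp add: schwartz_seq_def dec_cmult dec_shift funpow_DD_cmult_shift bd_cmult bd_shift)

lemma schwartz_seq_cmult: "schwartz_seq a \<Longrightarrow> schwartz_seq (\<lambda>n. x * a n)"
  using schwartz_seq_cmult_shift[of a x 0] by simp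

lemma schwartz_seq_DD: "schwartz_seq a \<Longrightarrow> schwartz_seq (DD a)"
  unfolding schwartz_seq_def
proof (elim conjE, intro conjI allI)
  fix j assume "\<forall>j. bd ((DD ^^ j) a)"
  then show "bd ((DD ^^ j) (DD a))" using spec[of _ "Suc j"] by (metis funpow_Suc_right o_apply)
qed (rule dec_DD)

end

section \<open>The Hankel transform of Schwartz sequences\<close>

context q_base
begin

lemma schwartz_seq_dec: "schwartz_seq a \<Longrightarrow> dec a"
  by (simp add: schwartz_seq_def)

lemma schwartz_seq_bd: "schwartz_seq a \<Longrightarrow> bd a"
  unfolding schwartz_seq_def by (elim conjE, drule spec[of _ 0]) simp

lemma weighted_summable:
  assumes a: "dec a" "bd a" and v: "0 < v" "v < 1" and g: "\<And>n. \<bar>g n\<bar> \<le> C"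
  shows "(\<lambda>n. norm (complex_of_real (v powi n * g n) * a n)) summable_on UNIV"
proof -
  \<comment> \<open>The order of decay p is chosen to beat the growth v^(-k) of the weight at
    negative indices.\<close>
  obtain p where p: "Q ^ p < v" using real_arch_pow_inv[OF v(1) Q_less_1] by blast
  obtain B1 where B1: "\<And>k. norm (a (- int k)) \<le> B1 * (Q ^ k) ^ p" using a(1) unfolding dec_def by blast
  obtain B2 where B2: "\<And>k. norm (a (int k)) \<le> B2" using a(2) unfolding bd_def by blast
  have C0: "0 \<le> C" using order_trans[OF abs_ge_zero g[of 0]] .
  have B0: "0 \<le> B1" "0 \<le> B2"
    using order_trans[OF norm_ge_zero B1[of 0]] order_trans[OF norm_ge_zero B2[of 0]] by simp_all
  define r where "r = max v (Q ^ p / v)"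
  have r: "0 \<le> r" "r < 1" using v p Q_pos by (auto simp: r_def)
  show ?thesis
  proof (rule summable_on_int_geometric(1)[OF r])
    fix k :: nat
    have "norm (complex_of_real (v powi int k * g (int k)) * a (int k)) = \<bar>g (int k)\<bar> * norm (a (int k)) * v ^ k"
      using v by (simp add: norm_mult norm_power)
    also have "\<dots> \<le> C * B2 * r ^ k"
      using v C0 B0 by (intro mult_mono g B2 power_mono) (auto simp: r_def)
    also have "\<dots> \<le> C * (B1 + B2) * r ^ k"
      using r C0 B0 by (intro mult_right_mono mult_left_mono) auto
    finally show "norm (complex_of_real (v powi int k * g (int k)) * a (int k)) \<le> C * (B1 + B2) * r ^ k" .
    have "norm (complex_of_real (v powi (- int k) * g (- int k)) * a (- int k))
        = \<bar>g (- int k)\<bar> * norm (a (- int k)) * inverse (v ^ k)"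
      using v by (simp add: norm_mult power_int_minus norm_inverse norm_power)
    also have "\<dots> \<le> C * (B1 * (Q ^ k) ^ p) * inverse (v ^ k)"
      using v C0 B0 by (intro mult_right_mono mult_mono g B1) auto
    also have "\<dots> = C * B1 * (Q ^ p / v) ^ k"
      by (simp add: power_divide power_commutes field_simps flip: power_mult)
    also have "\<dots> \<le> C * (B1 + B2) * r ^ k"
      using v Q_pos C0 B0 by (intro mult_mono power_mono) (auto simp: r_def)
    finally show "norm (complex_of_real (v powi (- int k) * g (- int k)) * a (- int k)) \<le> C * (B1 + B2) * r ^ k" .
  qed
qed

text \<open>Hankel transform of order nu, up to powers and constants, for w = Q^(nu+1) and Q = q^2:
  the weight w^n is that of |x|^(2 nu + 1) d_q x at x = q^n.\<close>

definition H :: "real \<Rightarrow> (int \<Rightarrow> complex) \<Rightarrow> int \<Rightarrow> complex" where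
  "H w a m = (\<Sum>\<^sub>\<infinity>n. complex_of_real (w powi n * h w (n + m)) * a n)"

context
  fixes w :: real
  assumes w: "0 < w" "w < 1"
begin

lemma has_sum_weighted:
  assumes a: "schwartz_seq a" and v: "0 < v" "v < 1"
  shows "((\<lambda>n. complex_of_real (v powi n * h w (n + m)) * a n) has_sum
    (\<Sum>\<^sub>\<infinity>n. complex_of_real (v powi n * h w (n + m)) * a n)) UNIV"
proof (rule has_sum_infsum[OF abs_summable_summable])
  show "(\<lambda>n. norm (complex_of_real (v powi n * h w (n + m)) * a n)) summable_on UNIV"
    using w by (intro weighted_summable[where C = "S * S"] abs_h_le schwartz_seq_dec schwartz_seq_bd a v) auto
qed

lemma H_has_sum:
  "schwartz_seq a \<Longrightarrow> ((\<lambda>n. complex_of_real (w powi n * h w (n + m)) * a n) has_sum H w a m) UNIV"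
  unfolding H_def by (rule has_sum_weighted[OF _ w])

lemma H_bounded: assumes a: "schwartz_seq a" shows "\<exists>B. \<forall>m. norm (H w a m) \<le> B"
proof (intro exI allI)
  fix m
  have s: "(\<lambda>n. norm (complex_of_real (w powi n * h w (n + m)) * a n)) summable_on UNIV"
    using w by (intro weighted_summable[where C = "S * S"] abs_h_le schwartz_seq_dec schwartz_seq_bd a) auto
  have s': "(\<lambda>n. norm (complex_of_real (w powi n * (S * S)) * a n)) summable_on UNIV"
    using w by (intro weighted_summable[where C = "S * S"] schwartz_seq_dec schwartz_seq_bd a) auto
  have "norm (H w a m) \<le> (\<Sum>\<^sub>\<infinity>n. norm (complex_of_real (w powi n * h w (n + m)) * a n))"
    unfolding H_def by (rule norm_infsum_bound[OF s])
  also have "\<dots> \<le> (\<Sum>\<^sub>\<infinity>n. norm (complex_of_real (w powi n * (S * S)) * a n))"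
  proof (rule infsum_mono[OF s s'])
    fix n
    have "\<bar>w powi n\<bar> * \<bar>h w (n + m)\<bar> \<le> \<bar>w powi n\<bar> * (S * S)"
      using w by (intro mult_left_mono abs_h_le) auto
    then show "norm (complex_of_real (w powi n * h w (n + m)) * a n)
        \<le> norm (complex_of_real (w powi n * (S * S)) * a n)"
      using S_nonneg unfolding norm_mult norm_of_real abs_mult by (intro mult_right_mono) auto
  qed
  finally show "norm (H w a m) \<le> (\<Sum>\<^sub>\<infinity>n. norm (complex_of_real (w powi n * (S * S)) * a n))" .
qed

end

lemma has_sum_int_shift: "(f has_sum x) UNIV \<Longrightarrow> ((\<lambda>n::int. f (n + c)) has_sum x) UNIV"
  using has_sum_reindex_bij_betw[OF bij_plus_right, of f c x] by simp

text \<open>\<open>h_step\<close> under the sum: differencing in m raises the order, and the factor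
  Q^n joins the weight to form (Q w)^n.\<close>

lemma DD_H:
  assumes w: "0 < w" "w < 1" and a: "schwartz_seq a"
  shows "DD (H w a) = (\<lambda>m. - 1 * H (Q * w) a m)"
proof
  fix m
  have "((\<lambda>n. complex_of_real (w powi n * h w (n + (m - 1))) * a n - complex_of_real (w powi n * h w (n + m)) * a n)
      has_sum H w a (m - 1) - H w a m) UNIV"
    by (intro has_sum_diff H_has_sum w a)
  moreover have "complex_of_real (w powi n * h w (n + (m - 1))) * a n - complex_of_real (w powi n * h w (n + m)) * a n
      = - of_real (Q powi m) * (complex_of_real ((Q * w) powi n * h (Q * w) (n + m)) * a n)" for n
  proof -
    have "h w (n + (m - 1)) - h w (n + m) = - (Q powi n * Q powi m * h (Q * w) (n + m))"
      using h_step[of w "n + m"] Q_pos by (simp add: power_int_add algebra_simps)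
    then have "w powi n * h w (n + (m - 1)) - w powi n * h w (n + m)
        = - (Q powi m) * ((Q * w) powi n * h (Q * w) (n + m))"
      unfolding right_diff_distrib[symmetric] by (simp add: power_int_mult_distrib)
    then have "complex_of_real (w powi n * h w (n + (m - 1)) - w powi n * h w (n + m)) * a n
        = complex_of_real (- (Q powi m) * ((Q * w) powi n * h (Q * w) (n + m))) * a n" by simp
    then show ?thesis by (simp add: left_diff_distrib mult.assoc)
  qed
  moreover have "((\<lambda>n. - of_real (Q powi m) * (complex_of_real ((Q * w) powi n * h (Q * w) (n + m)) * a n))
      has_sum - of_real (Q powi m) * H (Q * w) a m) UNIV"
    by (intro has_sum_cmult_right H_has_sum Qw w a)
  ultimately have "H w a (m - 1) - H w a m = - of_real (Q powi m) * H (Q * w) a m"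
    using has_sum_unique by (simp only:) blast
  then show "DD (H w a) m = - 1 * H (Q * w) a m" using Q_pos by (simp add: DD_def)
qed

text \<open>Summation by parts: \<open>h_raise\<close> writes w^n h w (n + m) as a difference in n
  of w^n h (Q w) (n + m), and the shift is moved onto \<open>a\<close>.\<close>

lemma H_eq_H_DD:
  assumes w: "0 < w" "w < 1" and a: "schwartz_seq a"
  shows "H w a m = - H (Q * w) (DD a) m"
proof -
  note qw = Qw[OF w]
  have 1: "((\<lambda>n. complex_of_real (w powi n * h (Q * w) (n + m)) * a n) has_sum x) UNIV"
    if "x = (\<Sum>\<^sub>\<infinity>n. complex_of_real (w powi n * h (Q * w) (n + m)) * a n)" for x
    unfolding that by (rule has_sum_weighted[OF qw(1,2) a w])
  have 2: "((\<lambda>n. complex_of_real (w powi n * h (Q * w) (n + m)) * a (n - 1)) has_sum x) UNIV"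
    if "x = (\<Sum>\<^sub>\<infinity>n. complex_of_real (w powi n * h (Q * w) (n + m)) * a (n - 1))" for x
    unfolding that using has_sum_weighted[OF qw(1,2) schwartz_seq_cmult_shift[OF a, of 1 "-1"] w, of m] by simp
  define X where "X = (\<Sum>\<^sub>\<infinity>n. complex_of_real (w powi n * h (Q * w) (n + m)) * a n)"
  define Y where "Y = (\<Sum>\<^sub>\<infinity>n. complex_of_real (w powi n * h (Q * w) (n + m)) * a (n - 1))"
  have "((\<lambda>n. complex_of_real (w powi (n + 1) * h (Q * w) (n + 1 + m)) * a (n + 1 - 1)) has_sum Y) UNIV"
    by (rule has_sum_int_shift[OF 2[OF Y_def]])
  from has_sum_diff[OF 1[OF X_def] this]
  have "((\<lambda>n. complex_of_real (w powi n * h w (n + m)) * a n) has_sum X - Y) UNIV"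
  proof (rule has_sum_cong[THEN iffD1, rotated])
    fix n
    have "w powi n * h w (n + m) = w powi n * h (Q * w) (n + m) - w powi (n + 1) * h (Q * w) (n + 1 + m)"
      using w unfolding h_raise[of w "n + m"] by (simp add: power_int_add algebra_simps)
    then show "complex_of_real (w powi n * h (Q * w) (n + m)) * a n
        - complex_of_real (w powi (n + 1) * h (Q * w) (n + 1 + m)) * a (n + 1 - 1)
      = complex_of_real (w powi n * h w (n + m)) * a n"
      by (simp only: of_real_diff left_diff_distrib) simp
  qed
  then have XY: "H w a m = X - Y" using H_has_sum[OF w a] has_sum_unique by blast
  have "((\<lambda>n. - (complex_of_real ((Q * w) powi n * h (Q * w) (n + m)) * DD a n)) has_sum X - Y) UNIV"
  proof (rule has_sum_cong[THEN iffD1, OF _ has_sum_diff[OF 1[OF X_def] 2[OF Y_def]]])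
    fix n
    have "a n - a (n - 1) = - of_real (Q powi n) * DD a n" using Q_pos by (simp add: DD_def)
    then have "complex_of_real (w powi n * h (Q * w) (n + m)) * (a n - a (n - 1))
      = complex_of_real (w powi n * h (Q * w) (n + m)) * (- of_real (Q powi n) * DD a n)" by (simp only:)
    then show "complex_of_real (w powi n * h (Q * w) (n + m)) * a n - complex_of_real (w powi n * h (Q * w) (n + m)) * a (n - 1)
      = - (complex_of_real ((Q * w) powi n * h (Q * w) (n + m)) * DD a n)"
      unfolding right_diff_distrib[symmetric] by (simp add: power_int_mult_distrib mult_ac)
  qed
  moreover have "((\<lambda>n. - (complex_of_real ((Q * w) powi n * h (Q * w) (n + m)) * DD a n)) has_sum - H (Q * w) (DD a) m) UNIV"
    unfolding has_sum_uminus using H_has_sum[OF qw(1,2) schwartz_seq_DD[OF a], of m] by simp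
  ultimately show ?thesis using XY has_sum_unique by metis
qed

text \<open>By \<open>DD_H\<close> the left side is a difference of \<open>H w b\<close> in m. Since
  the kernel depends on n + m only, the shift of m becomes one of n and moves onto \<open>b\<close>;
  the factor w comes from the weight.\<close>

lemma Q_H_lower:
  assumes w: "0 < w" "w < 1" and b: "schwartz_seq b"
  shows "of_real (Q powi m) * H (Q * w) b m = H w (\<lambda>n. b n + - of_real w * b (n + 1)) m"
proof -
  note qw = Qw[OF w]
  have "((\<lambda>n. complex_of_real (w powi n * h w (n + (m - 1))) * b n) has_sum H w b (m - 1)) UNIV"
    by (rule H_has_sum[OF w b])
  then have sh: "((\<lambda>n. complex_of_real (w powi (n + 1) * h w (n + 1 + (m - 1))) * b (n + 1)) has_sum H w b (m - 1)) UNIV"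
    by (rule has_sum_int_shift)
  have "((\<lambda>n. complex_of_real (w powi n * h w (n + m)) * (b n + - of_real w * b (n + 1))) has_sum H w b m - H w b (m - 1)) UNIV"
  proof (rule has_sum_cong[THEN iffD1, OF _ has_sum_diff[OF H_has_sum[OF w b] sh]])
    show "complex_of_real (w powi n * h w (n + m)) * b n - complex_of_real (w powi (n + 1) * h w (n + 1 + (m - 1))) * b (n + 1)
      = complex_of_real (w powi n * h w (n + m)) * (b n + - of_real w * b (n + 1))" for n
      using w by (simp add: power_int_add algebra_simps)
  qed
  moreover have "((\<lambda>n. complex_of_real (w powi n * h w (n + m)) * (b n + - of_real w * b (n + 1))) has_sum
      H w (\<lambda>n. b n + - of_real w * b (n + 1)) m) UNIV"
    by (intro H_has_sum w schwartz_seq_add b schwartz_seq_cmult_shift)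
  ultimately have "H w (\<lambda>n. b n + - of_real w * b (n + 1)) m = H w b m - H w b (m - 1)"
    using has_sum_unique by blast
  moreover have "of_real (Q powi m) * H (Q * w) b m = H w b m - H w b (m - 1)"
    using fun_cong[OF DD_H[OF w b], of m] Q_pos by (simp add: DD_def field_simps)
  ultimately show ?thesis by (simp only:)
qed

text \<open>Raising the order by \<open>H_eq_H_DD\<close> and lowering it by
  \<open>Q_H_lower\<close> returns to the same transform with a gain of Q^m, which plays the role of
  \<lambda>^2. The new input is again a Schwartz sequence, so the step can be iterated.\<close>

lemma H_decay_step:
  assumes w: "0 < w" "w < 1" and a: "schwartz_seq a"
  shows "schwartz_seq (\<lambda>n. DD a n + - of_real w * DD a (n + 1))"
    "of_real (Q powi m) * H w a m = - H w (\<lambda>n. DD a n + - of_real w * DD a (n + 1)) m"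
proof -
  show "schwartz_seq (\<lambda>n. DD a n + - of_real w * DD a (n + 1))"
    by (intro schwartz_seq_add schwartz_seq_DD a schwartz_seq_cmult_shift)
  show "of_real (Q powi m) * H w a m = - H w (\<lambda>n. DD a n + - of_real w * DD a (n + 1)) m"
    using Q_H_lower[OF w schwartz_seq_DD[OF a], of m] unfolding H_eq_H_DD[OF w a, of m] by simp
qed

lemma schwartz_seq_H:
  assumes w: "0 < w" "w < 1" and a: "schwartz_seq a"
  shows "schwartz_seq (H w a)"
  unfolding schwartz_seq_def
proof (intro conjI allI)
  show "dec (H w a)" unfolding dec_def
  proof
    fix m
    show "\<exists>B. \<forall>k. norm (H w a (- int k)) \<le> B * (Q ^ k) ^ m"
      using a
    proof (induction m arbitrary: a)
      case 0
      then show ?case using H_bounded[OF w, of a] by auto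
    next
      case (Suc m)
      note st = H_decay_step[OF w Suc.prems]
      from Suc.IH[OF st(1)] obtain B where
        B: "\<And>k. norm (H w (\<lambda>n. DD a n + - of_real w * DD a (n + 1)) (- int k)) \<le> B * (Q ^ k) ^ m" by blast
      have "norm (H w a (- int k)) \<le> B * (Q ^ k) ^ Suc m" for k
      proof -
        have "H w a (- int k) = - (of_real (Q ^ k) * H w (\<lambda>n. DD a n + - of_real w * DD a (n + 1)) (- int k))"
          using st(2)[of "- int k"] Q_pos by (simp add: power_int_minus field_simps)
        then have "norm (H w a (- int k)) = Q ^ k * norm (H w (\<lambda>n. DD a n + - of_real w * DD a (n + 1)) (- int k))"
          using Q_pos by (simp only: norm_minus_cancel norm_mult norm_of_real) simp
        also have "\<dots> \<le> Q ^ k * (B * (Q ^ k) ^ m)" using Q_pos by (intro mult_left_mono B) auto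
        finally show ?thesis by (simp add: mult_ac)
      qed
      then show ?case by blast
    qed
  qed
  fix j
  show "bd ((DD ^^ j) (H w a))"
    using w
  \<comment> \<open>Each \<open>DD\<close> raises the order, so the induction has to run over all
    weights at once.\<close>
  proof (induction j arbitrary: w)
    case 0
    then show ?case using H_bounded[OF 0 a] by (auto simp: bd_def)
  next
    case (Suc j)
    have "(DD ^^ Suc j) (H w a) = (DD ^^ j) (\<lambda>m. - 1 * H (Q * w) a m)"
      using DD_H[OF Suc.prems a] by (simp only: funpow_Suc_right o_apply)
    then show ?case using Suc.IH[OF Qw(1,2)[OF Suc.prems]] by (simp only: funpow_DD_cmult bd_cmult)
  qed
qed

text \<open>Inverts \<open>b \<mapsto> b - c b(\<cdot> + 1)\<close> by a Neumann series, which excludes the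
  growing solution \<open>c\<^sup>-\<^sup>n\<close> by the limit hypothesis.\<close>

lemma bd_of_diff:
  assumes c: "0 < c" "c < 1"
    and lim: "(\<lambda>k. c ^ k * norm (b (int k))) \<longlonglongrightarrow> 0"
    and u: "bd (\<lambda>n. b n - of_real c * b (n + 1))"
  shows "bd b"
proof -
  obtain B where B: "\<And>k. norm (b (int k) - of_real c * b (int k + 1)) \<le> B" using u by (auto simp: bd_def)
  have B0: "0 \<le> B" using order_trans[OF norm_ge_zero B[of 0]] .
  have step: "norm (b (int k)) \<le> B / (1 - c) + c ^ j * norm (b (int (k + j)))" for k j
  proof -
    have "norm (b (int k)) \<le> B * (\<Sum>i<j. c ^ i) + c ^ j * norm (b (int (k + j)))"
    proof (induction j)
      case (Suc j)
      have "norm (b (int (k + j))) \<le> B + c * norm (b (int (k + Suc j)))"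
        using B[of "k + j"] norm_triangle_ineq2[of "b (int (k + j))" "of_real c * b (int (k + j) + 1)"] c
        by (simp add: norm_mult algebra_simps)
      then have "c ^ j * norm (b (int (k + j))) \<le> c ^ j * (B + c * norm (b (int (k + Suc j))))"
        using c by (intro mult_left_mono) auto
      then show ?case using Suc by (simp add: algebra_simps)
    qed simp
    also have "B * (\<Sum>i<j. c ^ i) \<le> B / (1 - c)"
    proof -
      have "(\<Sum>i<j. c ^ i) \<le> 1 / (1 - c)"
        using c sum_gp_strict[of c j] by (simp add: divide_right_mono)
      then show ?thesis using mult_left_mono[OF _ B0] by fastforce
    qed
    finally show ?thesis by simp
  qed
  have "norm (b (int k)) \<le> B / (1 - c)" for k
  proof (rule tendsto_lowerbound)
    have "(\<lambda>j. inverse (c ^ k) * (c ^ (j + k) * norm (b (int (j + k))))) \<longlonglongrightarrow> inverse (c ^ k) * 0"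
      by (intro tendsto_mult tendsto_const LIMSEQ_ignore_initial_segment[OF lim])
    moreover have "inverse (c ^ k) * (c ^ (j + k) * x) = c ^ j * x" for j and x :: real
      using c by (simp add: power_add)
    ultimately have "(\<lambda>j. c ^ j * norm (b (int (k + j)))) \<longlonglongrightarrow> 0" by (simp add: add.commute)
    from tendsto_add[OF tendsto_const this]
    show "(\<lambda>j. B / (1 - c) + c ^ j * norm (b (int (k + j)))) \<longlonglongrightarrow> B / (1 - c)" by simp
  qed (use step in auto)
  then show ?thesis unfolding bd_def by blast
qed

text \<open>The increments are Q^(k+1) times the bounded sequence \<open>DD a\<close>, hence
  summable.\<close>

lemma schwartz_seq_convergent:
  assumes "schwartz_seq a"
  shows "convergent (\<lambda>k. a (int k))"
proof -
  have "bd (DD a)" using schwartz_seq_bd[OF schwartz_seq_DD[OF assms]] .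
  then obtain B where B: "\<And>k. norm (DD a (int k)) \<le> B" by (auto simp: bd_def)
  have "summable (\<lambda>k. a (int (Suc k)) - a (int k))"
  proof (rule summable_comparison_test')
    show "summable (\<lambda>k. B * Q ^ Suc k)" using Q_pos Q_less_1 by (intro summable_mult) (auto simp: summable_geometric)
    fix k :: nat
    have "a (int (Suc k)) - a (int k) = - (DD a (int (Suc k)) * of_real (Q ^ Suc k))"
      using Q_pos by (simp add: DD_def power_int_add)
    then have "norm (a (int (Suc k)) - a (int k)) = norm (DD a (int (Suc k))) * Q ^ Suc k"
      using Q_pos by (simp only: norm_minus_cancel norm_mult norm_of_real) simp
    also have "\<dots> \<le> B * Q ^ Suc k" using Q_pos by (intro mult_right_mono B) auto
    finally show "norm (a (int (Suc k)) - a (int k)) \<le> B * Q ^ Suc k" .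
  qed
  from summable_LIMSEQ[OF this] have "convergent (\<lambda>n. a (int n) - a (int 0))"
    unfolding sum_lessThan_telescope[of "\<lambda>k. a (int k)"] by (auto simp: convergent_def)
  from convergent_add[OF this convergent_const[of "a (int 0)"]] show ?thesis by simp
qed

end

section \<open>The Dunkl transform on the lattice\<close>

locale dunkl_setting =
  fixes q \<alpha> :: real and K :: int
  assumes q: "0 < q" "q < 1"
    and K: "1 - q = q powi K"
    and \<alpha>: "- 1 < \<alpha>"
begin

sublocale q_base "q\<^sup>2"
  using q by unfold_locales (auto simp: power_less_one_iff)

lemma q_powr_less_1: "0 < x \<Longrightarrow> q powr x < 1"
  using q by (simp add: powr_def mult_pos_neg)

text \<open>The powers of s distribute the measure weight evenly between function and kernel, which
  makes the matrix symmetric. For the odd part, of order \<alpha> + 1, the same role is played by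
  \<open>q * s\<close>.\<close>

definition s :: real where "s = q powr (\<alpha> + 1)"

abbreviation w :: real where "w \<equiv> s\<^sup>2"

lemma s: "0 < s" "s < 1"
  using q \<alpha> by (auto simp: s_def q_powr_less_1)

lemma w: "0 < w" "w < 1"
  using s by (auto simp: power_less_one_iff)

lemma qs: "0 < q * s" "q * s < 1"
  using q s mult_strict_mono[of q 1 s 1] by auto

lemma w_eq: "w = q powr (2 * \<alpha> + 2)"
  using q by (simp add: s_def power2_eq_square flip: powr_add)

lemma Qw_eq: "q\<^sup>2 * w = q powr (2 * (\<alpha> + 1) + 2)" "q\<^sup>2 * w = (q * s)\<^sup>2"
proof -
  have "q\<^sup>2 = q powr 2" using q by simp
  then show "q\<^sup>2 * w = q powr (2 * (\<alpha> + 1) + 2)" unfolding w_eq by (simp add: algebra_simps flip: powr_add)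
qed (simp add: power_mult_distrib)

lemma Q_powi: "q\<^sup>2 powi n = (q powi n)\<^sup>2"
  by (simp add: power2_eq_square power_int_mult_distrib)

section \<open>Gamma functions and the Dunkl kernel on the lattice\<close>

lemma Gamma_q2_eq:
  assumes "0 < x"
  shows "Gamma_q2 q x = E (q\<^sup>2) / E (q powr (2 * x)) * (1 - q\<^sup>2) powr (1 - x)"
  unfolding Gamma_q2_def using q assms
  by (subst (1 2) qpoch_inf_eq_E) (auto simp: q_powr_less_1 power_less_one_iff)

lemma eul_closed: "eul n * (q\<^sup>2) ^ n * (\<Prod>k<n. 1 - q\<^sup>2 * (q\<^sup>2) ^ k) = (- 1) ^ n * q ^ (n * (n + 1))"
proof (induction n)
  case (Suc n)
  have e: "q ^ (Suc n * (Suc n + 1)) = q ^ (n * (n + 1)) * ((q\<^sup>2) ^ n * q\<^sup>2)"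
    by (simp add: algebra_simps power_add power2_eq_square flip: power_mult)
  have "eul (Suc n) * (q\<^sup>2) ^ Suc n * (\<Prod>k<Suc n. 1 - q\<^sup>2 * (q\<^sup>2) ^ k)
    = (eul (Suc n) * (1 - (q\<^sup>2) ^ Suc n)) * (q\<^sup>2) ^ n * q\<^sup>2 * (\<Prod>k<n. 1 - q\<^sup>2 * (q\<^sup>2) ^ k)"
    by (simp only: prod.lessThan_Suc power_Suc mult_ac)
  also have "\<dots> = - ((q\<^sup>2) ^ n * q\<^sup>2 * (eul n * (q\<^sup>2) ^ n * (\<Prod>k<n. 1 - q\<^sup>2 * (q\<^sup>2) ^ k)))"
    unfolding eul_Suc by (simp only: mult_ac mult_minus_left mult_minus_right)
  also have "\<dots> = (- 1) ^ Suc n * q ^ (Suc n * (Suc n + 1))"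
    unfolding Suc e by simp
  finally show ?case .
qed simp

text \<open>The powers of 1 - q^2 = (1 - q)(1 + q) left over by the Gamma quotients combine with x /
  (1 + q) to (1 - q) x. This is the origin of the index shift by \<open>K\<close>.\<close>

lemma q_bessel_term:
  assumes "- 1 < \<beta>"
  defines "v \<equiv> q powr (2 * \<beta> + 2)"
  shows "(- 1) ^ n * (Gamma_q2 q (\<beta> + 1) * q ^ (n * (n + 1)))
            / (Gamma_q2 q (\<beta> + real n + 1) * Gamma_q2 q (real n + 1)) * (x / (1 + q)) ^ (2 * n)
    = eul n * (q\<^sup>2 * ((1 - q) * x)\<^sup>2) ^ n * E (v * (q\<^sup>2) ^ n) / E v"
proof -
  define d where "d = 1 - q\<^sup>2"
  have d: "0 < d" using Q_less_1 by (simp add: d_def)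
  have dq: "d = (1 - q) * (1 + q)" by (simp add: d_def algebra_simps power2_eq_square)
  define p where "p = d powr (- \<beta>)"
  have p: "0 < p" using d by (simp add: p_def)
  define P where "P = (\<Prod>k<n. 1 - q\<^sup>2 * (q\<^sup>2) ^ k)"
  define e where "e = E (q\<^sup>2 * (q\<^sup>2) ^ n)"
  have Qn: "q powr (2 * real n) = (q\<^sup>2) ^ n" using q
    by (metis mult.commute of_nat_mult of_nat_numeral power_mult powr_realpow)
  have v1: "v < 1" unfolding v_def using q assms(1) by (simp add: q_powr_less_1)
  have vn: "v * (q\<^sup>2) ^ n < 1"
  proof -
    have "v * (q\<^sup>2) ^ n \<le> v" unfolding v_def using Q_pos Q_less_1 by (simp add: mult_left_le power_le_one)
    then show ?thesis using v1 by linarith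
  qed
  have Qn1: "q\<^sup>2 * (q\<^sup>2) ^ n < 1" using Q_power_less_1[of n] by simp
  have pos: "0 < E v" "0 < E (v * (q\<^sup>2) ^ n)" "0 < e" "0 < E (q\<^sup>2)"
    using v1 vn Qn1 Q_less_1 by (auto simp: e_def intro!: E_pos)
  have EQ: "E (q\<^sup>2) = P * e" unfolding P_def e_def by (rule E_prod)
  then have P0: "P \<noteq> 0" using pos by auto
  have g1: "Gamma_q2 q (\<beta> + 1) = E (q\<^sup>2) / E v * p"
    using assms by (simp add: Gamma_q2_eq v_def p_def d_def algebra_simps)
  have dn: "d powr (- \<beta> - real n) = p / d ^ n" "d powr (- real n) = 1 / d ^ n"
    using d by (simp_all add: p_def powr_diff powr_realpow powr_minus_divide)
  have vq: "q powr (2 * (\<beta> + real n + 1)) = v * (q\<^sup>2) ^ n"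
    unfolding v_def Qn[symmetric] by (simp add: algebra_simps flip: powr_add)
  have g2: "Gamma_q2 q (\<beta> + real n + 1) = E (q\<^sup>2) / E (v * (q\<^sup>2) ^ n) * (p / d ^ n)"
    using assms(1) unfolding dn(1)[symmetric] vq[symmetric]
    by (subst Gamma_q2_eq) (simp_all add: d_def)
  have "q powr (2 * (real n + 1)) = q\<^sup>2 * (q\<^sup>2) ^ n"
    using Qn q by (simp add: distrib_left powr_add)
  then have g3: "Gamma_q2 q (real n + 1) = P * (1 / d ^ n)"
    unfolding dn(2)[symmetric] using EQ pos by (subst Gamma_q2_eq) (simp_all add: d_def e_def)
  have "(- 1) ^ n * (Gamma_q2 q (\<beta> + 1) * q ^ (n * (n + 1)))
            / (Gamma_q2 q (\<beta> + real n + 1) * Gamma_q2 q (real n + 1)) * (x / (1 + q)) ^ (2 * n)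
    = ((- 1) ^ n * q ^ (n * (n + 1)) / P) * (E (v * (q\<^sup>2) ^ n) / E v) * (d ^ n * d ^ n * (x / (1 + q)) ^ (2 * n))"
    unfolding g1 g2 g3 using pos p d P0 by (simp add: field_simps)
  also have "d ^ n * d ^ n * (x / (1 + q)) ^ (2 * n) = (((1 - q) * x)\<^sup>2) ^ n"
  proof -
    have "d ^ n * d ^ n * (x / (1 + q)) ^ (2 * n) = (d * (x / (1 + q))) ^ (2 * n)"
      unfolding mult_2 power_add by (simp only: power_mult_distrib mult_ac)
    also have "d * (x / (1 + q)) = (1 - q) * x" unfolding dq using q by (simp add: field_simps)
    finally show ?thesis by (simp add: power_mult)
  qed
  also have "(- 1) ^ n * q ^ (n * (n + 1)) / P = eul n * (q\<^sup>2) ^ n"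
    using eul_closed[of n, folded P_def] P0 by (simp add: field_simps)
  finally show ?thesis by (simp add: power_mult_distrib mult_ac)
qed

lemma q_bessel_lattice:
  assumes "- 1 < \<beta>" "\<bar>x\<bar> = q powi j"
  defines "v \<equiv> q powr (2 * \<beta> + 2)"
  shows "q_bessel q \<beta> x = h v (j + K) / E v"
proof -
  have "q\<^sup>2 * ((1 - q) * x)\<^sup>2 = q\<^sup>2 * ((q powi K)\<^sup>2 * (q powi j)\<^sup>2)"
    using assms(2) K by (simp add: power_mult_distrib flip: power2_abs[of x])
  also have "\<dots> = q\<^sup>2 powi (j + K + 1)"
    using q by (simp add: power_int_add flip: Q_powi)
  finally have "q\<^sup>2 * ((1 - q) * x)\<^sup>2 = q\<^sup>2 powi (j + K + 1)" .
  then show ?thesis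
    unfolding q_bessel_def q_bessel_term[OF assms(1)] h_def G_def v_def
    by (subst suminf_divide[OF summable_G']) simp
qed

text \<open>The q-number (1 - w) / (1 - q) does two things: 1 - w turns
  \<open>E (q\<^sup>2 * w)\<close> into \<open>E w\<close>, so that both parts share a denominator,
  and 1 - q turns q^j into q^(j+K). The sign of the product of the arguments is \<sigma>.\<close>

lemma dunkl_kernel_lattice:
  assumes "\<bar>\<sigma>\<bar> = 1" "l * x = \<sigma> * q powi j"
  shows "dunkl_kernel q \<alpha> l x
    = (complex_of_real (h w (j + K)) + \<i> * of_real (\<sigma> * (q powi (j + K) * h (q\<^sup>2 * w) (j + K)))) / of_real (E w)"
proof -
  have ab: "\<bar>l * x\<bar> = q powi j" using assms q by (simp add: abs_mult)
  have E1: "E w = (1 - w) * E (q\<^sup>2 * w)" using E_step[of w] by (simp add: mult.commute)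
  have pos: "0 < E (q\<^sup>2 * w)" "0 < 1 - w" "0 < 1 - q"
    using w(2) q Qw(2)[OF w] E_pos[of "q\<^sup>2 * w"] by simp_all
  have "q_number q (2 * \<alpha> + 2) = (1 - w) / (1 - q)" by (simp add: q_number_def w_eq)
  then have "l * x / q_number q (2 * \<alpha> + 2) * q_bessel q (\<alpha> + 1) (l * x)
      = \<sigma> * q powi j / ((1 - w) / (1 - q)) * (h (q\<^sup>2 * w) (j + K) / E (q\<^sup>2 * w))"
    using q_bessel_lattice[OF _ ab, of "\<alpha> + 1"] \<alpha> unfolding assms(2) Qw_eq(1) by simp
  also have "\<dots> = \<sigma> * (((1 - q) * q powi j) * h (q\<^sup>2 * w) (j + K)) / E w"
    unfolding E1 using pos by (simp add: field_simps)
  also have "(1 - q) * q powi j = q powi (j + K)" unfolding K using q by (simp add: power_int_add)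
  finally have 2: "l * x / q_number q (2 * \<alpha> + 2) * q_bessel q (\<alpha> + 1) (l * x)
      = \<sigma> * (q powi (j + K) * h (q\<^sup>2 * w) (j + K)) / E w" .
  have 1: "q_bessel q \<alpha> (l * x) = h w (j + K) / E w"
    unfolding w_eq by (rule q_bessel_lattice[OF \<alpha> ab])
  have "dunkl_kernel q \<alpha> l x = complex_of_real (q_bessel q \<alpha> (l * x))
      + \<i> * complex_of_real (l * x / q_number q (2 * \<alpha> + 2) * q_bessel q (\<alpha> + 1) (l * x))"
    by (simp add: dunkl_kernel_def)
  then show ?thesis unfolding 1 2 by (simp add: add_divide_distrib)
qed

text \<open>For t = q^(nu+1) the entry is q^j J_nu(q^j; q^2) with j = n + m + K.\<close>

definition Mat :: "real \<Rightarrow> int \<Rightarrow> int \<Rightarrow> real" where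
  "Mat t m n = t powi (n + m + K) * h (t\<^sup>2) (n + m + K) / E (q\<^sup>2)"

lemma E_Q_pos: "0 < E (q\<^sup>2)" by (rule E_pos[OF Q_less_1])

text \<open>The power of t splits: t^(2n) is the weight required by \<open>h_orthogonal\<close>, and
  the rest cancels the row norm found there.\<close>

lemma symmetric_orthogonal_Mat:
  assumes t: "0 < t" "t < 1"
  shows "symmetric_orthogonal (Mat t)"
proof
  show "Mat t m n = Mat t n m" for m n by (simp add: Mat_def add.commute)
  fix m l
  have t2: "0 < t\<^sup>2" "t\<^sup>2 < 1" using t by (auto simp: power_less_one_iff)
  define c where "c = t powi (m + K) * t powi (l + K) / (E (q\<^sup>2) * E (q\<^sup>2))"
  have "((\<lambda>n. c * ((t\<^sup>2) powi n * (h (t\<^sup>2) (n + (m + K)) * h (t\<^sup>2) (n + (l + K))))) has_sum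
      c * (if m + K = l + K then E (q\<^sup>2) * E (q\<^sup>2) * (t\<^sup>2) powi (- (m + K)) else 0)) UNIV"
    by (intro has_sum_cmult_right h_orthogonal t2)
  moreover have "c * ((t\<^sup>2) powi n * (h (t\<^sup>2) (n + (m + K)) * h (t\<^sup>2) (n + (l + K)))) = Mat t m n * Mat t l n" for n
  proof -
    have "t powi (n + (i + K)) = t powi n * t powi (i + K)" for i using t by (intro power_int_add) auto
    then show ?thesis
      by (simp add: Mat_def c_def add.assoc power2_eq_square power_int_mult_distrib)
  qed
  moreover have "c * (if m + K = l + K then E (q\<^sup>2) * E (q\<^sup>2) * (t\<^sup>2) powi (- (m + K)) else 0) = (if m = l then 1 else 0)"
  proof -
    have "t powi i * t powi i * (t\<^sup>2) powi (- i) = 1" for i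
      using t by (simp add: power2_eq_square power_int_mult_distrib power_int_minus field_simps)
    from this[of "m + K"] show ?thesis using E_Q_pos by (auto simp: c_def mult_ac)
  qed
  ultimately show "((\<lambda>k. Mat t m k * Mat t l k) has_sum (if m = l then 1 else 0)) UNIV" by simp
qed

sublocale even: symmetric_orthogonal "Mat s" by (rule symmetric_orthogonal_Mat[OF s])
sublocale odd: symmetric_orthogonal "Mat (q * s)" by (rule symmetric_orthogonal_Mat[OF qs])

section \<open>Coordinates of a lattice function: even and odd part\<close>

definition es :: "(real \<Rightarrow> complex) \<Rightarrow> int \<Rightarrow> complex" where
  "es f n = (f (q powi n) + f (- (q powi n))) / 2"

definition os :: "(real \<Rightarrow> complex) \<Rightarrow> int \<Rightarrow> complex" where
  "os f n = (f (q powi n) - f (- (q powi n))) / 2"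

text \<open>The factor is the square root of the measure weight, see \<open>weight_eq\<close>, so
  that L^2 turns into plain square-summability.\<close>

definition ev :: "(real \<Rightarrow> complex) \<Rightarrow> int \<Rightarrow> complex" where
  "ev f n = of_real (s powi n) * es f n"

definition od :: "(real \<Rightarrow> complex) \<Rightarrow> int \<Rightarrow> complex" where
  "od f n = of_real (s powi n) * os f n"

lemma value_eq:
  assumes "\<bar>\<sigma>\<bar> = 1"
  shows "f (\<sigma> * q powi n) = es f n + of_real \<sigma> * os f n"
    "of_real (s powi n) * f (\<sigma> * q powi n) = ev f n + of_real \<sigma> * od f n"
proof -
  have "\<sigma> = 1 \<or> \<sigma> = - 1" using assms by linarith
  then show 1: "f (\<sigma> * q powi n) = es f n + of_real \<sigma> * os f n"
    by (auto simp: es_def os_def field_simps)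
  show "of_real (s powi n) * f (\<sigma> * q powi n) = ev f n + of_real \<sigma> * od f n"
    unfolding 1 by (simp add: ev_def od_def algebra_simps)
qed

lemma in_lattice: "\<bar>\<sigma>\<bar> = 1 \<Longrightarrow> \<sigma> * q powi n \<in> q_lattice q"
  unfolding q_lattice_def by (cases "\<sigma> = 1") (auto intro!: exI[of _ n] simp: abs_if split: if_splits)

lemma lattice_cases:
  assumes "x \<in> q_lattice q"
  obtains \<sigma> n where "\<bar>\<sigma>\<bar> = 1" "x = \<sigma> * q powi n"
proof -
  obtain n where "x = q powi n \<or> x = - (q powi n)" using assms unfolding q_lattice_def by blast
  then show ?thesis using that[of 1 n] that[of "- 1" n] by auto
qed

lemma uminus_lattice: "- x \<in> q_lattice q \<longleftrightarrow> x \<in> q_lattice q"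
  unfolding q_lattice_def by (simp add: minus_equation_iff[of x] eq_commute[of _ x] disj_commute)

lemma weight_eq: "q powi n * (q powi n) powr (2 * \<alpha> + 1) = s powi n * s powi n"
proof -
  have "q powi n * (q powi n) powr (2 * \<alpha> + 1) = (q powi n) powr (2 * \<alpha> + 2)"
    using q by (simp add: powr_mult_base add.commute)
  also have "\<dots> = (q powi n) powr (\<alpha> + 1) * (q powi n) powr (\<alpha> + 1)"
    by (simp flip: powr_add)
  also have "(q powi n) powr (\<alpha> + 1) = s powi n"
    using q by (simp add: s_def powr_powr powr_real_of_int' mult.commute flip: powr_real_of_int')
  finally show ?thesis .
qed

text \<open>What remains when the integrand is rewritten with \<open>Mat\<close>: its denominator
  \<open>E (q\<^sup>2)\<close> against the \<open>E w\<close> of the kernel, and s^K from the index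
  shift.\<close>

definition \<kappa> :: real where "\<kappa> = E (q\<^sup>2) / (E w * s powi K)"

lemma E_w_pos: "0 < E w" by (rule E_pos[OF w(2)])

text \<open>This is how \<open>c_const\<close> normalises the transform to be unitary; the remaining
  1/2 is made up for by the two points q^n and -q^n.\<close>

lemma \<kappa>_eq: "c_const q \<alpha> / 2 * (1 - q) * \<kappa> = 1 / 2"
proof -
  have d: "1 - q\<^sup>2 = (1 - q) * (1 + q)" by (simp add: algebra_simps power2_eq_square)
  have G: "Gamma_q2 q (\<alpha> + 1) = E (q\<^sup>2) / E w * ((1 - q) powr (- \<alpha>) * (1 + q) powr (- \<alpha>))"
    using q \<alpha> unfolding d[symmetric] powr_mult[symmetric]
    by (subst Gamma_q2_eq) (simp_all add: w_eq d powr_mult distrib_left)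
  have "s powi K = (1 - q) powr (\<alpha> + 1)"
    unfolding K s_def using q by (simp add: powr_powr mult.commute flip: powr_real_of_int')
  also have "\<dots> = (1 - q) / (1 - q) powr (- \<alpha>)"
    using q by (simp add: powr_add powr_minus field_simps)
  finally have S: "s powi K = (1 - q) / (1 - q) powr (- \<alpha>)" .
  have "R / (e / f * (P * R)) / 2 * d * (e / (f * (d / P))) = 1 / 2"
    if "0 < R" "0 < P" "0 < d" "0 < e" "0 < f" for R P d e f :: real
    using that by (simp add: field_simps)
  then show ?thesis
    unfolding c_const_def G \<kappa>_def S using q E_Q_pos E_w_pos by simp
qed

lemma integrand_eq:
  fixes n m :: int and \<sigma> \<tau> :: real
  assumes "\<bar>\<sigma>\<bar> = 1" "\<bar>\<tau>\<bar> = 1"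
  defines "x \<equiv> \<sigma> * q powi n" and "l \<equiv> \<tau> * q powi m"
  shows "of_real (q powi n) * (f x * dunkl_kernel q \<alpha> l x * complex_of_real (\<bar>x\<bar> powr (2 * \<alpha> + 1)))
    = of_real (\<kappa> * s powi (- m)) * ((of_real (s powi n) * f x)
        * (of_real (Mat s m n) + \<i> * of_real (\<tau> * \<sigma>) * of_real (Mat (q * s) m n)))"
proof -
  have x: "\<bar>x\<bar> = q powi n" using assms q by (simp add: x_def abs_mult)
  have lx: "l * x = (\<tau> * \<sigma>) * q powi (n + m)"
    using q by (simp add: x_def l_def power_int_add mult_ac)
  have ts: "\<bar>\<tau> * \<sigma>\<bar> = 1" using assms by (simp add: abs_mult)
  define j where "j = n + m + K"
  have sj: "s powi j = s powi n * s powi m * s powi K" using s by (simp add: j_def power_int_add)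
  have e1: "Mat s m n = s powi j * h w j / E (q\<^sup>2)"
    and e2: "Mat (q * s) m n = s powi j * (q powi j * h (q\<^sup>2 * w) j) / E (q\<^sup>2)"
    unfolding Mat_def j_def[symmetric] by (simp_all add: power_int_mult_distrib power_mult_distrib)
  define z where "z = complex_of_real (h w j) + \<i> * of_real (\<tau> * \<sigma> * (q powi j * h (q\<^sup>2 * w) j))"
  have ker: "dunkl_kernel q \<alpha> l x = z / of_real (E w)"
    unfolding z_def j_def by (rule dunkl_kernel_lattice[OF ts lx])
  have M: "of_real (Mat s m n) + \<i> * of_real (\<tau> * \<sigma>) * of_real (Mat (q * s) m n) = of_real (s powi j / E (q\<^sup>2)) * z"
    unfolding e1 e2 z_def by (simp add: algebra_simps add_divide_distrib)
  have "of_real (q powi n) * (f x * dunkl_kernel q \<alpha> l x * complex_of_real (\<bar>x\<bar> powr (2 * \<alpha> + 1)))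
    = of_real (q powi n * (q powi n) powr (2 * \<alpha> + 1)) * f x * z / of_real (E w)"
    unfolding x ker by simp
  also have "\<dots> = of_real (s powi n * s powi n / E w) * f x * z" unfolding weight_eq by simp
  also have "s powi n * s powi n / E w = \<kappa> * s powi (- m) * s powi n * (s powi j / E (q\<^sup>2))"
    unfolding sj \<kappa>_def using s E_Q_pos E_w_pos by (simp add: power_int_minus field_simps)
  finally show ?thesis unfolding M by (simp add: mult_ac)
qed

text \<open>Adding the contributions of q^n and -q^n removes the mixed products, so each part meets
  only its own matrix. Absolute convergence comes from pairing two square-summable sequences, hence
  holds on all of L^2.\<close>

lemma kernel_integral:
  fixes m :: int and \<tau> :: real
  assumes f: "l2 (ev f)" "l2 (od f)" and \<tau>: "\<bar>\<tau>\<bar> = 1"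
  defines "l \<equiv> \<tau> * q powi m"
  defines "g \<equiv> \<lambda>x. f x * dunkl_kernel q \<alpha> l x * complex_of_real (\<bar>x\<bar> powr (2 * \<alpha> + 1))"
  shows "jackson_integrable q g"
    "of_real (c_const q \<alpha> / 2) * jackson_integral q g = of_real (s powi (- m)) *
      (mat_app (Mat s) (ev f) m + \<i> * of_real \<tau> * mat_app (Mat (q * s)) (od f) m)"
proof -
  define R where "R \<sigma> n = complex_of_real (Mat s m n) + \<i> * of_real (\<tau> * \<sigma>) * of_real (Mat (q * s) m n)" for \<sigma> n
  have R: "l2 (R \<sigma>)" for \<sigma>
    unfolding R_def[abs_def] by (intro l2_add l2_cmult even.l2_row odd.l2_row)
  define F where "F \<sigma> n = ev f n + of_real \<sigma> * od f n" for \<sigma> :: real and n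
  have F: "l2 (F \<sigma>)" for \<sigma> unfolding F_def[abs_def] by (intro l2_add l2_cmult f)
  define C where "C = complex_of_real (\<kappa> * s powi (- m))"
  have g: "of_real (q powi n) * g (\<sigma> * q powi n) = C * (F \<sigma> n * R \<sigma> n)" if "\<bar>\<sigma>\<bar> = 1" for \<sigma> n
    unfolding g_def l_def integrand_eq[OF that \<tau>] value_eq(2)[OF that] C_def F_def R_def ..
  have gn: "q powi n * norm (g (\<sigma> * q powi n)) = norm (C * (F \<sigma> n * R \<sigma> n))" if "\<bar>\<sigma>\<bar> = 1" for \<sigma> n
    unfolding g[OF that, symmetric] using q by (simp add: norm_mult norm_power_int)
  have sF: "(\<lambda>n. norm (C * (F \<sigma> n * R \<sigma> n))) summable_on UNIV" for \<sigma>
    using summable_on_cmult_right[OF l2_product_summable[OF F R], of "norm C"] by (simp add: norm_mult)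
  have "(\<lambda>n. norm (C * (F 1 n * R 1 n)) + norm (C * (F (- 1) n * R (- 1) n))) summable_on UNIV"
    by (intro summable_on_add sF)
  then show "jackson_integrable q g"
    unfolding jackson_integrable_def using gn[of 1] gn[of "- 1"] by (simp add: distrib_left)
  have sum: "q powi n *\<^sub>R (g (q powi n) + g (- (q powi n)))
      = 2 * C * (of_real (Mat s m n) * ev f n + \<i> * of_real \<tau> * (of_real (Mat (q * s) m n) * od f n))" for n
  proof -
    have "q powi n *\<^sub>R (g (q powi n) + g (- (q powi n)))
      = of_real (q powi n) * g (1 * q powi n) + of_real (q powi n) * g (- 1 * q powi n)"
      by (simp add: scaleR_conv_of_real distrib_left)
    also have "\<dots> = C * (F 1 n * R 1 n) + C * (F (- 1) n * R (- 1) n)"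
      using g[of 1 n] g[of "- 1" n] by simp
    also have "\<dots> = 2 * C * (of_real (Mat s m n) * ev f n + \<i> * of_real \<tau> * (of_real (Mat (q * s) m n) * od f n))"
      by (simp add: F_def R_def algebra_simps)
    finally show ?thesis .
  qed
  have "((\<lambda>n. q powi n *\<^sub>R (g (q powi n) + g (- (q powi n)))) has_sum
      2 * C * (mat_app (Mat s) (ev f) m + \<i> * of_real \<tau> * mat_app (Mat (q * s)) (od f) m)) UNIV"
    unfolding sum by (intro has_sum_cmult_right has_sum_add even.has_sum_mat_app odd.has_sum_mat_app f)
  then have "jackson_integral q g = of_real (1 - q) *
      (2 * C * (mat_app (Mat s) (ev f) m + \<i> * of_real \<tau> * mat_app (Mat (q * s)) (od f) m))"
    unfolding jackson_integral_def by (simp add: infsumI scaleR_conv_of_real)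
  moreover have "of_real (c_const q \<alpha> / 2) * (of_real (1 - q) * (2 * C)) = complex_of_real (s powi (- m))"
  proof -
    have "of_real (c_const q \<alpha> / 2) * (of_real (1 - q) * (2 * C))
      = complex_of_real (2 * (c_const q \<alpha> / 2 * (1 - q) * \<kappa>) * s powi (- m))"
      unfolding C_def by (simp add: mult_ac)
    then show ?thesis unfolding \<kappa>_eq by simp
  qed
  ultimately show "of_real (c_const q \<alpha> / 2) * jackson_integral q g = of_real (s powi (- m)) *
      (mat_app (Mat s) (ev f) m + \<i> * of_real \<tau> * mat_app (Mat (q * s)) (od f) m)"
    by (simp only: mult.assoc[symmetric])
qed

lemma q_dunkl_value:
  assumes f: "l2 (ev f)" "l2 (od f)" and \<tau>: "\<bar>\<tau>\<bar> = 1"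
  shows "q_dunkl q \<alpha> f (\<tau> * q powi m) = of_real (s powi (- m)) *
      (mat_app (Mat s) (ev f) m - \<i> * of_real \<tau> * mat_app (Mat (q * s)) (od f) m)"
  using kernel_integral(2)[OF f, of "- \<tau>" m] \<tau> in_lattice[OF \<tau>, of m] by (simp add: q_dunkl_def)

lemma lattice_fun_q_dunkl: "lattice_fun q (q_dunkl q \<alpha> f)"
  by (simp add: lattice_fun_def q_dunkl_def)

lemma ev_od_q_dunkl:
  assumes f: "l2 (ev f)" "l2 (od f)"
  shows "ev (q_dunkl q \<alpha> f) = mat_app (Mat s) (ev f)"
    "od (q_dunkl q \<alpha> f) = (\<lambda>m. - \<i> * mat_app (Mat (q * s)) (od f) m)"
proof -
  have "s powi m * s powi (- m) = 1" for m using s by (simp add: power_int_minus)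
  then have sm: "complex_of_real (s powi m) * complex_of_real (s powi (- m)) = 1" for m
    by (metis of_real_1 of_real_mult)
  note v = q_dunkl_value[OF f, of 1, simplified] q_dunkl_value[OF f, of "- 1", simplified]
  show "ev (q_dunkl q \<alpha> f) = mat_app (Mat s) (ev f)"
  proof
    fix m
    have "es (q_dunkl q \<alpha> f) m = of_real (s powi (- m)) * mat_app (Mat s) (ev f) m"
      unfolding es_def v by (simp add: algebra_simps)
    then show "ev (q_dunkl q \<alpha> f) m = mat_app (Mat s) (ev f) m"
      unfolding ev_def using sm[of m] by (simp only: mult.assoc[symmetric] mult_1)
  qed
  show "od (q_dunkl q \<alpha> f) = (\<lambda>m. - \<i> * mat_app (Mat (q * s)) (od f) m)"
  proof
    fix m
    have "os (q_dunkl q \<alpha> f) m = of_real (s powi (- m)) * (- \<i> * mat_app (Mat (q * s)) (od f) m)"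
      unfolding os_def v by (simp add: algebra_simps)
    then show "od (q_dunkl q \<alpha> f) m = - \<i> * mat_app (Mat (q * s)) (od f) m"
      unfolding od_def using sm[of m] by (simp only: mult.assoc[symmetric] mult_1)
  qed
qed

lemma lattice_fun_eqI:
  assumes "lattice_fun q f" "lattice_fun q g" "ev f = ev g" "od f = od g"
  shows "f = g"
proof
  fix x
  show "f x = g x"
  proof (cases "x \<in> q_lattice q")
    case True
    then obtain \<sigma> n where x: "\<bar>\<sigma>\<bar> = 1" "x = \<sigma> * q powi n" by (rule lattice_cases)
    have "of_real (s powi n) * f x = of_real (s powi n) * g x"
      unfolding x(2) value_eq(2)[OF x(1)] assms(3,4) ..
    then show ?thesis using s by simp
  qed (use assms(1,2) in \<open>simp add: lattice_fun_def\<close>)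
qed

lemma ev_od_reflect: "ev (\<lambda>x. f (- x)) = ev f" "od (\<lambda>x. f (- x)) = (\<lambda>n. - 1 * od f n)"
  by (auto simp: ev_def od_def es_def os_def algebra_simps diff_divide_distrib)

text \<open>Both matrices are involutions; the odd part picks up (-i)^2 = -1, which is the
  reflection.\<close>

lemma q_dunkl_q_dunkl:
  assumes "lattice_fun q f" "l2 (ev f)" "l2 (od f)"
  shows "q_dunkl q \<alpha> (q_dunkl q \<alpha> f) = (\<lambda>x. f (- x))"
proof (rule lattice_fun_eqI)
  note e = ev_od_q_dunkl[OF assms(2,3)]
  have l: "l2 (ev (q_dunkl q \<alpha> f))" "l2 (od (q_dunkl q \<alpha> f))"
    unfolding e by (intro l2_cmult even.mat_app_l2 odd.mat_app_l2 assms)+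
  show "ev (q_dunkl q \<alpha> (q_dunkl q \<alpha> f)) = ev (\<lambda>x. f (- x))"
    unfolding ev_od_q_dunkl[OF l] ev_od_reflect e using even.mat_app_involution[OF assms(2)] by auto
  show "od (q_dunkl q \<alpha> (q_dunkl q \<alpha> f)) = od (\<lambda>x. f (- x))"
  proof
    fix m
    have "mat_app (Mat (q * s)) (\<lambda>m. - \<i> * mat_app (Mat (q * s)) (od f) m) m = - \<i> * od f m"
      unfolding mat_app_cmult odd.mat_app_involution[OF assms(3)] ..
    then show "od (q_dunkl q \<alpha> (q_dunkl q \<alpha> f)) m = od (\<lambda>x. f (- x)) m"
      unfolding ev_od_q_dunkl[OF l] ev_od_reflect e by simp
  qed
  show "lattice_fun q (\<lambda>x. f (- x))" using assms(1) by (simp add: lattice_fun_def uminus_lattice)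
qed (rule lattice_fun_q_dunkl)

section \<open>The L^2 norm in even and odd coordinates\<close>

lemma parallelogram:
  "(norm (f (q powi n)))\<^sup>2 + (norm (f (- (q powi n))))\<^sup>2 = 2 * ((norm (es f n))\<^sup>2 + (norm (os f n))\<^sup>2)"
proof -
  have "(norm (a + b))\<^sup>2 + (norm (a - b))\<^sup>2 = 2 * ((norm a)\<^sup>2 + (norm b)\<^sup>2)" for a b :: complex
    unfolding cmod_power2 by (simp add: power2_eq_square algebra_simps)
  from this[of "es f n" "os f n"] show ?thesis
    using value_eq(1)[of 1 f n] value_eq(1)[of "- 1" f n] by simp
qed

lemma L2_weight_eq:
  "q powi n * (norm (f (q powi n)) powr 2 * \<bar>q powi n\<bar> powr (2 * \<alpha> + 1)
    + norm (f (- (q powi n))) powr 2 * \<bar>- (q powi n)\<bar> powr (2 * \<alpha> + 1))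
    = 2 * ((norm (ev f n))\<^sup>2 + (norm (od f n))\<^sup>2)"
proof -
  have p2: "norm z powr 2 = (norm z)\<^sup>2" for z :: complex
    by (cases "z = 0") (simp_all add: powr_numeral)
  have "q powi n * (norm (f (q powi n)) powr 2 * \<bar>q powi n\<bar> powr (2 * \<alpha> + 1)
    + norm (f (- (q powi n))) powr 2 * \<bar>- (q powi n)\<bar> powr (2 * \<alpha> + 1))
    = (q powi n * (q powi n) powr (2 * \<alpha> + 1)) * ((norm (f (q powi n)))\<^sup>2 + (norm (f (- (q powi n))))\<^sup>2)"
    using q by (simp add: p2 algebra_simps)
  also have "\<dots> = 2 * ((norm (ev f n))\<^sup>2 + (norm (od f n))\<^sup>2)"
    unfolding weight_eq parallelogram ev_def od_def using s
    by (simp add: norm_mult power_mult_distrib norm_power_int algebra_simps power2_eq_square)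
  finally show ?thesis .
qed

lemma Lq_2_iff: "f \<in> Lq 2 \<alpha> q \<longleftrightarrow> lattice_fun q f \<and> l2 (ev f) \<and> l2 (od f)"
proof -
  have "jackson_integrable q (\<lambda>x. norm (f x) powr 2 * \<bar>x\<bar> powr (2 * \<alpha> + 1))
    \<longleftrightarrow> (\<lambda>n. 2 * ((norm (ev f n))\<^sup>2 + (norm (od f n))\<^sup>2)) summable_on UNIV"
    unfolding jackson_integrable_def L2_weight_eq[symmetric] by simp
  also have "\<dots> \<longleftrightarrow> l2 (ev f) \<and> l2 (od f)"
  proof
    assume s: "(\<lambda>n. 2 * ((norm (ev f n))\<^sup>2 + (norm (od f n))\<^sup>2)) summable_on UNIV"
    show "l2 (ev f) \<and> l2 (od f)" unfolding l2_def
      by (intro conjI; rule summable_on_comparison_test[OF s]) auto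
  next
    assume "l2 (ev f) \<and> l2 (od f)"
    then show "(\<lambda>n. 2 * ((norm (ev f n))\<^sup>2 + (norm (od f n))\<^sup>2)) summable_on UNIV"
      unfolding l2_def by (intro summable_on_cmult_right summable_on_add) auto
  qed
  finally show ?thesis by (simp add: Lq_def)
qed

lemma Lq_norm_2_eq:
  assumes "f \<in> Lq 2 \<alpha> q"
  shows "Lq_norm 2 \<alpha> q f = sqrt (2 * (1 - q) * (l2_norm2 (ev f) + l2_norm2 (od f)))"
proof -
  have l: "l2 (ev f)" "l2 (od f)" using assms by (auto simp: Lq_2_iff)
  have "jackson_integral q (\<lambda>x. norm (f x) powr 2 * \<bar>x\<bar> powr (2 * \<alpha> + 1))
    = (1 - q) * (\<Sum>\<^sub>\<infinity>n. 2 * ((norm (ev f n))\<^sup>2 + (norm (od f n))\<^sup>2))"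
    unfolding jackson_integral_def L2_weight_eq[symmetric] by simp
  also have "(\<Sum>\<^sub>\<infinity>n. 2 * ((norm (ev f n))\<^sup>2 + (norm (od f n))\<^sup>2)) = 2 * (l2_norm2 (ev f) + l2_norm2 (od f))"
    using l unfolding l2_def l2_norm2_def by (subst infsum_cmult_right', subst infsum_add) auto
  finally have "jackson_integral q (\<lambda>x. norm (f x) powr 2 * \<bar>x\<bar> powr (2 * \<alpha> + 1))
    = 2 * (1 - q) * (l2_norm2 (ev f) + l2_norm2 (od f))" by (simp add: algebra_simps)
  moreover have "0 \<le> 2 * (1 - q) * (l2_norm2 (ev f) + l2_norm2 (od f))"
    using q unfolding l2_norm2_def by (intro mult_nonneg_nonneg add_nonneg_nonneg infsum_nonneg) auto
  ultimately show ?thesis unfolding Lq_norm_def by (simp add: powr_half_sqrt)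
qed

end

section \<open>Schwartz functions\<close>

context q_base
begin

lemma schwartz_seq_finite_support:
  assumes "finite {n. a n \<noteq> 0}"
  shows "schwartz_seq a"
proof -
  define fin where "fin a \<longleftrightarrow> finite {n::int. a n \<noteq> (0::complex)}" for a
  \<comment> \<open>The free weight \<open>c\<close> lets one argument serve both boundedness, with
    \<open>c\<close> constant 1, and decay.\<close>
  have bound: "\<exists>B. \<forall>n. norm (a n) / c n \<le> B" if "fin a" and c: "\<And>n. 0 < c n" for a and c :: "int \<Rightarrow> real"
  proof (intro exI allI)
    fix n
    have f: "finite {n. a n \<noteq> 0}" using that by (simp add: fin_def)
    show "norm (a n) / c n \<le> (\<Sum>n\<in>{n. a n \<noteq> 0}. norm (a n) / c n)"
    proof (cases "a n = 0")
      case True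
      then show ?thesis using c by (auto intro!: sum_nonneg divide_nonneg_pos)
    next
      case False
      then show ?thesis using f c
        by (intro member_le_sum[where f = "\<lambda>n. norm (a n) / c n"]) (auto intro!: divide_nonneg_pos)
    qed
  qed
  have fin_DD: "fin (DD a)" if "fin a" for a
  proof -
    have "{n. DD a n \<noteq> 0} \<subseteq> {n. a n \<noteq> 0} \<union> (\<lambda>n. n + 1) ` {n. a n \<noteq> 0}"
    proof
      fix n assume "n \<in> {n. DD a n \<noteq> 0}"
      then have "a (n - 1) \<noteq> 0 \<or> a n \<noteq> 0" by (auto simp: DD_def)
      then show "n \<in> {n. a n \<noteq> 0} \<union> (\<lambda>n. n + 1) ` {n. a n \<noteq> 0}"
        by (auto intro!: image_eqI[of n _ "n - 1"])
    qed
    from finite_subset[OF this] show ?thesis using that by (simp add: fin_def)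
  qed
  have fin: "fin ((DD ^^ j) a)" for j
    using assms by (induction j) (auto simp: fin_DD, simp add: fin_def)
  have "bd ((DD ^^ j) a)" for j
    using bound[OF fin, of "\<lambda>_. 1" j] unfolding bd_def by auto
  moreover have "dec a" unfolding dec_def
  proof
    fix m
    obtain B where B: "\<And>n. norm (a n) / (Q ^ nat (- n)) ^ m \<le> B"
      using bound[of a "\<lambda>n. (Q ^ nat (- n)) ^ m"] fin[of 0] Q_pos by auto
    have "norm (a (- int k)) \<le> B * (Q ^ k) ^ m" for k
      using B[of "- int k"] Q_pos by (simp add: pos_divide_le_eq)
    then show "\<exists>B. \<forall>k. norm (a (- int k)) \<le> B * (Q ^ k) ^ m" by blast
  qed
  ultimately show ?thesis by (simp add: schwartz_seq_def)
qed

lemma l2_schwartz_seq: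
  assumes t: "0 < t" "t < 1" and a: "schwartz_seq a"
  shows "l2 (\<lambda>n. of_real (t powi n) * a n)"
proof -
  obtain B1 where B1: "\<And>k. norm (a (int k)) \<le> B1" using schwartz_seq_bd[OF a] by (auto simp: bd_def)
  obtain B2 where B2: "\<And>k. norm (a (- int k)) \<le> B2" using dec_bounded[OF schwartz_seq_dec[OF a]] by blast
  define B where "B = max B1 B2"
  have B: "norm (a n) \<le> B" for n
    using B1 B2 by (cases n rule: int_cases2) (auto simp: B_def le_max_iff_disj)
  have t2: "0 < t\<^sup>2" "t\<^sup>2 < 1" using t by (auto simp: power_less_one_iff)
  have s: "(\<lambda>n. B * norm (complex_of_real ((t\<^sup>2) powi n * 1) * a n)) summable_on UNIV"
    by (intro summable_on_cmult_right weighted_summable[where C = 1] schwartz_seq_dec schwartz_seq_bd a t2) simp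
  have le: "(norm (of_real (t powi n) * a n))\<^sup>2 \<le> B * norm (complex_of_real ((t\<^sup>2) powi n * 1) * a n)" for n
  proof -
    have "(t powi n)\<^sup>2 * norm (a n) * norm (a n) \<le> (t powi n)\<^sup>2 * norm (a n) * B"
      by (intro mult_left_mono B) auto
    then show ?thesis using t
      by (simp add: norm_mult power_mult_distrib power2_eq_square power_int_mult_distrib norm_power_int mult_ac)
  qed
  show ?thesis unfolding l2_def by (rule summable_on_comparison_test[OF s le]) auto
qed

end

section \<open>The q-derivative on even and odd parts\<close>

context dunkl_setting
begin

text \<open>An odd function divided by x is even, so both parts can be measured with the one class
  \<open>schwartz_seq\<close>.\<close>

definition gs :: "(real \<Rightarrow> complex) \<Rightarrow> int \<Rightarrow> complex" where
  "gs f n = os f n / of_real (q powi n)"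

lemma os_eq_gs: "os f n = of_real (q powi n) * gs f n"
  using q by (simp add: gs_def)

lemma ev_od_eq: "ev f = (\<lambda>n. of_real (s powi n) * es f n)" "od f = (\<lambda>n. of_real ((q * s) powi n) * gs f n)"
  by (auto simp: ev_def od_def os_eq_gs power_int_mult_distrib)

text \<open>The operator exchanges parity. After the reflected terms cancel it takes the difference
  between z / q and z on the even part, but between z and q z on the odd part; hence the different
  shapes of the two formulas.\<close>

lemma es_gs_q_deriv:
  "es (q_deriv q f) n = (gs f n - of_real q * gs f (n + 1)) / of_real (1 - q)"
  "gs (q_deriv q f) n = DD (es f) n / of_real (1 - q)"
proof -
  define a where "a = q powi n"
  have a: "a \<noteq> 0" using q by (simp add: a_def)
  have pm: "inverse q * a = q powi (n - 1)" "q * a = q powi (n + 1)"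
    using q by (simp_all add: a_def power_int_add power_int_diff field_simps)
  have v: "f (q powi i) = es f i + os f i" "f (- (q powi i)) = es f i - os f i" for i
    using value_eq(1)[of 1 f i] value_eq(1)[of "- 1" f i] by simp_all
  define c where "c = complex_of_real ((1 - q) * a)"
  have "q_deriv q f a = (2 * (es f (n - 1) - es f n + (os f n - os f (n + 1)))) / (2 * c)"
    unfolding q_deriv_def pm unfolding a_def v unfolding c_def a_def by (simp add: algebra_simps)
  then have 1: "q_deriv q f a = (es f (n - 1) - es f n + (os f n - os f (n + 1))) / c"
    by (subst (asm) mult_divide_mult_cancel_left) simp_all
  have "q_deriv q f (- a) = (- 2 * (- (es f (n - 1) - es f n) + (os f n - os f (n + 1)))) / (- 2 * c)"
    unfolding q_deriv_def mult_minus_right pm minus_minus unfolding a_def v unfolding c_def a_def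
    by (simp add: algebra_simps)
  then have 2: "q_deriv q f (- a) = (- (es f (n - 1) - es f n) + (os f n - os f (n + 1))) / c"
    by (subst (asm) mult_divide_mult_cancel_left) simp_all
  have avg: "((x + y) / c + (- x + y) / c) / 2 = y / c" "((x + y) / c - (- x + y) / c) / 2 = x / c" for x y
    by (simp_all add: add_divide_distrib diff_divide_distrib)
  have e: "es (q_deriv q f) n = (os f n - os f (n + 1)) / c"
    unfolding es_def[of "q_deriv q f"] a_def[symmetric] 1 2 by (rule avg)
  have o: "os (q_deriv q f) n = (es f (n - 1) - es f n) / c"
    unfolding os_def[of "q_deriv q f"] a_def[symmetric] 1 2 by (rule avg)
  have "os f n - os f (n + 1) = of_real a * (gs f n - of_real q * gs f (n + 1))"
    unfolding os_eq_gs pm(2)[symmetric] a_def[symmetric] by (simp add: algebra_simps)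
  then show "es (q_deriv q f) n = (gs f n - of_real q * gs f (n + 1)) / of_real (1 - q)"
    unfolding e c_def using a by simp
  show "gs (q_deriv q f) n = DD (es f) n / of_real (1 - q)"
    unfolding gs_def o c_def DD_def Q_powi a_def[symmetric] by (simp add: power2_eq_square mult_ac)
qed

definition schwartz_pair :: "(real \<Rightarrow> complex) \<Rightarrow> bool" where
  "schwartz_pair f \<longleftrightarrow> schwartz_seq (es f) \<and> schwartz_seq (gs f)"

text \<open>The conditions of \<open>q_schwartz\<close> for a single order of derivative, so that
  derivatives can be fed in by induction.\<close>

definition schwartz_at :: "(real \<Rightarrow> complex) \<Rightarrow> bool" where
  "schwartz_at f \<longleftrightarrow>
    (\<forall>m. bdd_above ((\<lambda>x. norm (complex_of_real (x ^ m) * f x)) ` q_lattice q)) \<and>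
    (\<exists>l. (f \<longlongrightarrow> l) (at 0 within q_lattice q))"

lemma q_schwartz_iff_at:
  "f \<in> q_schwartz q \<longleftrightarrow> lattice_fun q f \<and> (\<forall>n. schwartz_at ((q_deriv q ^^ n) f))"
  unfolding q_schwartz_def schwartz_at_def mem_Collect_eq all_conj_distrib ..

lemma schwartz_pair_q_deriv: assumes "schwartz_pair f" shows "schwartz_pair (q_deriv q f)"
proof -
  have "es (q_deriv q f) = (\<lambda>n. inverse (of_real (1 - q)) * gs f n + (- of_real q * inverse (of_real (1 - q))) * gs f (n + 1))"
    unfolding es_gs_q_deriv by (auto simp: divide_inverse algebra_simps)
  moreover have "gs (q_deriv q f) = (\<lambda>n. inverse (of_real (1 - q)) * DD (es f) n)"
    unfolding es_gs_q_deriv by (auto simp: divide_inverse)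
  ultimately show ?thesis using assms unfolding schwartz_pair_def
    by (simp only: schwartz_seq_add schwartz_seq_cmult schwartz_seq_cmult_shift[of _ _ 1] schwartz_seq_DD)
qed

lemma powi_null: "(\<lambda>k. q powi (int k)) \<longlonglongrightarrow> 0"
  using q by (simp add: LIMSEQ_power_zero)

lemma tendsto_lattice_iff:
  fixes f :: "real \<Rightarrow> complex"
  shows "(f \<longlongrightarrow> l) (at 0 within q_lattice q) \<longleftrightarrow>
    (\<forall>\<sigma>. \<bar>\<sigma>\<bar> = 1 \<longrightarrow> (\<lambda>k. f (\<sigma> * q powi int k)) \<longlonglongrightarrow> l)"
proof (intro iffI allI impI)
  fix \<sigma> :: real assume f: "(f \<longlongrightarrow> l) (at 0 within q_lattice q)" and \<sigma>: "\<bar>\<sigma>\<bar> = 1"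
  have "filterlim (\<lambda>k. \<sigma> * q powi int k) (at 0 within q_lattice q) sequentially"
    unfolding filterlim_at
  proof
    show "\<forall>\<^sub>F k in sequentially. \<sigma> * q powi int k \<in> q_lattice q \<and> \<sigma> * q powi int k \<noteq> 0"
      using \<sigma> q by (intro always_eventually allI conjI in_lattice) auto
    show "(\<lambda>k. \<sigma> * q powi int k) \<longlonglongrightarrow> 0" by (intro tendsto_mult_right_zero powi_null)
  qed
  then show "(\<lambda>k. f (\<sigma> * q powi int k)) \<longlonglongrightarrow> l" by (rule filterlim_compose[OF f])
next
  assume lim: "\<forall>\<sigma>. \<bar>\<sigma>\<bar> = 1 \<longrightarrow> (\<lambda>k. f (\<sigma> * q powi int k)) \<longlonglongrightarrow> l"
  show "(f \<longlongrightarrow> l) (at 0 within q_lattice q)"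
  proof (rule tendstoI)
    fix e :: real assume e: "0 < e"
    have "\<forall>\<^sub>F k in sequentially. dist (f (1 * q powi int k)) l < e \<and> dist (f (- 1 * q powi int k)) l < e"
      by (intro eventually_conj tendstoD[OF lim[rule_format] e]) simp_all
    then obtain N where N: "\<And>k. k \<ge> N \<Longrightarrow> dist (f (1 * q powi int k)) l < e \<and> dist (f (- 1 * q powi int k)) l < e"
      by (auto simp: eventually_sequentially)
    show "\<forall>\<^sub>F x in at 0 within q_lattice q. dist (f x) l < e"
      unfolding eventually_at
    proof (intro exI[of _ "q powi int N"] conjI ballI impI)
      fix x assume x: "x \<in> q_lattice q" "x \<noteq> 0 \<and> dist x 0 < q powi int N"
      then obtain \<sigma> n where sn: "\<bar>\<sigma>\<bar> = 1" "x = \<sigma> * q powi n" using lattice_cases by blast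
      have "q powi n < q powi int N" using x sn q by (simp add: abs_mult)
      then have n: "int N < n" using q power_int_decreasing[of n "int N" q] by (cases "n \<le> int N") auto
      have "\<sigma> = 1 \<or> \<sigma> = - 1" using sn by linarith
      then show "dist (f x) l < e" using N[of "nat n"] n sn by auto
    qed (use q in simp)
  qed
qed

lemma schwartz_at_pair:
  assumes "schwartz_pair f"
  shows "schwartz_at f"
  unfolding schwartz_at_def
proof (intro conjI allI)
  have e: "schwartz_seq (es f)" and g: "schwartz_seq (gs f)" using assms by (auto simp: schwartz_pair_def)
  obtain B3 where B3: "\<And>k. norm (es f (int k)) \<le> B3" using schwartz_seq_bd[OF e] by (auto simp: bd_def)
  obtain B4 where B4: "\<And>k. norm (gs f (int k)) \<le> B4" using schwartz_seq_bd[OF g] by (auto simp: bd_def)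
  {
    fix m :: nat
    \<comment> \<open>With y = q^k the exponent m + 1 yields y^(2m+2), enough against x^m and the
      extra factor x in front of \<open>gs f\<close>.\<close>
    obtain B1 where B1: "\<And>k. norm (es f (- int k)) \<le> B1 * ((q\<^sup>2) ^ k) ^ (m + 1)"
      using schwartz_seq_dec[OF e] unfolding dec_def by blast
    obtain B2 where B2: "\<And>k. norm (gs f (- int k)) \<le> B2 * ((q\<^sup>2) ^ k) ^ (m + 1)"
      using schwartz_seq_dec[OF g] unfolding dec_def by blast
    have B0: "0 \<le> B1" "0 \<le> B2" "0 \<le> B3" "0 \<le> B4"
      using order_trans[OF norm_ge_zero B1[of 0]] order_trans[OF norm_ge_zero B2[of 0]]
        order_trans[OF norm_ge_zero B3[of 0]] order_trans[OF norm_ge_zero B4[of 0]] by simp_all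
    have "norm (complex_of_real (x ^ m) * f x) \<le> B1 + B2 + (B3 + B4)" if xl: "x \<in> q_lattice q" for x
    proof -
      obtain \<sigma> n where x: "\<bar>\<sigma>\<bar> = 1" "x = \<sigma> * q powi n" by (rule lattice_cases[OF xl])
      have "norm (f x) \<le> norm (es f n) + norm (complex_of_real \<sigma> * os f n)"
        unfolding x(2) value_eq(1)[OF x(1)] by (rule norm_triangle_ineq)
      also have "norm (complex_of_real \<sigma> * os f n) = q powi n * norm (gs f n)"
        unfolding os_eq_gs using x q by (simp add: norm_mult norm_power_int)
      finally have fx: "norm (f x) \<le> norm (es f n) + q powi n * norm (gs f n)" .
      have "norm (complex_of_real (x ^ m) * f x) = (q powi n) ^ m * norm (f x)"
        using x q by (simp add: norm_mult norm_power norm_power_int abs_mult)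
      also have "\<dots> \<le> (q powi n) ^ m * (norm (es f n) + q powi n * norm (gs f n))"
        using q by (intro mult_left_mono fx) auto
      also have "\<dots> \<le> B1 + B2 + (B3 + B4)"
      proof (cases n rule: int_cases2)
        case (nonneg k)
        have y: "0 \<le> q ^ k" "q ^ k \<le> 1" using q by (auto simp: power_le_one)
        have "(q ^ k) ^ m * (norm (es f (int k)) + q ^ k * norm (gs f (int k))) \<le> 1 * (B3 + 1 * B4)"
          using y B0 B3 B4 by (intro mult_mono add_mono) (auto intro!: power_le_one)
        then show ?thesis using B0 nonneg by simp
      next
        case (nonpos k)
        define y where "y = q ^ k"
        have y: "0 < y" "y \<le> 1" using q by (auto simp: y_def power_le_one)
        have qk: "q powi (- int k) = 1 / y" "(q\<^sup>2) ^ k = y\<^sup>2"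
          by (simp_all add: y_def power_int_minus divide_inverse mult.commute flip: power_mult)
        have "(1 / y) ^ m * (norm (es f (- int k)) + 1 / y * norm (gs f (- int k)))
          \<le> (1 / y) ^ m * (B1 * (y\<^sup>2) ^ (m + 1) + 1 / y * (B2 * (y\<^sup>2) ^ (m + 1)))"
          using B1[of k] B2[of k] y unfolding qk by (intro mult_left_mono add_mono) auto
        also have "\<dots> = B1 * y ^ (m + 2) + B2 * y ^ (m + 1)"
        proof -
          have "(y\<^sup>2) ^ (m + 1) = y ^ m * y ^ (m + 2)" by (simp add: power_add power2_eq_square flip: power_mult)
            (simp add: power_mult_distrib)
          then show ?thesis using y by (simp add: field_simps)
        qed
        also have "\<dots> \<le> B1 * 1 + B2 * 1"
          using y B0 by (intro add_mono mult_left_mono power_le_one) auto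
        finally show ?thesis using B0 unfolding nonpos qk by simp
      qed
      finally show ?thesis .
    qed
    then show "bdd_above ((\<lambda>x. norm (complex_of_real (x ^ m) * f x)) ` q_lattice q)"
      by (intro bdd_aboveI2)
  }
  obtain l where l: "(\<lambda>k. es f (int k)) \<longlonglongrightarrow> l"
    using schwartz_seq_convergent[OF e] by (auto simp: convergent_def)
  have o: "(\<lambda>k. os f (int k)) \<longlonglongrightarrow> 0"
  proof (rule Lim_null_comparison)
    show "\<forall>\<^sub>F k in sequentially. norm (os f (int k)) \<le> B4 * q powi int k"
    proof (intro always_eventually allI)
      fix k
      have "norm (os f (int k)) = norm (gs f (int k)) * q ^ k"
        unfolding os_eq_gs using q by (simp add: norm_mult norm_power)
      also have "\<dots> \<le> B4 * q ^ k" using q by (intro mult_right_mono B4) auto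
      finally show "norm (os f (int k)) \<le> B4 * q powi int k" by simp
    qed
    show "(\<lambda>k. B4 * q powi int k) \<longlonglongrightarrow> 0" by (intro tendsto_mult_right_zero powi_null)
  qed
  have "(\<lambda>k. f (\<sigma> * q powi int k)) \<longlonglongrightarrow> l" if "\<bar>\<sigma>\<bar> = 1" for \<sigma>
    unfolding value_eq(1)[OF that] using tendsto_add[OF l tendsto_mult_right_zero[OF o]] by simp
  then show "\<exists>l. (f \<longlongrightarrow> l) (at 0 within q_lattice q)" unfolding tendsto_lattice_iff by blast
qed

text \<open>Near 0 the odd part is controlled through the limit, which is the same from both sides:
  f(x) - f(-x) tends to 0. This is weaker than boundedness of \<open>gs f\<close> and serves as the
  limit hypothesis of \<open>bd_of_diff\<close>.\<close>

lemma schwartz_at_bounds: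
  assumes f: "schwartz_at f"
  shows "dec (es f)" "dec (gs f)" "bd (es f)" "(\<lambda>k. q ^ k * norm (gs f (int k))) \<longlonglongrightarrow> 0"
proof -
  have eo: "norm (es f n) \<le> C" "norm (os f n) \<le> C"
    if "norm (f (q powi n)) \<le> C" "norm (f (- (q powi n))) \<le> C" for n C
    using that norm_triangle_ineq[of "f (q powi n)" "f (- (q powi n))"]
      norm_triangle_ineq4[of "f (q powi n)" "f (- (q powi n))"] by (simp_all add: es_def os_def norm_divide)
  have lat: "q powi n \<in> q_lattice q" "- (q powi n) \<in> q_lattice q" for n by (auto simp: q_lattice_def)
  have bound: "\<exists>B. \<forall>n. norm (es f n) \<le> B * (q powi (- n)) ^ m \<and> norm (os f n) \<le> B * (q powi (- n)) ^ m" for m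
  proof -
    obtain B where B: "\<And>x. x \<in> q_lattice q \<Longrightarrow> norm (complex_of_real (x ^ m) * f x) \<le> B"
      using f unfolding schwartz_at_def bdd_above_def by (meson image_eqI)
    have "norm (f x) \<le> B * (q powi (- n)) ^ m" if "x \<in> q_lattice q" "\<bar>x\<bar> = q powi n" for x n
    proof -
      have "(q powi n) ^ m * norm (f x) \<le> B" using B[OF that(1)] that(2)
        by (simp add: norm_mult norm_power)
      then show ?thesis using q by (simp add: power_int_minus field_simps)
    qed
    from this[OF lat(1)] this[OF lat(2)] show ?thesis using q by (intro exI[of _ B] allI conjI eo) auto
  qed
  have dec_of: "dec a" if bnd: "\<And>m. \<exists>B. \<forall>n. norm (a n) \<le> B * (q powi (- n)) ^ m" for a
    unfolding dec_def
  proof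
    fix m
    obtain B where B: "\<And>n. norm (a n) \<le> B * (q powi (- n)) ^ (2 * m)" using bnd[of "2 * m"] by blast
    have "norm (a (- int k)) \<le> B * ((q\<^sup>2) ^ k) ^ m" for k
    proof -
      have "((q\<^sup>2) ^ k) ^ m = (q ^ k) ^ (2 * m)" by (simp add: mult_ac flip: power_mult)
      then show ?thesis using B[of "- int k"] by simp
    qed
    then show "\<exists>B. \<forall>k. norm (a (- int k)) \<le> B * ((q\<^sup>2) ^ k) ^ m" by blast
  qed
  show "dec (es f)" using bound by (intro dec_of) blast
  have "dec (os f)" using bound by (intro dec_of) blast
  then have "dec (\<lambda>n. inverse (complex_of_real (q powi n)) * os f n)"
    using q by (intro dec_mult_bounded) (auto simp: norm_inverse norm_power power_int_minus power_le_one)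
  then show "dec (gs f)" by (simp add: gs_def[abs_def] divide_inverse mult.commute)
  show "bd (es f)" using bound[of 0] unfolding bd_def by auto
  obtain l where l: "(f \<longlongrightarrow> l) (at 0 within q_lattice q)" using f by (auto simp: schwartz_at_def)
  then have "(\<lambda>k. f (1 * q powi int k)) \<longlonglongrightarrow> l" "(\<lambda>k. f (- 1 * q powi int k)) \<longlonglongrightarrow> l"
    using l[unfolded tendsto_lattice_iff, rule_format, of 1] l[unfolded tendsto_lattice_iff, rule_format, of "- 1"]
    by simp_all
  from tendsto_norm[OF tendsto_divide[OF tendsto_diff[OF this] tendsto_const[of 2]]]
  have "(\<lambda>k. norm (os f (int k))) \<longlonglongrightarrow> 0" by (simp add: os_def)
  moreover have "norm (os f (int k)) = q ^ k * norm (gs f (int k))" for k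
    unfolding os_eq_gs using q by (simp add: norm_mult norm_power)
  ultimately show "(\<lambda>k. q ^ k * norm (gs f (int k))) \<longlonglongrightarrow> 0" by simp
qed

text \<open>Derivatives give \<open>DD\<close> of the even part directly, but of the odd part only
  the combination \<open>gs f n - q * gs f (n + 1)\<close>, which \<open>bd_of_diff\<close> inverts.
  The two bounds need each other: one \<open>DD\<close> on \<open>es f\<close> becomes
  \<open>gs\<close> of the derivative, so the induction is joint and over all
  \<open>f\<close>.\<close>

lemma bd_funpow_DD_es_gs:
  assumes "\<And>n. schwartz_at ((q_deriv q ^^ n) f)"
  shows "bd ((DD ^^ j) (es f)) \<and> bd ((DD ^^ j) (gs f))"
  using assms
proof (induction j arbitrary: f)
  have deriv: "schwartz_at ((q_deriv q ^^ n) (q_deriv q f))" if "\<And>n. schwartz_at ((q_deriv q ^^ n) f)" for f n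
    using that[of "Suc n"] by (simp only: funpow_Suc_right o_apply)
  have q1: "complex_of_real (1 - q) \<noteq> 0" using q by simp
  have gs_diff: "gs f n - of_real q * gs f (n + 1) = of_real (1 - q) * es (q_deriv q f) n" for f n
    unfolding es_gs_q_deriv using q1 by simp
  have DD_es: "DD (es f) = (\<lambda>n. of_real (1 - q) * gs (q_deriv q f) n)" for f
    unfolding es_gs_q_deriv using q1 by simp
  {
    case 0
    note b = schwartz_at_bounds[OF 0[of 0, simplified]]
    have "bd (gs f)"
    \<comment> \<open>The homogeneous solution q^(-k) is excluded because q^k times
      \<open>gs f\<close> tends to 0.\<close>
    proof (rule bd_of_diff[OF q b(4)])
      show "bd (\<lambda>n. gs f n - of_real q * gs f (n + 1))"
        unfolding gs_diff using schwartz_at_bounds(3)[OF deriv[OF 0, of 0, simplified]] by (rule bd_cmult)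
    qed
    then show ?case using b by simp
  next
    case (Suc j)
    have E: "bd ((DD ^^ Suc j) (es f))" if "\<And>n. schwartz_at ((q_deriv q ^^ n) f)" for f
      using Suc.IH[OF deriv[OF that]] by (simp only: funpow_Suc_right o_apply DD_es funpow_DD_cmult bd_cmult)
    define b where "b = (DD ^^ Suc j) (gs f)"
    \<comment> \<open>Applying \<open>DD\<close> j + 1 times multiplies the shift coefficient q by
      (q^2)^(j+1).\<close>
    define c where "c = q * (q\<^sup>2) ^ Suc j"
    have c: "0 < c" "c < 1" unfolding c_def
      using q Q_pos Q_power_less_1[of j] mult_strict_mono[of q 1 "(q\<^sup>2) ^ Suc j" 1] by simp_all
    have "bd b"
    proof (rule bd_of_diff[OF c])
      have "bd ((DD ^^ Suc j) (\<lambda>n. gs f n + - of_real q * gs f (n + 1)))"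
        using E[OF deriv[OF Suc.prems]] gs_diff[of f]
        by (simp only: mult_minus_left add_uminus_conv_diff funpow_DD_cmult bd_cmult)
      then show "bd (\<lambda>n. b n - of_real c * b (n + 1))"
        unfolding funpow_DD_add funpow_DD_cmult_shift b_def c_def by (simp add: mult_ac del: funpow.simps)
      obtain B where B: "\<And>k. norm ((DD ^^ j) (gs f) (int k)) \<le> B"
        using Suc.IH[OF Suc.prems] by (auto simp: bd_def)
      obtain B' where B': "\<And>k. norm ((DD ^^ j) (gs f) (int k + - 1)) \<le> B'"
        using bd_shift[of "(DD ^^ j) (gs f)" "- 1"] Suc.IH[OF Suc.prems] by (auto simp: bd_def)
      \<comment> \<open>A crude bound from the induction hypothesis: the loss (q^2)^(-k) is beaten
        by c^k, which leaves the ratio q (q^2)^j < 1.\<close>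
      have "norm (b (int k)) \<le> (B' + B) / (q\<^sup>2) ^ k" for k
      proof -
        have "norm (b (int k)) = norm ((DD ^^ j) (gs f) (int k + - 1) - (DD ^^ j) (gs f) (int k)) / (q\<^sup>2) ^ k"
          unfolding b_def using q by (simp add: DD_def norm_divide norm_power)
        also have "\<dots> \<le> (B' + B) / (q\<^sup>2) ^ k"
          using B[of k] B'[of k] norm_triangle_ineq4[of "(DD ^^ j) (gs f) (int k + - 1)" "(DD ^^ j) (gs f) (int k)"]
          by (intro divide_right_mono) auto
        finally show ?thesis .
      qed
      then have "c ^ k * norm (b (int k)) \<le> c ^ k * ((B' + B) / (q\<^sup>2) ^ k)" for k
        using c by (intro mult_left_mono) auto
      moreover have "c ^ k * (x / (q\<^sup>2) ^ k) = x * (q * (q\<^sup>2) ^ j) ^ k" for k and x :: real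
        unfolding c_def using q by (simp add: power_mult_distrib field_simps)
      ultimately have le: "c ^ k * norm (b (int k)) \<le> (B' + B) * (q * (q\<^sup>2) ^ j) ^ k" for k
        by metis
      have r: "0 \<le> q * (q\<^sup>2) ^ j" "q * (q\<^sup>2) ^ j < 1"
      proof -
        have "q * (q\<^sup>2) ^ j \<le> q * 1" using q Q_less_1 by (intro mult_left_mono power_le_one) auto
        then show "q * (q\<^sup>2) ^ j < 1" using q by linarith
      qed (use q in simp)
      show "(\<lambda>k. c ^ k * norm (b (int k))) \<longlonglongrightarrow> 0"
      proof (rule Lim_null_comparison)
        show "\<forall>\<^sub>F k in sequentially. norm (c ^ k * norm (b (int k))) \<le> (B' + B) * (q * (q\<^sup>2) ^ j) ^ k"
          using le c by (intro always_eventually) simp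
        show "(\<lambda>k. (B' + B) * (q * (q\<^sup>2) ^ j) ^ k) \<longlonglongrightarrow> 0"
          using r by (intro tendsto_mult_right_zero LIMSEQ_power_zero) simp
      qed
    qed
    then show ?case using E[OF Suc.prems] by (simp only: b_def)
  }
qed

lemma q_schwartz_iff: "f \<in> q_schwartz q \<longleftrightarrow> lattice_fun q f \<and> schwartz_pair f"
proof -
  have "(\<forall>n. schwartz_at ((q_deriv q ^^ n) f)) \<longleftrightarrow> schwartz_pair f"
  proof
    assume a: "\<forall>n. schwartz_at ((q_deriv q ^^ n) f)"
    then have "schwartz_at ((q_deriv q ^^ 0) f)" by blast
    then show "schwartz_pair f"
      using bd_funpow_DD_es_gs[of f] a schwartz_at_bounds(1,2)[of f]
      by (auto simp: schwartz_pair_def schwartz_seq_def)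
  next
    assume "schwartz_pair f"
    then have "schwartz_pair ((q_deriv q ^^ n) f)" for n
      by (induction n) (simp_all add: schwartz_pair_q_deriv)
    then show "\<forall>n. schwartz_at ((q_deriv q ^^ n) f)" using schwartz_at_pair by blast
  qed
  then show ?thesis by (simp add: q_schwartz_iff_at)
qed

section \<open>Inclusions and invariance of the Schwartz space\<close>

lemma q_schwartz_subset_L2: "q_schwartz q \<subseteq> Lq 2 \<alpha> q"
proof
  fix f assume f: "f \<in> q_schwartz q"
  have "schwartz_seq (es f)" "schwartz_seq (gs f)" using f by (auto simp: q_schwartz_iff schwartz_pair_def)
  then have "l2 (ev f)" "l2 (od f)" unfolding ev_od_eq by (blast intro: l2_schwartz_seq s qs)+
  then show "f \<in> Lq 2 \<alpha> q" using f by (simp add: Lq_2_iff q_schwartz_iff)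
qed

lemma q_schwartz_subset_L1: "q_schwartz q \<subseteq> Lq 1 \<alpha> q"
proof
  fix f assume f: "f \<in> q_schwartz q"
  then have e: "schwartz_seq (es f)" and g: "schwartz_seq (gs f)" by (auto simp: q_schwartz_iff schwartz_pair_def)
  \<comment> \<open>The odd part is q^n times \<open>gs f\<close>, so its weight is q w instead of
    w.\<close>
  have wq: "0 < q * w" "q * w < 1" using q w mult_strict_mono[of q 1 w 1] by simp_all
  have sm: "(\<lambda>n. 2 * norm (complex_of_real (w powi n * 1) * es f n) + 2 * norm (complex_of_real ((q * w) powi n * 1) * gs f n)) summable_on UNIV"
    by (intro summable_on_add summable_on_cmult_right weighted_summable[where C = 1] schwartz_seq_dec schwartz_seq_bd e g w wq) auto
  have "jackson_integrable q (\<lambda>x. norm (f x) powr 1 * \<bar>x\<bar> powr (2 * \<alpha> + 1))"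
    unfolding jackson_integrable_def
  proof (rule summable_on_comparison_test[OF sm])
    fix n
    have v: "norm (f (q powi n)) \<le> norm (es f n) + norm (os f n)" "norm (f (- (q powi n))) \<le> norm (es f n) + norm (os f n)"
      using value_eq(1)[of 1 f n] value_eq(1)[of "- 1" f n] norm_triangle_ineq[of "es f n" "os f n"]
        norm_triangle_ineq4[of "es f n" "os f n"] by simp_all
    have o: "norm (os f n) = q powi n * norm (gs f n)" unfolding os_eq_gs using q by (simp add: norm_mult norm_power_int)
    have "q powi n * (norm (norm (f (q powi n)) powr 1 * \<bar>q powi n\<bar> powr (2 * \<alpha> + 1))
        + norm (norm (f (- (q powi n))) powr 1 * \<bar>- (q powi n)\<bar> powr (2 * \<alpha> + 1)))
      = (q powi n * (q powi n) powr (2 * \<alpha> + 1)) * (norm (f (q powi n)) + norm (f (- (q powi n))))"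
      using q by (simp add: algebra_simps)
    also have "\<dots> \<le> (s powi n * s powi n) * (2 * norm (es f n) + 2 * (q powi n * norm (gs f n)))"
      unfolding weight_eq o[symmetric] using v s by (intro mult_left_mono) auto
    also have "\<dots> = 2 * norm (complex_of_real (w powi n * 1) * es f n) + 2 * norm (complex_of_real ((q * w) powi n * 1) * gs f n)"
      using q s by (simp add: norm_mult norm_power_int power2_eq_square power_int_mult_distrib algebra_simps)
    finally show "q powi n * (norm (norm (f (q powi n)) powr 1 * \<bar>q powi n\<bar> powr (2 * \<alpha> + 1))
        + norm (norm (f (- (q powi n))) powr 1 * \<bar>- (q powi n)\<bar> powr (2 * \<alpha> + 1)))
      \<le> 2 * norm (complex_of_real (w powi n * 1) * es f n) + 2 * norm (complex_of_real ((q * w) powi n * 1) * gs f n)" .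
  qed (use q in auto)
  then show "f \<in> Lq 1 \<alpha> q" using f by (simp add: Lq_def q_schwartz_iff)
qed

lemma mat_app_Mat_eq_H:
  assumes "0 < t"
  shows "mat_app (Mat t) (\<lambda>n. of_real (t powi n) * a n) m = of_real (t powi (m + K) / E (q\<^sup>2)) * H (t\<^sup>2) a (m + K)"
proof -
  have "complex_of_real (Mat t m n) * (of_real (t powi n) * a n)
    = of_real (t powi (m + K) / E (q\<^sup>2)) * (complex_of_real ((t\<^sup>2) powi n * h (t\<^sup>2) (n + (m + K))) * a n)" for n
  proof -
    have "t powi (n + m + K) = t powi n * t powi (m + K)"
      using assms power_int_add[of t n "m + K"] by (simp add: add.assoc)
    then show ?thesis
      by (simp add: Mat_def power2_eq_square power_int_mult_distrib add.assoc)
  qed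
  then show ?thesis unfolding mat_app_def H_def by (simp only: infsum_cmult_right')
qed

text \<open>Once the powers of t cancel, the transform acts as \<open>H\<close> on the even part and
  as \<open>H\<close> of the next order on the odd part divided by x, each shifted by
  \<open>K\<close>. The division by x is thus compatible with the transform, and
  \<open>schwartz_seq_H\<close> applies to both.\<close>

lemma q_dunkl_schwartz:
  assumes f: "f \<in> q_schwartz q"
  shows "q_dunkl q \<alpha> f \<in> q_schwartz q"
proof -
  have e: "schwartz_seq (es f)" and g: "schwartz_seq (gs f)" using f by (auto simp: q_schwartz_iff schwartz_pair_def)
  have l: "l2 (ev f)" "l2 (od f)" using f q_schwartz_subset_L2 by (auto simp: Lq_2_iff)
  have cancel: "y = of_real (t powi K / c) * x"
    if "of_real (t powi m) * y = of_real (t powi (m + K) / c) * x" "0 < t" for t c m and x y :: complex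
  proof -
    have "of_real (t powi m) * y = of_real (t powi m) * (of_real (t powi K / c) * x)"
      using that by (simp add: power_int_add)
    then show ?thesis using that(2) by (subst (asm) mult_left_cancel) auto
  qed
  have qs2: "0 < (q * s)\<^sup>2" "(q * s)\<^sup>2 < 1" using qs by (auto simp: power_less_one_iff)
  have "es (q_dunkl q \<alpha> f) = (\<lambda>m. of_real (s powi K / E (q\<^sup>2)) * H w (es f) (m + K))"
  proof
    fix m
    have "of_real (s powi m) * es (q_dunkl q \<alpha> f) m = of_real (s powi (m + K) / E (q\<^sup>2)) * H w (es f) (m + K)"
      using fun_cong[OF ev_od_q_dunkl(1)[OF l], of m] mat_app_Mat_eq_H[OF s(1), of "es f" m]
      unfolding ev_od_eq by simp
    then show "es (q_dunkl q \<alpha> f) m = of_real (s powi K / E (q\<^sup>2)) * H w (es f) (m + K)"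
      by (rule cancel[OF _ s(1)])
  qed
  moreover have "gs (q_dunkl q \<alpha> f) = (\<lambda>m. of_real ((q * s) powi K / E (q\<^sup>2)) * (- \<i> * H ((q * s)\<^sup>2) (gs f) (m + K)))"
  proof
    fix m
    have "of_real ((q * s) powi m) * gs (q_dunkl q \<alpha> f) m
      = of_real ((q * s) powi (m + K) / E (q\<^sup>2)) * (- \<i> * H ((q * s)\<^sup>2) (gs f) (m + K))"
      using fun_cong[OF ev_od_q_dunkl(2)[OF l], of m] mat_app_Mat_eq_H[OF qs(1), of "gs f" m]
      unfolding ev_od_eq by simp
    then show "gs (q_dunkl q \<alpha> f) m = of_real ((q * s) powi K / E (q\<^sup>2)) * (- \<i> * H ((q * s)\<^sup>2) (gs f) (m + K))"
      by (rule cancel[OF _ qs(1)])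
  qed
  ultimately have "schwartz_pair (q_dunkl q \<alpha> f)"
    unfolding schwartz_pair_def mult.assoc[symmetric]
    by (simp only:) (intro conjI schwartz_seq_cmult_shift schwartz_seq_H w qs2 e g)
  then show ?thesis by (simp add: q_schwartz_iff lattice_fun_q_dunkl)
qed

end

section \<open>The Plancherel theorem\<close>

context dunkl_setting
begin

lemma ev_od_add:
  "ev (\<lambda>x. f x + g x) = (\<lambda>n. ev f n + ev g n)" "od (\<lambda>x. f x + g x) = (\<lambda>n. od f n + od g n)"
  by (auto simp: ev_def od_def es_def os_def algebra_simps add_divide_distrib diff_divide_distrib)

lemma ev_od_cmult:
  "ev (\<lambda>x. c * f x) = (\<lambda>n. c * ev f n)" "od (\<lambda>x. c * f x) = (\<lambda>n. c * od f n)"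
  by (auto simp: ev_def od_def es_def os_def algebra_simps)

lemma L2_add: "f \<in> Lq 2 \<alpha> q \<Longrightarrow> g \<in> Lq 2 \<alpha> q \<Longrightarrow> (\<lambda>x. f x + g x) \<in> Lq 2 \<alpha> q"
  by (simp add: Lq_2_iff ev_od_add l2_add lattice_fun_def)

lemma L2_cmult: "f \<in> Lq 2 \<alpha> q \<Longrightarrow> (\<lambda>x. c * f x) \<in> Lq 2 \<alpha> q"
  by (simp add: Lq_2_iff ev_od_cmult l2_cmult lattice_fun_def)

lemma q_dunkl_add:
  assumes f: "f \<in> Lq 2 \<alpha> q" and g: "g \<in> Lq 2 \<alpha> q"
  shows "q_dunkl q \<alpha> (\<lambda>x. f x + g x) = (\<lambda>x. q_dunkl q \<alpha> f x + q_dunkl q \<alpha> g x)"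
proof (rule lattice_fun_eqI)
  have l: "l2 (ev f)" "l2 (od f)" "l2 (ev g)" "l2 (od g)" "l2 (ev (\<lambda>x. f x + g x))" "l2 (od (\<lambda>x. f x + g x))"
    using f g L2_add[OF f g] by (auto simp: Lq_2_iff)
  note T = ev_od_q_dunkl[OF l(1,2)] ev_od_q_dunkl[OF l(3,4)] ev_od_q_dunkl[OF l(5,6)]
  show "ev (q_dunkl q \<alpha> (\<lambda>x. f x + g x)) = ev (\<lambda>x. q_dunkl q \<alpha> f x + q_dunkl q \<alpha> g x)"
    unfolding ev_od_add T using even.mat_app_add[OF l(1,3)] by auto
  show "od (q_dunkl q \<alpha> (\<lambda>x. f x + g x)) = od (\<lambda>x. q_dunkl q \<alpha> f x + q_dunkl q \<alpha> g x)"
    unfolding ev_od_add T using odd.mat_app_add[OF l(2,4)] by (auto simp: algebra_simps)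
  show "lattice_fun q (\<lambda>x. q_dunkl q \<alpha> f x + q_dunkl q \<alpha> g x)"
    by (simp add: lattice_fun_def q_dunkl_def)
qed (rule lattice_fun_q_dunkl)

lemma q_dunkl_cmult:
  assumes f: "f \<in> Lq 2 \<alpha> q"
  shows "q_dunkl q \<alpha> (\<lambda>x. c * f x) = (\<lambda>x. c * q_dunkl q \<alpha> f x)"
proof (rule lattice_fun_eqI)
  have l: "l2 (ev f)" "l2 (od f)" "l2 (ev (\<lambda>x. c * f x))" "l2 (od (\<lambda>x. c * f x))"
    using f L2_cmult[OF f] by (auto simp: Lq_2_iff)
  note T = ev_od_q_dunkl[OF l(1,2)] ev_od_q_dunkl[OF l(3,4)]
  show "ev (q_dunkl q \<alpha> (\<lambda>x. c * f x)) = ev (\<lambda>x. c * q_dunkl q \<alpha> f x)"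
    unfolding ev_od_cmult T by (auto simp: mat_app_cmult)
  show "od (q_dunkl q \<alpha> (\<lambda>x. c * f x)) = od (\<lambda>x. c * q_dunkl q \<alpha> f x)"
    unfolding ev_od_cmult T by (auto simp: mat_app_cmult)
  show "lattice_fun q (\<lambda>x. c * q_dunkl q \<alpha> f x)" by (simp add: lattice_fun_def q_dunkl_def)
qed (rule lattice_fun_q_dunkl)

lemma q_dunkl_L2:
  assumes f: "f \<in> Lq 2 \<alpha> q"
  shows "q_dunkl q \<alpha> f \<in> Lq 2 \<alpha> q" "Lq_norm 2 \<alpha> q (q_dunkl q \<alpha> f) = Lq_norm 2 \<alpha> q f"
proof -
  have l: "l2 (ev f)" "l2 (od f)" using f by (auto simp: Lq_2_iff)
  note T = ev_od_q_dunkl[OF l]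
  show T2: "q_dunkl q \<alpha> f \<in> Lq 2 \<alpha> q"
    unfolding Lq_2_iff T by (intro conjI lattice_fun_q_dunkl l2_cmult even.mat_app_l2 odd.mat_app_l2 l)
  show "Lq_norm 2 \<alpha> q (q_dunkl q \<alpha> f) = Lq_norm 2 \<alpha> q f"
    unfolding Lq_norm_2_eq[OF f] Lq_norm_2_eq[OF T2] T l2_norm2_cmult
      even.mat_app_isometry[OF l(1)] odd.mat_app_isometry[OF l(2)] by simp
qed

lemma q_dunkl_L2_reflect: "f \<in> Lq 2 \<alpha> q \<Longrightarrow> q_dunkl q \<alpha> (q_dunkl q \<alpha> f) = (\<lambda>x. f (- x))"
  by (rule q_dunkl_q_dunkl) (auto simp: Lq_2_iff)

text \<open>The square is a reflection, so the fourth power is the identity and the cube inverts the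
  transform.\<close>

lemma q_dunkl_cubed:
  assumes f: "f \<in> Lq 2 \<alpha> q"
  defines "T \<equiv> q_dunkl q \<alpha>"
  shows "T (T (T f)) = (\<lambda>x. T f (- x))" "T (T (T (T f))) = f"
  using q_dunkl_L2_reflect[OF f] q_dunkl_L2_reflect[OF q_dunkl_L2(1)[OF f]]
    q_dunkl_L2_reflect[OF q_dunkl_L2(1)[OF q_dunkl_L2(1)[OF f]]]
  by (simp_all add: T_def)

text \<open>As the inverse is the cube, a set invariant under the transform is invariant under its
  inverse as well, which gives surjectivity. This covers the Schwartz space and L^2 at once.\<close>

lemma linear_iso_onto_q_dunkl:
  assumes V: "V \<subseteq> Lq 2 \<alpha> q" "\<And>f. f \<in> V \<Longrightarrow> q_dunkl q \<alpha> f \<in> V"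
  shows "linear_iso_onto V (q_dunkl q \<alpha>)"
  unfolding linear_iso_onto_def
proof (intro conjI ballI allI)
  show "bij_betw (q_dunkl q \<alpha>) V V"
    using V q_dunkl_cubed(2)
    by (intro bij_betwI[where g = "\<lambda>f. q_dunkl q \<alpha> (q_dunkl q \<alpha> (q_dunkl q \<alpha> f))"]) auto
qed (use V in \<open>auto intro!: q_dunkl_add q_dunkl_cmult\<close>)

lemma isometric_extension_q_dunkl: "isometric_extension q \<alpha> (q_dunkl q \<alpha>)"
  unfolding isometric_extension_def
  by (auto intro!: linear_iso_onto_q_dunkl q_dunkl_L2)

text \<open>Every lattice point has positive mass, so point evaluation is continuous in L^2 and two
  extensions can be compared at single points.\<close>

lemma norm_point_le:
  assumes u: "u \<in> Lq 2 \<alpha> q" and x: "\<bar>\<sigma>\<bar> = 1"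
  shows "norm (u (\<sigma> * q powi n)) \<le> 2 / (s powi n * sqrt (2 * (1 - q))) * Lq_norm 2 \<alpha> q u"
proof -
  have l: "l2 (ev u)" "l2 (od u)" using u by (auto simp: Lq_2_iff)
  define A where "A = l2_norm2 (ev u) + l2_norm2 (od u)"
  have nn: "0 \<le> l2_norm2 (ev u)" "0 \<le> l2_norm2 (od u)"
    unfolding l2_norm2_def by (auto intro!: infsum_nonneg)
  have "norm (ev u n) \<le> sqrt A" "norm (od u n) \<le> sqrt A"
    using l2_point_le[OF l(1), of n] l2_point_le[OF l(2), of n] nn by (auto simp: A_def intro!: real_le_rsqrt)
  moreover have "norm (of_real (s powi n) * u (\<sigma> * q powi n)) \<le> norm (ev u n) + norm (of_real \<sigma> * od u n)"
    unfolding value_eq(2)[OF x] by (rule norm_triangle_ineq)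
  ultimately have "s powi n * norm (u (\<sigma> * q powi n)) \<le> 2 * sqrt A"
    using x s by (simp add: norm_mult norm_power_int)
  then have "norm (u (\<sigma> * q powi n)) \<le> 2 * sqrt A / s powi n"
    using s by (simp add: pos_le_divide_eq mult.commute)
  moreover have "Lq_norm 2 \<alpha> q u = sqrt (2 * (1 - q)) * sqrt A"
    unfolding Lq_norm_2_eq[OF u] A_def by (simp add: real_sqrt_mult)
  ultimately show ?thesis using q by simp
qed

text \<open>Lattice functions with finite support are Schwartz functions and dense in \<open>L\<^sup>2\<close>.\<close>

lemma isometric_extension_unique:
  assumes T: "isometric_extension q \<alpha> T" and T': "isometric_extension q \<alpha> T'" and f: "f \<in> Lq 2 \<alpha> q"
  shows "T f = T' f"
proof
  fix x
  have lat: "lattice_fun q (U f)" if "isometric_extension q \<alpha> U" for U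
    using that f unfolding isometric_extension_def linear_iso_onto_def bij_betw_def Lq_def by blast
  show "T f x = T' f x"
  proof (cases "x \<in> q_lattice q")
    case False
    then show ?thesis using lat[OF T] lat[OF T'] by (simp add: lattice_fun_def)
  next
    case True
    then obtain \<sigma> m where x: "\<bar>\<sigma>\<bar> = 1" "x = \<sigma> * q powi m" by (rule lattice_cases)
    define c where "c = 2 / (s powi m * sqrt (2 * (1 - q)))"
    \<comment> \<open>\<open>p F\<close> is the finitely supported part and \<open>r F\<close> the
      remainder; cutting by |y| treats even and odd part alike.\<close>
    define r where "r F y = (if \<bar>y\<bar> \<in> (powi) q ` F then 0 else f y)" for F y
    define p where "p F y = (if \<bar>y\<bar> \<in> (powi) q ` F then f y else 0)" for F y
    have mem: "\<bar>q powi n\<bar> \<in> (powi) q ` F \<longleftrightarrow> n \<in> F" for n F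
      using q power_int_inject_real[OF q, of n] by auto
    have evr: "ev (r F) = (\<lambda>n. if n \<in> F then 0 else ev f n)" "od (r F) = (\<lambda>n. if n \<in> F then 0 else od f n)" for F
      using mem by (auto simp: ev_def od_def es_def os_def r_def)
    have lf: "lattice_fun q f" "l2 (ev f)" "l2 (od f)" using f by (auto simp: Lq_2_iff)
    have fpr: "f = (\<lambda>y. p F y + r F y)" for F by (auto simp: p_def r_def)
    have rL: "r F \<in> Lq 2 \<alpha> q" if "finite F" for F
      unfolding Lq_2_iff evr using l2_truncate(2)[OF lf(2) that] l2_truncate(2)[OF lf(3) that] lf(1)
      by (auto simp: lattice_fun_def r_def)
    have pS: "p F \<in> q_schwartz q" if "finite F" for F
    proof -
      have sub: "{n. es (p F) n \<noteq> 0} \<subseteq> F" "{n. gs (p F) n \<noteq> 0} \<subseteq> F"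
        using mem by (auto simp: es_def gs_def os_def p_def split: if_splits)
      have "schwartz_pair (p F)"
        unfolding schwartz_pair_def by (intro conjI schwartz_seq_finite_support finite_subset[OF sub(1) that] finite_subset[OF sub(2) that])
      then show ?thesis using lf(1) by (auto simp: q_schwartz_iff lattice_fun_def p_def)
    qed
    \<comment> \<open>An extension is prescribed on \<open>p F\<close>, whereas on
      \<open>r F\<close> only its norm is known; that norm becomes small as F grows.\<close>
    have ext: "U f x = q_dunkl q \<alpha> (p F) x + U (r F) x \<and> norm (U (r F) x) \<le> c * Lq_norm 2 \<alpha> q (r F)"
      if U: "isometric_extension q \<alpha> U" and F: "finite F" for U F
    proof
      have pL: "p F \<in> Lq 2 \<alpha> q" using pS[OF F] q_schwartz_subset_L2 by blast
      have "U (\<lambda>y. p F y + r F y) = (\<lambda>y. U (p F) y + U (r F) y)"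
        using U pL rL[OF F] unfolding isometric_extension_def linear_iso_onto_def by blast
      moreover have "U (p F) = q_dunkl q \<alpha> (p F)"
        using U pS[OF F] unfolding isometric_extension_def by blast
      ultimately show "U f x = q_dunkl q \<alpha> (p F) x + U (r F) x" using fpr[of F] by metis
      have "U (r F) \<in> Lq 2 \<alpha> q" "Lq_norm 2 \<alpha> q (U (r F)) = Lq_norm 2 \<alpha> q (r F)"
        using U rL[OF F] unfolding isometric_extension_def linear_iso_onto_def bij_betw_def by blast+
      then show "norm (U (r F) x) \<le> c * Lq_norm 2 \<alpha> q (r F)"
        using norm_point_le[of "U (r F)" \<sigma> m] x by (simp add: c_def)
    qed
    have bound: "norm (T f x - T' f x) \<le> 2 * c * sqrt (2 * (1 - q) * (l2_norm2 (\<lambda>n. if n \<in> F then 0 else ev f n)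
        + l2_norm2 (\<lambda>n. if n \<in> F then 0 else od f n)))" if F: "finite F" for F
    proof -
      have "norm (T f x - T' f x) = norm (T (r F) x - T' (r F) x)"
        using ext[OF T F] ext[OF T' F] by simp
      also have "\<dots> \<le> norm (T (r F) x) + norm (T' (r F) x)" by (rule norm_triangle_ineq4)
      also have "\<dots> \<le> 2 * c * Lq_norm 2 \<alpha> q (r F)" using ext[OF T F] ext[OF T' F] by simp
      finally show ?thesis unfolding Lq_norm_2_eq[OF rL[OF F]] evr .
    qed
    have "((\<lambda>F. 2 * c * sqrt (2 * (1 - q) * (l2_norm2 (\<lambda>n. if n \<in> F then 0 else ev f n)
        + l2_norm2 (\<lambda>n. if n \<in> F then 0 else od f n)))) \<longlongrightarrow> 2 * c * sqrt (2 * (1 - q) * (0 + 0)))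
        (finite_subsets_at_top UNIV)"
      by (intro tendsto_mult tendsto_const tendsto_real_sqrt tendsto_add l2_tail_tendsto lf)
    then have "norm (T f x - T' f x) \<le> 2 * c * sqrt (2 * (1 - q) * (0 + 0))"
      by (rule tendsto_lowerbound[OF _ eventually_finite_subsets_at_top_weakI[OF bound]]) simp_all
    then show ?thesis by simp
  qed
qed

lemma dunkl_kernel_commute: "dunkl_kernel q \<alpha> l x = dunkl_kernel q \<alpha> x l"
  by (simp add: dunkl_kernel_def mult.commute)

text \<open>The inverse is the cube, that is, the transform followed by the reflection. At -x the
  kernel parameter -(-x) is x again, and symmetry of the kernel brings the integral into the stated
  form.\<close>

lemma q_dunkl_inverse:
  assumes f: "f \<in> Lq 2 \<alpha> q" and x: "x \<in> q_lattice q"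
  defines "g \<equiv> \<lambda>l. f l * dunkl_kernel q \<alpha> l x * complex_of_real (\<bar>l\<bar> powr (2 * \<alpha> + 1))"
  shows "jackson_integrable q g"
    "inv_into (Lq 2 \<alpha> q) (q_dunkl q \<alpha>) f x = q_dunkl q \<alpha> f (- x)"
    "q_dunkl q \<alpha> f (- x) = complex_of_real (c_const q \<alpha> / 2) * jackson_integral q g"
proof -
  have l: "l2 (ev f)" "l2 (od f)" using f by (auto simp: Lq_2_iff)
  obtain \<tau> m where tm: "\<bar>\<tau>\<bar> = 1" "x = \<tau> * q powi m" using x by (rule lattice_cases)
  show "jackson_integrable q g"
    using kernel_integral(1)[OF l tm(1), of m] unfolding g_def dunkl_kernel_commute[of _ x] tm(2)[symmetric] .
  show "q_dunkl q \<alpha> f (- x) = complex_of_real (c_const q \<alpha> / 2) * jackson_integral q g"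
    unfolding g_def dunkl_kernel_commute[of _ x] using x by (simp add: q_dunkl_def uminus_lattice)
  have "bij_betw (q_dunkl q \<alpha>) (Lq 2 \<alpha> q) (Lq 2 \<alpha> q)"
    using linear_iso_onto_q_dunkl[of "Lq 2 \<alpha> q"] q_dunkl_L2(1) unfolding linear_iso_onto_def by blast
  then have "inv_into (Lq 2 \<alpha> q) (q_dunkl q \<alpha>) f = q_dunkl q \<alpha> (q_dunkl q \<alpha> (q_dunkl q \<alpha> f))"
    by (intro inv_into_f_eq q_dunkl_cubed f q_dunkl_L2) (simp add: bij_betw_def)
  then show "inv_into (Lq 2 \<alpha> q) (q_dunkl q \<alpha>) f x = q_dunkl q \<alpha> f (- x)"
    using q_dunkl_cubed(1)[OF f] by simp
qed

end

theorem theorem11: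
  fixes q \<alpha> :: real
  assumes q: "0 < q" "q < 1"
    and q_even: "\<exists>k::int. ln (1 - q) / ln q = 2 * real_of_int k"
    and \<alpha>: "\<alpha> \<ge> - 1 / 2"
  shows
    "(q_schwartz q \<subseteq> Lq 1 \<alpha> q \<and>
      q_schwartz q \<subseteq> Lq 2 \<alpha> q \<and>
      linear_iso_onto (q_schwartz q) (q_dunkl q \<alpha>) \<and>
      (\<forall>f\<in>q_schwartz q. Lq_norm 2 \<alpha> q (q_dunkl q \<alpha> f) = Lq_norm 2 \<alpha> q f))
     \<and>
     (\<exists>T. isometric_extension q \<alpha> T \<and>
       (\<forall>T'. isometric_extension q \<alpha> T' \<longrightarrow> (\<forall>f\<in>Lq 2 \<alpha> q. T' f = T f)) \<and>
       (\<forall>f\<in>Lq 2 \<alpha> q. \<forall>x\<in>q_lattice q.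
          jackson_integrable q
            (\<lambda>l. f l * dunkl_kernel q \<alpha> l x * complex_of_real (\<bar>l\<bar> powr (2 * \<alpha> + 1))) \<and>
          inv_into (Lq 2 \<alpha> q) T f x =
            complex_of_real (c_const q \<alpha> / 2)
            * jackson_integral q
                (\<lambda>l. f l * dunkl_kernel q \<alpha> l x * complex_of_real (\<bar>l\<bar> powr (2 * \<alpha> + 1))) \<and>
          inv_into (Lq 2 \<alpha> q) T f x = T f (- x)))"
proof -
  obtain k :: int where k: "ln (1 - q) / ln q = 2 * real_of_int k" using q_even by blast
  have "ln q \<noteq> 0" using q by simp
  then have "ln (1 - q) = real_of_int (2 * k) * ln q" using k by (simp add: field_simps)
  \<comment> \<open>Exponentiated, the hypothesis says that 1 - q is a lattice point; it supplies
    the locale parameter \<open>K\<close> as 2 * k.\<close>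
  then have "1 - q = q powr real_of_int (2 * k)"
    using q by (metis diff_gt_0_iff_gt exp_ln powr_def less_irrefl)
  then have K: "1 - q = q powi (2 * k)" using q powr_real_of_int'[of q "2 * k"] by simp
  interpret dunkl_setting q \<alpha> "2 * k"
    using q K \<alpha> by unfold_locales auto
  show ?thesis
  proof (intro conjI exI[of _ "q_dunkl q \<alpha>"] allI impI ballI)
    show "q_schwartz q \<subseteq> Lq 1 \<alpha> q" by (rule q_schwartz_subset_L1)
    show "q_schwartz q \<subseteq> Lq 2 \<alpha> q" by (rule q_schwartz_subset_L2)
    show "linear_iso_onto (q_schwartz q) (q_dunkl q \<alpha>)"
      by (rule linear_iso_onto_q_dunkl[OF q_schwartz_subset_L2 q_dunkl_schwartz])
    show "Lq_norm 2 \<alpha> q (q_dunkl q \<alpha> f) = Lq_norm 2 \<alpha> q f" if "f \<in> q_schwartz q" for f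
      using that q_schwartz_subset_L2 by (intro q_dunkl_L2) auto
    show "isometric_extension q \<alpha> (q_dunkl q \<alpha>)" by (rule isometric_extension_q_dunkl)
    show "T' f = q_dunkl q \<alpha> f" if "isometric_extension q \<alpha> T'" "f \<in> Lq 2 \<alpha> q" for T' f
      by (rule isometric_extension_unique[OF that(1) isometric_extension_q_dunkl that(2)])
    fix f x assume fx: "f \<in> Lq 2 \<alpha> q" "x \<in> q_lattice q"
    note inv = q_dunkl_inverse[OF fx]
    show "jackson_integrable q
        (\<lambda>l. f l * dunkl_kernel q \<alpha> l x * complex_of_real (\<bar>l\<bar> powr (2 * \<alpha> + 1)))"
      by (rule inv(1))
    show "inv_into (Lq 2 \<alpha> q) (q_dunkl q \<alpha>) f x = q_dunkl q \<alpha> f (- x)" by (rule inv(2))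
    then show "inv_into (Lq 2 \<alpha> q) (q_dunkl q \<alpha>) f x = complex_of_real (c_const q \<alpha> / 2)
        * jackson_integral q
            (\<lambda>l. f l * dunkl_kernel q \<alpha> l x * complex_of_real (\<bar>l\<bar> powr (2 * \<alpha> + 1)))"
      using inv(3) by (rule trans)
  qed
qed

end
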